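(* Let $d\ge 1$, $1<p,q,r<\infty$, $0\le t<s$, $\frac ts\le\theta\le 1$, $\alpha\in\,]-d/p,d/p'[$, $\beta\in\,]-d/q,d/q'[$ and $\gamma>-d/r$. Assume that $$\frac1r-\frac{t-\gamma}{d}=\theta\left(\frac1p-\frac{s-\alpha}{d}\right)+(1-\theta)\left(\frac1q+\frac{\beta}{d}\right)$$ and $$0\le\theta\alpha+(1-\theta)\beta-\gamma\le\theta s-t.$$ Then there is a constant $C>0$, not depending on $f$, such that $$\||x|^\gamma D^tf\|_{L^r(\mathbb R^d)}\le C\,\||x|^\alpha D^sf\|_{L^p(\mathbb R^d)}^{\theta}\,\||x|^\beta f\|_{L^q(\mathbb R^d)}^{1-\theta}\quad\text{for all } f\in\mathcal S(\mathbb R^d).$$ Moreover, the same inequality holds with $D^t,D^s$ replaced by $J^t,J^s$ respectively.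
   Context: $\mathcal S(\mathbb R^d)$ is the Schwartz space; $p'$ is the conjugate exponent, $\frac1p+\frac1{p'}=1$ (similarly $q'$). Fourier transform: $\hat f(\xi)=\int e^{-2\pi i x\cdot\xi}f(x)\,dx$, with inverse denoted ${}^\vee$. For $f\in\mathcal S(\mathbb R^d)$ and $\operatorname{Re}(z)>-d$, $D^zf=(|\cdot|^z\hat f)^\vee$, i.e. $D^zf(x)=\int e^{2\pi i x\cdot\xi}|\xi|^z\hat f(\xi)\,d\xi$. For $z\in\mathbb C$, $J^zf=(\langle\cdot\rangle^z\hat f)^\vee$ with $\langle\xi\rangle=(1+|\xi|^2)^{1/2}$. *)

theory Defs
  imports "HOL-Analysis.Analysis"
begin

text \<open>
  The space \<open>\<real>\<^sup>d\<close> is rendered by an arbitrary type of class \<^class>\<open>euclidean_space\<close>, with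
  \<open>d = DIM('a) \<ge> 1\<close>.
\<close>

primrec iter_partial :: "'a::euclidean_space list \<Rightarrow> ('a \<Rightarrow> complex) \<Rightarrow> 'a \<Rightarrow> complex" where
  "iter_partial [] f = f"
| "iter_partial (b # bs) f = (\<lambda>x. frechet_derivative (iter_partial bs f) (at x) b)"

text \<open>
  A function is smooth iff all its iterated partial derivatives exist and are (Frechet)
  differentiable everywhere. A multi-index is represented by a list of basis vectors.
\<close>

definition schwartz_space :: "('a::euclidean_space \<Rightarrow> complex) set" where
  "schwartz_space = {f. \<forall>bs. set bs \<subseteq> Basis \<longrightarrow>
      (\<forall>x. iter_partial bs f differentiable (at x)) \<and>
      (\<forall>k. \<exists>M. \<forall>x. norm x ^ k * norm (iter_partial bs f x) \<le> M)}"

definition fourier :: "('a::euclidean_space \<Rightarrow> complex) \<Rightarrow> 'a \<Rightarrow> complex" where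
  "fourier f \<xi> = (\<integral>x. exp (- 2 * of_real pi * \<i> * of_real (x \<bullet> \<xi>)) * f x \<partial>lborel)"

definition inv_fourier :: "('a::euclidean_space \<Rightarrow> complex) \<Rightarrow> 'a \<Rightarrow> complex" where
  "inv_fourier g x = (\<integral>\<xi>. exp (2 * of_real pi * \<i> * of_real (x \<bullet> \<xi>)) * g \<xi> \<partial>lborel)"

text \<open>
  Since \<^prop>\<open>0 powr z = 0\<close> for every \<open>z\<close>, the symbol \<open>\<bar>\<xi>\<bar>\<^sup>z\<close> is given the value \<open>0\<close> at the origin,
  also for \<open>z = 0\<close>; this only affects the integrand on a null set.
\<close>

definition D_op :: "complex \<Rightarrow> ('a::euclidean_space \<Rightarrow> complex) \<Rightarrow> 'a \<Rightarrow> complex" where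
  "D_op z f = inv_fourier (\<lambda>\<xi>. of_real (norm \<xi>) powr z * fourier f \<xi>)"

definition japanese_bracket :: "'a::euclidean_space \<Rightarrow> real" where
  "japanese_bracket \<xi> = sqrt (1 + (norm \<xi>)\<^sup>2)"

definition J_op :: "complex \<Rightarrow> ('a::euclidean_space \<Rightarrow> complex) \<Rightarrow> 'a \<Rightarrow> complex" where
  "J_op z f = inv_fourier (\<lambda>\<xi>. of_real (japanese_bracket \<xi>) powr z * fourier f \<xi>)"

text \<open>
  Powers of extended nonnegative reals, meant for exponents \<open>a \<ge> 0\<close>, with \<open>x\<^sup>0 = 1\<close> for all \<open>x\<close>
  (unlike \<^const>\<open>powr\<close>, which has \<^prop>\<open>0 powr 0 = (0::real)\<close>) and \<open>\<infinity>\<^sup>a = \<infinity>\<close> for \<open>a > 0\<close>.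
\<close>

definition ennpowr :: "ennreal \<Rightarrow> real \<Rightarrow> ennreal" where
  "ennpowr x a = (if a = 0 then 1 else if x = \<infinity> then \<infinity> else ennreal (enn2real x powr a))"

text \<open>\<open>L\<^sup>p\<close> norms take values in \<open>[0, \<infinity>]\<close>, being infinite for functions outside \<open>L\<^sup>p\<close>.\<close>

definition Lp_norm :: "real \<Rightarrow> ('a::euclidean_space \<Rightarrow> complex) \<Rightarrow> ennreal" where
  "Lp_norm p g = ennpowr (\<integral>\<^sup>+x. ennreal (norm (g x) powr p) \<partial>lborel) (1 / p)"

definition weighted :: "real \<Rightarrow> ('a::euclidean_space \<Rightarrow> complex) \<Rightarrow> 'a \<Rightarrow> complex" where
  "weighted a g = (\<lambda>x. of_real (norm x powr a) * g x)"

end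

theory Submission
  imports Defs "HOL-Probability.Characteristic_Functions"
begin

text \<open>
  Write \<open>a(\<xi>) = \<kappa> + \<bar>\<xi>\<bar>\<^sup>2\<close> with \<open>\<kappa> = 0\<close> for \<open>D\<close> and \<open>\<kappa> = 1\<close> for \<open>J\<close>; both families have the symbols
  \<open>a powr (z / 2)\<close>. The resolvents \<open>R(\<tau>) = 1 / (1 + \<tau> a)\<close> are averages of Gaussian convolutions, so \<open>R(\<tau>)\<close>
  and \<open>1 - R(\<tau>)\<close> are bounded pointwise by the Hardy--Littlewood maximal operator \<open>M\<close>. For an integer
  \<open>n > s / 2\<close>, the symbol \<open>a powr (t / 2)\<close> is a multiple of the integral of \<open>\<tau> powr (- t / 2 - 1) * (1 - R(\<tau>))^n\<close>
  over \<open>\<tau> > 0\<close>. For large \<open>\<tau>\<close> the factor \<open>(1 - R(\<tau>))^n\<close> costs nothing; for small \<open>\<tau>\<close> it gains \<open>\<tau> powr (s / 2)\<close>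
  at the price of \<open>D\<^sup>s\<close>, since \<open>(1 - R(\<tau>)) R(\<rho>) = (\<tau> / \<rho>) R(\<tau>) (1 - R(\<rho>))\<close>. Splitting the integral optimally bounds
  \<open>\<bar>D\<^sup>t f\<bar>\<close> pointwise by the geometric mean of iterates of \<open>M\<close> applied to \<open>D\<^sup>s f\<close> and \<open>f\<close>, with exponents
  \<open>t / s\<close> and \<open>1 - t / s\<close>. With Hoelder's inequality and the boundedness of \<open>M\<close> for power weights this settles
  \<open>\<theta> s = t\<close>. In general it controls the operator of order \<open>\<theta> s\<close>, and the remaining negative power, of order
  \<open>\<theta> s - t\<close>, has a kernel below a Riesz kernel, to which the Stein--Weiss inequality applies.
\<close>

section \<open>Powers and integrals of extended nonnegative reals\<close>

text \<open>The maximal operator is bounded on L^p with weight |x|^\<alpha> in the range assumed for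
  \<alpha>, and likewise for q and \<beta>, so a pointwise bound by its iterates carries the weights
  along. Resolvents are used because the exchange identity turns 1 - R(\<tau>) into the numerical
  factor \<tau> / \<rho>, and the n-th power of this factor beats \<rho> powr (s / 2) at infinity
  once n > s / 2. The parameter \<kappa> only brings in factors exp (- \<tau> * \<kappa>) \<le> 1,
  so the same constants serve both families. The exponent r and the weight |x|^\<gamma> enter only
  in the last step: with a = \<theta> \<alpha> + (1 - \<theta>) \<beta> - \<gamma> and e = \<theta>
  s - t, the two inequalities on the weights read 0 \<le> a \<le> e, the scaling relation becomes
  that of Stein--Weiss, and \<gamma> > - d / r is its lower weight condition; the upper one follows
  from the ranges of \<alpha> and \<beta>. Integrals are taken in [0, \<infinity>], so no weighted
  norm of f has to be shown finite.\<close>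

lemma ennpowr_0 [simp]: "ennpowr x 0 = 1"
  by (simp add: ennpowr_def)

lemma ennpowr_zero [simp]: "a \<noteq> 0 \<Longrightarrow> ennpowr 0 a = 0"
  by (simp add: ennpowr_def)

lemma ennpowr_top [simp]: "a \<noteq> 0 \<Longrightarrow> ennpowr top a = top"
  by (simp add: ennpowr_def)

lemma ennpowr_ennreal: "0 \<le> x \<Longrightarrow> a \<noteq> 0 \<Longrightarrow> ennpowr (ennreal x) a = ennreal (x powr a)"
  by (simp add: ennpowr_def)

lemma ennpowr_ennreal_pos: "0 < x \<Longrightarrow> ennpowr (ennreal x) a = ennreal (x powr a)"
  by (simp add: ennpowr_def)

lemma ennpowr_1 [simp]: "ennpowr x 1 = x"
  by (cases x) (auto simp: ennpowr_def)

lemma ennpowr_eq_0_iff: "0 < a \<Longrightarrow> ennpowr x a = 0 \<longleftrightarrow> x = 0"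
  by (cases x) (auto simp: ennpowr_def)

lemma ennpowr_mono: "0 \<le> a \<Longrightarrow> x \<le> y \<Longrightarrow> ennpowr x a \<le> ennpowr y a"
  by (cases x; cases y) (auto simp: ennpowr_def top_unique intro!: powr_mono2 ennreal_leI)

text \<open>The convention 0 * \<infinity> = 0 does no harm: for a > 0 the power fixes 0 and
  \<open>top\<close>, and for a = 0 all three powers are 1.\<close>

lemma ennpowr_mult: "0 \<le> a \<Longrightarrow> ennpowr (x * y) a = ennpowr x a * ennpowr y a"
proof (cases "a = 0")
  case False
  assume "0 \<le> a"
  then have a: "0 < a" using False by simp
  show ?thesis
  proof (cases x)
    case (real u)
    show ?thesis
    proof (cases y)
      case v: (real v)
      then show ?thesis using real a
        by (simp add: ennreal_mult[symmetric] ennpowr_ennreal powr_mult)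
    next
      case top
      then show ?thesis using real a
        by (cases "u = 0") (auto simp: ennpowr_def ennreal_mult_top ennreal_top_mult)
    qed
  next
    case top
    show ?thesis using top a
    proof (cases y)
      case (real v)
      then show ?thesis using top a
        by (cases "v = 0") (auto simp: ennpowr_def ennreal_mult_top ennreal_top_mult)
    qed (auto simp: ennpowr_def)
  qed
qed simp

lemma ennpowr_ennpowr:
  assumes "0 \<le> a" "0 \<le> b"
  shows "ennpowr (ennpowr x a) b = ennpowr x (a * b)"
  using assms by (cases x) (auto simp: ennpowr_def powr_powr)

lemma ennpowr_add:
  assumes "0 \<le> a" "0 \<le> b"
  shows "ennpowr x (a + b) = ennpowr x a * ennpowr x b"
  using assms
  by (cases x) (auto simp: ennpowr_def powr_add ennreal_mult[symmetric] add_nonneg_eq_0_iff)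

lemma measurable_ennpowr [measurable (raw)]:
  "f \<in> borel_measurable M \<Longrightarrow> (\<lambda>x. ennpowr (f x) a) \<in> borel_measurable M"
  unfolding ennpowr_def by (cases "a = 0") auto

lemma ennpowr_max: "0 \<le> a \<Longrightarrow> ennpowr (max x y) a = max (ennpowr x a) (ennpowr y a)"
  by (metis ennpowr_mono max.absorb1 max.absorb2 linear)

text \<open>Comparing x + y with 2 * max x y gives a crude constant, but treats all exponents a
  \<ge> 0 at once, convex or concave.\<close>

lemma ennpowr_add_le:
  assumes "0 \<le> a"
  shows "ennpowr (x + y) a \<le> ennreal (2 powr a) * (ennpowr x a + ennpowr y a)"
proof -
  have "x + y \<le> 2 * max x y"
    by (simp add: mult_2 add_mono)
  then have "ennpowr (x + y) a \<le> ennpowr (ennreal 2 * max x y) a"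
    using assms by (intro ennpowr_mono) auto
  also have "\<dots> = ennreal (2 powr a) * max (ennpowr x a) (ennpowr y a)"
    using assms by (simp add: ennpowr_mult ennpowr_max ennpowr_ennreal_pos del: ennreal_numeral)
  also have "\<dots> \<le> ennreal (2 powr a) * (ennpowr x a + ennpowr y a)"
    by (intro mult_left_mono) (auto simp: max_def)
  finally show ?thesis .
qed

text \<open>Weighted arithmetic-geometric mean. An infinite argument makes the right-hand side
  infinite, because both coefficients are positive.\<close>

lemma ennpowr_Young:
  fixes x y :: ennreal
  assumes "0 < l" "l < 1"
  shows "ennpowr x l * ennpowr y (1 - l) \<le> ennreal l * x + ennreal (1 - l) * y"
proof (cases x)
  case (real u)
  show ?thesis
  proof (cases y)
    case v: (real v)
    have "u powr l * v powr (1 - l) \<le> l * u + (1 - l) * v"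
      using Youngs_inequality_0[of l "1 - l" u v] real v assms
      by (cases "u = 0 \<or> v = 0") auto
    then have "ennreal (u powr l * v powr (1 - l)) \<le> ennreal (l * u + (1 - l) * v)"
      by (rule ennreal_leI)
    then show ?thesis using real v assms
      by (simp add: ennpowr_ennreal ennreal_mult ennreal_plus)
  next
    case top
    then show ?thesis using assms by (simp add: ennreal_mult_top)
  qed
next
  case top
  then show ?thesis using assms by (simp add: ennreal_mult_top)
qed

text \<open>Hoelder in the form that suits geometric means, with values in [0, \<infinity>]. If one
  integral is 0, one factor vanishes almost everywhere; if neither is 0 and one is infinite, so is
  the right-hand side.\<close>

lemma nn_integral_Holder:
  assumes [measurable]: "f \<in> borel_measurable M" "g \<in> borel_measurable M"
    and l: "0 < l" "l < 1"
  shows "(\<integral>\<^sup>+x. ennpowr (f x) l * ennpowr (g x) (1 - l) \<partial>M)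
      \<le> ennpowr (\<integral>\<^sup>+x. f x \<partial>M) l * ennpowr (\<integral>\<^sup>+x. g x \<partial>M) (1 - l)"
proof -
  define A where "A = (\<integral>\<^sup>+x. f x \<partial>M)"
  define B where "B = (\<integral>\<^sup>+x. g x \<partial>M)"
  have "?thesis" if "A = 0 \<or> B = 0"
  proof -
    have "(\<integral>\<^sup>+x. ennpowr (f x) l * ennpowr (g x) (1 - l) \<partial>M) = 0"
    proof (subst nn_integral_0_iff_AE)
      show "AE x in M. ennpowr (f x) l * ennpowr (g x) (1 - l) = 0"
        using that
      proof
        assume "A = 0"
        then have "AE x in M. f x = 0" unfolding A_def by (subst (asm) nn_integral_0_iff_AE) auto
        then show ?thesis by eventually_elim (use l in auto)
      next
        assume "B = 0"
        then have "AE x in M. g x = 0" unfolding B_def by (subst (asm) nn_integral_0_iff_AE) auto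
        then show ?thesis by eventually_elim (use l in auto)
      qed
    qed measurable
    then show ?thesis by simp
  qed
  moreover have "?thesis" if "A \<noteq> 0" "B \<noteq> 0" "A = \<infinity> \<or> B = \<infinity>"
  proof -
    have "ennpowr A l * ennpowr B (1 - l) = \<infinity>"
      using that l ennpowr_eq_0_iff[of l A] ennpowr_eq_0_iff[of "1-l" B]
      by (auto simp: ennreal_mult_eq_top_iff)
    then show ?thesis by (simp add: A_def B_def)
  qed
  moreover have "?thesis" if ne: "A \<noteq> 0" "B \<noteq> 0" "A \<noteq> \<infinity>" "B \<noteq> \<infinity>"
  proof -
    from ne obtain a b where ab: "A = ennreal a" "B = ennreal b" "0 < a" "0 < b"
      by (cases A; cases B) (auto simp: less_le)
    \<comment> \<open>Young's inequality for f / A and g / B; after integration the bracket becomes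
      l + (1 - l) = 1.\<close>
    have "ennpowr (f x) l * ennpowr (g x) (1 - l)
        \<le> ennpowr A l * ennpowr B (1-l) * (ennreal (l / a) * f x + ennreal ((1 - l) / b) * g x)" for x
    proof -
      have f: "ennpowr (f x) l = ennpowr A l * ennpowr (ennreal (1/a) * f x) l"
        using ab l by (simp add: ennpowr_mult[symmetric] mult.assoc[symmetric] ennreal_mult[symmetric])
      have g: "ennpowr (g x) (1-l) = ennpowr B (1-l) * ennpowr (ennreal (1/b) * g x) (1-l)"
        using ab l by (simp add: ennpowr_mult[symmetric] mult.assoc[symmetric] ennreal_mult[symmetric])
      have "ennpowr (f x) l * ennpowr (g x) (1 - l) = ennpowr A l * ennpowr B (1-l) *
         (ennpowr (ennreal (1/a) * f x) l * ennpowr (ennreal (1/b) * g x) (1-l))"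
        by (simp add: f g ac_simps)
      also have "\<dots> \<le> ennpowr A l * ennpowr B (1-l) *
         (ennreal l * (ennreal (1/a) * f x) + ennreal (1 - l) * (ennreal (1/b) * g x))"
        by (intro mult_left_mono ennpowr_Young l) auto
      also have "\<dots> = ennpowr A l * ennpowr B (1-l) * (ennreal (l / a) * f x + ennreal ((1 - l) / b) * g x)"
        using ab l by (simp add: mult.assoc[symmetric] ennreal_mult[symmetric])
      finally show ?thesis .
    qed
    then have "(\<integral>\<^sup>+x. ennpowr (f x) l * ennpowr (g x) (1 - l) \<partial>M)
       \<le> (\<integral>\<^sup>+x. ennpowr A l * ennpowr B (1-l) * (ennreal (l / a) * f x + ennreal ((1 - l) / b) * g x) \<partial>M)"
      by (intro nn_integral_mono) auto
    also have "\<dots> = ennpowr A l * ennpowr B (1-l) * (ennreal (l / a) * A + ennreal ((1 - l) / b) * B)"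
      by (simp add: nn_integral_cmult nn_integral_add A_def B_def)
    also have "ennreal (l / a) * A + ennreal ((1 - l) / b) * B = 1"
      using ab l by (simp add: ennreal_mult[symmetric] ennreal_plus[symmetric] del: ennreal_plus)
    finally show ?thesis by (simp add: A_def B_def)
  qed
  ultimately show ?thesis by blast
qed

lemma nn_integral_Holder_conj:
  assumes [measurable]: "f \<in> borel_measurable M" "g \<in> borel_measurable M"
    and p: "1 < p" "1 / p + 1 / q = 1"
  shows "(\<integral>\<^sup>+x. f x * g x \<partial>M)
      \<le> ennpowr (\<integral>\<^sup>+x. ennpowr (f x) p \<partial>M) (1 / p) * ennpowr (\<integral>\<^sup>+x. ennpowr (g x) q \<partial>M) (1 / q)"
proof -
  have q: "1 / q = 1 - 1 / p" "0 < q"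
  proof -
    show "1 / q = 1 - 1 / p" using p by simp
    moreover have "1 - 1 / p > 0" using p by simp
    ultimately show "0 < q" by (metis zero_less_divide_1_iff)
  qed
  show ?thesis
    using nn_integral_Holder[of "\<lambda>x. ennpowr (f x) p" M "\<lambda>x. ennpowr (g x) q" "1/p"] p q
    unfolding q(1)[symmetric]
    by (simp add: ennpowr_ennpowr)
qed

subsection \<open>Scaling of one-dimensional power integrals\<close>

text \<open>Mellin transform of \<open>h\<close> at - b. The spectral formulas below evaluate a
  profile \<open>h\<close> at v times a positive number, so that convergence is decided once and for
  all frequencies.\<close>

definition mellin :: "real \<Rightarrow> (real \<Rightarrow> ennreal) \<Rightarrow> ennreal" where
  "mellin b h = (\<integral>\<^sup>+v. indicator {0<..} v * ennreal (v powr (- b - 1)) * h v \<partial>lborel)"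

text \<open>Substitute a v for v: the measure dv / v is invariant, so only the power of v
  contributes a factor.\<close>

lemma mellin_scale:
  assumes [measurable]: "h \<in> borel_measurable borel" and a: "0 < a"
  shows "mellin b (\<lambda>v. h (v * a)) = ennreal (a powr b) * mellin b h"
proof -
  have "mellin b h = ennreal a *
      (\<integral>\<^sup>+v. indicator {0<..} (a * v) * ennreal ((a * v) powr (- b - 1)) * h (a * v) \<partial>lborel)"
    unfolding mellin_def
    by (subst nn_integral_real_affine[where c = a and t = 0]) (use a in auto)
  also have "\<dots> = (\<integral>\<^sup>+v. ennreal a * (indicator {0<..} (a * v) * ennreal ((a * v) powr (- b - 1)) * h (a * v)) \<partial>lborel)"
    by (subst nn_integral_cmult) auto
  also have "\<dots> = (\<integral>\<^sup>+v. ennreal (a powr (-b)) * (indicator {0<..} v * ennreal (v powr (- b - 1)) * h (v * a)) \<partial>lborel)"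
  proof (rule nn_integral_cong)
    fix v :: real
    have "ennreal a * ennreal ((a * v) powr (- b - 1)) = ennreal (a powr (-b)) * ennreal (v powr (- b - 1))" if "v > 0"
    proof -
      have "a * (a * v) powr (- b - 1) = a powr (-b) * v powr (-b-1)"
        using that a by (simp add: powr_mult powr_diff)
      then show ?thesis using a by (simp add: ennreal_mult[symmetric])
    qed
    then show "ennreal a * (indicator {0<..} (a * v) * ennreal ((a * v) powr (- b - 1)) * h (a * v)) =
        ennreal (a powr (-b)) * (indicator {0<..} v * ennreal (v powr (- b - 1)) * h (v * a))"
      using a by (auto simp: indicator_def mult.assoc[symmetric] zero_less_mult_iff mult.commute[of v a])
  qed
  also have "\<dots> = ennreal (a powr (-b)) * mellin b (\<lambda>v. h (v * a))"
    unfolding mellin_def by (subst nn_integral_cmult) auto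
  finally have "ennreal (a powr b) * mellin b h = ennreal (a powr b * a powr (-b)) * mellin b (\<lambda>v. h (v * a))"
    using a by (simp add: ennreal_mult mult.assoc)
  then show ?thesis using a by (simp add: powr_add[symmetric])
qed

lemma nn_integral_powr_from_0:
  assumes "0 < c" "0 \<le> R"
  shows "(\<integral>\<^sup>+v. indicator {0<..R} v * ennreal (v powr (c - 1)) \<partial>lborel) = ennreal (R powr c / c)"
proof -
  have "((\<lambda>x. x powr (c-1)) has_integral (R powr c / c)) {0..R}"
    using has_integral_powr_from_0[of "c - 1" R] assms by simp
  then have *: "((\<lambda>x. if x \<in> {0..R} then x powr (c-1) else 0) has_integral (R powr c / c)) UNIV"
    by (simp only: has_integral_restrict_UNIV)
  have "(\<integral>\<^sup>+x. ennreal (if x \<in> {0..R} then x powr (c-1) else 0) \<partial>lborel) = ennreal (R powr c / c)"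
    by (rule nn_integral_has_integral_lborel[OF _ _ *]) auto
  moreover have "(\<integral>\<^sup>+x. ennreal (if x \<in> {0..R} then x powr (c-1) else 0) \<partial>lborel)
      = (\<integral>\<^sup>+v. indicator {0<..R} v * ennreal (v powr (c - 1)) \<partial>lborel)"
    by (rule nn_integral_cong) (auto simp: indicator_def)
  ultimately show ?thesis by simp
qed

lemma nn_integral_powr_to_inf:
  assumes "0 < c" "0 < R"
  shows "(\<integral>\<^sup>+v. indicator {R..} v * ennreal (v powr (- c - 1)) \<partial>lborel) = ennreal (R powr (-c) / c)"
proof -
  have "(\<integral>\<^sup>+v. ennreal (v powr (- c - 1)) * indicator {R..} v \<partial>lborel) = ennreal (0 - (- (R powr (-c) / c)))"
  proof (rule nn_integral_FTC_atLeast)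
    fix x assume "R \<le> x"
    then have "x > 0" using assms by simp
    have "DERIV (\<lambda>x. - (x powr (-c) / c)) x :> - ((-c) * x powr (-c-1) / c)"
      using \<open>x > 0\<close> by (auto intro!: derivative_eq_intros)
    then show "DERIV (\<lambda>x. - (x powr (-c) / c)) x :> x powr (-c-1)" using assms by simp
  next
    have "((\<lambda>x. x powr (-c)) \<longlongrightarrow> 0) at_top"
      using assms by (intro tendsto_neg_powr filterlim_ident) auto
    then show "((\<lambda>x. - (x powr (-c) / c)) \<longlongrightarrow> 0) at_top"
      by (intro tendsto_eq_rhs[OF tendsto_minus[OF tendsto_divide[OF _ tendsto_const]]]) (use assms in auto)
  qed (auto)
  then show ?thesis by (simp add: mult.commute)
qed

text \<open>Split at v = 1. The exponents of the two power bounds lie on either side of b, which is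
  convergence at 0 and at infinity respectively.\<close>

lemma mellin_finite:
  assumes [measurable]: "h \<in> borel_measurable borel"
    and lo: "\<And>v. 0 < v \<Longrightarrow> v \<le> 1 \<Longrightarrow> h v \<le> ennreal (K * v powr c1)" "b < c1"
    and hi: "\<And>v. 1 \<le> v \<Longrightarrow> h v \<le> ennreal (K * v powr c2)" "c2 < b"
  shows "mellin b h < \<infinity>"
proof -
  have K: "ennreal (K * x) \<le> ennreal \<bar>K\<bar> * ennreal x" if "0 \<le> x" for x
    using that by (simp add: ennreal_mult[symmetric] ennreal_leI mult_right_mono)
  have "mellin b h \<le> (\<integral>\<^sup>+v. ennreal \<bar>K\<bar> * (indicator {0<..1} v * ennreal (v powr ((c1 - b) - 1)))
      + ennreal \<bar>K\<bar> * (indicator {1..} v * ennreal (v powr (- (b - c2) - 1))) \<partial>lborel)"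
    unfolding mellin_def
  proof (rule nn_integral_mono)
    fix v :: real
    consider "v \<le> 0" | "0 < v" "v \<le> 1" | "1 < v" by linarith
    then show "indicator {0<..} v * ennreal (v powr (- b - 1)) * h v \<le>
        ennreal \<bar>K\<bar> * (indicator {0<..1} v * ennreal (v powr ((c1 - b) - 1)))
      + ennreal \<bar>K\<bar> * (indicator {1..} v * ennreal (v powr (- (b - c2) - 1)))"
    proof cases
      case 2
      have "ennreal (v powr (- b - 1)) * h v \<le> ennreal (v powr (- b - 1)) * (ennreal \<bar>K\<bar> * ennreal (v powr c1))"
        using lo(1)[OF 2] K[of "v powr c1"] by (intro mult_left_mono) (auto intro: order_trans)
      also have "\<dots> = ennreal \<bar>K\<bar> * ennreal (v powr (c1 - b - 1))"
        using 2 by (simp add: ennreal_mult[symmetric] powr_add[symmetric] algebra_simps)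
      finally show ?thesis using 2 by (auto simp: add_increasing2)
    next
      case 3
      have "ennreal (v powr (- b - 1)) * h v \<le> ennreal (v powr (- b - 1)) * (ennreal \<bar>K\<bar> * ennreal (v powr c2))"
        using hi(1)[of v] 3 K[of "v powr c2"] by (intro mult_left_mono) (auto intro: order_trans)
      also have "\<dots> = ennreal \<bar>K\<bar> * ennreal (v powr (- (b - c2) - 1))"
        using 3 by (simp add: ennreal_mult[symmetric] powr_add[symmetric] algebra_simps)
      finally show ?thesis using 3 by (auto simp: add_increasing)
    qed auto
  qed
  also have "\<dots> = ennreal \<bar>K\<bar> * ennreal (1 powr (c1 - b) / (c1 - b)) + ennreal \<bar>K\<bar> * ennreal (1 powr (-(b - c2)) / (b - c2))"
    using lo hi nn_integral_powr_from_0[of "c1 - b" 1] nn_integral_powr_to_inf[of "b - c2" 1]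
    by (subst nn_integral_add) (auto simp: nn_integral_cmult)
  also have "\<dots> < \<infinity>" by (simp add: ennreal_mult_less_top)
  finally show ?thesis .
qed

text \<open>Together with finiteness this turns Mellin constants into positive reals, by which the
  spectral formulas are divided. The interval [1, 2] is the witness of positive measure.\<close>

lemma mellin_pos:
  assumes [measurable]: "h \<in> borel_measurable borel" and pos: "\<And>v. 0 < v \<Longrightarrow> 0 < h v"
  shows "0 < mellin b h"
proof (rule ccontr)
  assume "\<not> 0 < mellin b h"
  then have "AE v in lborel. indicator {0<..} v * ennreal (v powr (- b - 1)) * h v = 0"
    unfolding mellin_def by (subst nn_integral_0_iff_AE[symmetric]) (auto simp: not_less)
  then have "AE v in lborel. v \<notin> {1::real..2}"
  proof eventually_elim
    case (elim v)
    then show ?case using pos[of v] by (auto simp: indicator_def)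
  qed
  then have "emeasure lborel {1::real..2} = 0"
    by (subst (asm) AE_iff_measurable[OF _ refl]) (auto simp: atLeastAtMost_def Int_def)
  then show False by simp
qed

section \<open>The Hardy--Littlewood maximal function\<close>

lemma lborel_nn_integral_swap:
  assumes "case_prod f \<in> borel_measurable (borel \<Otimes>\<^sub>M borel)"
  shows "(\<integral>\<^sup>+x. (\<integral>\<^sup>+y. f x y \<partial>lborel) \<partial>lborel)
    = (\<integral>\<^sup>+y. (\<integral>\<^sup>+x. f x y \<partial>lborel) \<partial>lborel)"
proof -
  have "case_prod f \<in> borel_measurable (lborel \<Otimes>\<^sub>M lborel)"
    using assms by (simp cong: measurable_cong_sets)
  then show ?thesis
    by (intro pair_sigma_finite.Fubini'[symmetric] pair_sigma_finite.intro sigma_finite_lborel)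
qed

lemma borel_measurable_indicator_ball [measurable (raw)]:
  fixes f :: "'b \<Rightarrow> 'a::euclidean_space"
  assumes [measurable]: "f \<in> borel_measurable M" "g \<in> borel_measurable M" "r \<in> borel_measurable M"
  shows "(\<lambda>x. indicator (ball (f x) (r x)) (g x) :: ennreal) \<in> borel_measurable M"
proof -
  have "(\<lambda>x. if dist (f x) (g x) < r x then 1 else 0 :: ennreal) \<in> borel_measurable M"
    by measurable
  then show ?thesis by (simp add: indicator_def)
qed

lemma borel_measurable_indicator_lessThan [measurable (raw)]:
  fixes f g :: "'b \<Rightarrow> ennreal"
  assumes [measurable]: "f \<in> borel_measurable M" "g \<in> borel_measurable M"
  shows "(\<lambda>x. indicator {..<f x} (g x) :: ennreal) \<in> borel_measurable M"
proof -
  have "(\<lambda>x. if g x < f x then 1 else 0 :: ennreal) \<in> borel_measurable M"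
    by measurable
  then show ?thesis by (simp add: indicator_def)
qed

lemma nn_integral_lborel_measurable [measurable (raw)]:
  assumes "case_prod f \<in> borel_measurable (M \<Otimes>\<^sub>M borel)"
  shows "(\<lambda>x. \<integral>\<^sup>+y. f x y \<partial>lborel) \<in> borel_measurable M"
  using assms sigma_finite_measure.borel_measurable_nn_integral[OF sigma_finite_lborel, of "f" M]
  by (simp cong: measurable_cong_sets)

text \<open>Restricting to dyadic radii keeps the supremum countable, hence measurable, and costs a factor
  \<open>2\<^sup>d\<close>. The averages are normalised by \<open>r\<^sup>d\<close> instead of the volume of the ball.\<close>

definition hlmax :: "('a::euclidean_space \<Rightarrow> ennreal) \<Rightarrow> 'a \<Rightarrow> ennreal" where
  "hlmax g x = (SUP k::int. ennreal (1 / (2 powr k) ^ DIM('a)) *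
      (\<integral>\<^sup>+y. indicator (ball x (2 powr k)) y * g y \<partial>lborel))"

lemma measurable_hlmax [measurable]:
  fixes g :: "'a::euclidean_space \<Rightarrow> ennreal"
  assumes [measurable]: "g \<in> borel_measurable borel"
  shows "hlmax g \<in> borel_measurable borel"
  unfolding hlmax_def by measurable

lemma average_le_hlmax:
  fixes g :: "'a::euclidean_space \<Rightarrow> ennreal"
  assumes R: "0 < R" and [measurable]: "g \<in> borel_measurable borel"
  shows "(\<integral>\<^sup>+y. indicator (ball x R) y * g y \<partial>lborel) \<le> ennreal (2 ^ DIM('a) * R ^ DIM('a)) * hlmax g x"
proof -
  \<comment> \<open>The least dyadic radius not below R is less than 2 R; this is the factor 2^d of
    the statement.\<close>
  define k where "k = \<lceil>log 2 R\<rceil>"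
  have "log 2 R \<le> k" "k < log 2 R + 1" unfolding k_def by linarith+
  then have "2 powr (log 2 R) \<le> 2 powr k" "2 powr k \<le> 2 powr (log 2 R + 1)" by simp_all
  then have k: "R \<le> 2 powr k" "2 powr k \<le> 2 * R" using R by (simp_all add: powr_add)
  define c where "c = (2 powr k) ^ DIM('a)"
  have c: "0 < c" "c \<le> 2 ^ DIM('a) * R ^ DIM('a)"
    using power_mono[OF k(2), of "DIM('a)"] by (auto simp: c_def power_mult_distrib)
  have "(\<integral>\<^sup>+y. indicator (ball x R) y * g y \<partial>lborel) \<le> (\<integral>\<^sup>+y. indicator (ball x (2 powr k)) y * g y \<partial>lborel)"
    using k by (intro nn_integral_mono mult_right_mono) (auto simp: indicator_def)
  also have "\<dots> = ennreal c * (ennreal (1 / c) * (\<integral>\<^sup>+y. indicator (ball x (2 powr k)) y * g y \<partial>lborel))"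
    using c by (simp add: mult.assoc[symmetric] ennreal_mult[symmetric])
  also have "\<dots> \<le> ennreal c * hlmax g x"
    unfolding hlmax_def c_def by (intro mult_left_mono SUP_upper2[OF UNIV_I order_refl]) auto
  also have "\<dots> \<le> ennreal (2 ^ DIM('a) * R ^ DIM('a)) * hlmax g x"
    using c by (intro mult_right_mono ennreal_leI) auto
  finally show ?thesis .
qed

lemma hlmax_mono:
  fixes g :: "'a::euclidean_space \<Rightarrow> ennreal"
  assumes "\<And>y. g y \<le> h y"
  shows "hlmax g x \<le> hlmax h x"
  unfolding hlmax_def
  by (intro SUP_mono'[of _ _] mult_left_mono nn_integral_mono) (use assms in auto)

lemma hlmax_cmult:
  fixes g :: "'a::euclidean_space \<Rightarrow> ennreal"
  assumes [measurable]: "g \<in> borel_measurable borel"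
  shows "hlmax (\<lambda>y. c * g y) x = c * hlmax g x"
  unfolding hlmax_def
  by (simp add: mult.left_commute[of _ c] nn_integral_cmult SUP_mult_left_ennreal)

lemma hlmax_add_le:
  fixes g :: "'a::euclidean_space \<Rightarrow> ennreal"
  assumes [measurable]: "g \<in> borel_measurable borel" "h \<in> borel_measurable borel"
  shows "hlmax (\<lambda>y. g y + h y) x \<le> hlmax g x + hlmax h x"
  unfolding hlmax_def
proof (intro SUP_least)
  fix k :: int
  show "ennreal (1 / (2 powr k) ^ DIM('a)) * (\<integral>\<^sup>+y. indicator (ball x (2 powr k)) y * (g y + h y) \<partial>lborel)
    \<le> (SUP k::int. ennreal (1 / (2 powr k) ^ DIM('a)) * (\<integral>\<^sup>+y. indicator (ball x (2 powr k)) y * g y \<partial>lborel))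
    + (SUP k::int. ennreal (1 / (2 powr k) ^ DIM('a)) * (\<integral>\<^sup>+y. indicator (ball x (2 powr k)) y * h y \<partial>lborel))"
    by (simp only: distrib_left, subst nn_integral_add)
       (auto simp: distrib_left intro!: add_mono SUP_upper2[OF UNIV_I order_refl])
qed

lemma hlmax_const_le:
  "hlmax (\<lambda>_::'a::euclidean_space. c) x \<le> ennreal (unit_ball_vol DIM('a)) * c"
  unfolding hlmax_def
proof (intro SUP_least)
  fix k :: int
  define b where "b = (2 powr real_of_int k) ^ DIM('a)"
  have b: "0 < b" by (simp add: b_def)
  have "(\<integral>\<^sup>+y. indicator (ball x (2 powr k)) y * c \<partial>lborel) = ennreal (unit_ball_vol DIM('a) * b) * c"
    by (subst nn_integral_multc) (auto simp: emeasure_ball b_def)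
  then show "ennreal (1 / (2 powr k) ^ DIM('a)) * (\<integral>\<^sup>+y. indicator (ball x (2 powr k)) y * c \<partial>lborel)
     \<le> ennreal (unit_ball_vol DIM('a)) * c"
    unfolding b_def[symmetric] using b
    by (simp add: mult.assoc[symmetric] ennreal_mult[symmetric])
qed

lemma hlmax_le_bound:
  fixes g :: "'a::euclidean_space \<Rightarrow> ennreal"
  assumes "\<And>y. g y \<le> c"
  shows "hlmax g x \<le> ennreal (unit_ball_vol DIM('a)) * c"
  using hlmax_mono[of g "\<lambda>_. c" x] hlmax_const_le[of c x] assms by (meson order_trans)

section \<open>Weak and strong type bounds for the maximal operator\<close>

lemma emeasure_UN_countable_le:
  assumes "countable C" "\<And>i. i \<in> C \<Longrightarrow> B i \<in> sets M"
  shows "emeasure M (\<Union>i\<in>C. B i) \<le> (\<integral>\<^sup>+i. emeasure M (B i) \<partial>count_space C)"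
proof -
  have [measurable]: "(\<Union>i\<in>C. B i) \<in> sets M" using assms by (intro sets.countable_UN') auto
  have "emeasure M (\<Union>i\<in>C. B i) = (\<integral>\<^sup>+x. indicator (\<Union>i\<in>C. B i) x \<partial>M)" by simp
  also have "\<dots> \<le> (\<integral>\<^sup>+x. (\<integral>\<^sup>+i. indicator (B i) x \<partial>count_space C) \<partial>M)"
  proof (intro nn_integral_mono)
    fix x
    show "indicator (\<Union>i\<in>C. B i) x \<le> (\<integral>\<^sup>+i. indicator (B i) x \<partial>count_space C)"
    proof (cases "x \<in> (\<Union>i\<in>C. B i)")
      case True
      then obtain j where j: "j \<in> C" "x \<in> B j" by auto
      have "1 = (\<integral>\<^sup>+i. indicator {j} i \<partial>count_space C)" using j by simp
      also have "\<dots> \<le> (\<integral>\<^sup>+i. indicator (B i) x \<partial>count_space C)"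
        using j by (intro nn_integral_mono) (auto simp: indicator_def)
      finally show ?thesis using True by simp
    qed simp
  qed
  also have "\<dots> = (\<integral>\<^sup>+i. (\<integral>\<^sup>+x. indicator (B i) x \<partial>M) \<partial>count_space C)"
    using assms by (intro nn_integral_count_space_nn_integral) auto
  also have "\<dots> = (\<integral>\<^sup>+i. emeasure M (B i) \<partial>count_space C)"
    using assms by (intro nn_integral_cong) auto
  finally show ?thesis .
qed

text \<open>Every point lies in at most one of the sets. As in the preceding lemma the sum is an
  integral over \<open>count_space\<close>, so that the family selected by the covering lemma,
  indexed by pairs of a centre and an exponent, need not be enumerated.\<close>

lemma nn_integral_disjoint_le:
  assumes [measurable]: "g \<in> borel_measurable M"
    and "countable C" "\<And>i. i \<in> C \<Longrightarrow> B i \<in> sets M" "disjoint_family_on B C"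
  shows "(\<integral>\<^sup>+i. (\<integral>\<^sup>+x. indicator (B i) x * g x \<partial>M) \<partial>count_space C) \<le> (\<integral>\<^sup>+x. g x \<partial>M)"
proof -
  have "(\<integral>\<^sup>+i. (\<integral>\<^sup>+x. indicator (B i) x * g x \<partial>M) \<partial>count_space C)
      = (\<integral>\<^sup>+x. (\<integral>\<^sup>+i. indicator (B i) x * g x \<partial>count_space C) \<partial>M)"
    using assms by (intro nn_integral_count_space_nn_integral[symmetric]) auto
  also have "\<dots> \<le> (\<integral>\<^sup>+x. g x \<partial>M)"
  proof (intro nn_integral_mono)
    fix x
    have *: "emeasure (count_space C) {i\<in>C. x \<in> B i} \<le> 1"
    proof (cases "{i\<in>C. x \<in> B i} = {}")
      case False
      then obtain j where j: "j \<in> C" "x \<in> B j" by auto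
      then have "{i\<in>C. x \<in> B i} = {j}"
        using assms(4) by (auto simp: disjoint_family_on_def disjoint_iff)
      then show ?thesis using j by simp
    next
      case True
      then show ?thesis by (simp only: emeasure_empty) simp
    qed
    have "(\<integral>\<^sup>+i. indicator (B i) x * g x \<partial>count_space C) = (\<integral>\<^sup>+i. indicator {i\<in>C. x \<in> B i} i * g x \<partial>count_space C)"
      by (intro nn_integral_cong) (auto simp: indicator_def)
    also have "\<dots> = emeasure (count_space C) {i\<in>C. x \<in> B i} * g x"
      by (subst nn_integral_multc) (auto)
    also have "\<dots> \<le> 1 * g x" using * by (intro mult_right_mono) auto
    finally show "(\<integral>\<^sup>+i. indicator (B i) x * g x \<partial>count_space C) \<le> g x" by simp
  qed
  finally show ?thesis .
qed

text \<open>Vitali covering. Around a point of the level set some ball has average above l, so r^d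
  is at most 1 / l times the integral over that ball. A disjoint subfamily whose fivefold dilates
  cover the level set then gives the estimate, the dilation costing 5^d.\<close>

lemma hlmax_weak_type:
  fixes g :: "'a::euclidean_space \<Rightarrow> ennreal"
  assumes [measurable]: "g \<in> borel_measurable borel" and l: "0 < l"
  shows "emeasure lborel {x. ennreal l < hlmax g x}
     \<le> ennreal (unit_ball_vol DIM('a) * 5 ^ DIM('a) / l) * (\<integral>\<^sup>+x. g x \<partial>lborel)"
proof (cases "(\<integral>\<^sup>+x. g x \<partial>lborel)")
  case top
  have "unit_ball_vol DIM('a) * 5 ^ DIM('a) / l > 0" using l by simp
  then have "ennreal (unit_ball_vol DIM('a) * 5 ^ DIM('a) / l) * (\<integral>\<^sup>+x. g x \<partial>lborel) = top"
    using top by (simp only: ennreal_mult_top ennreal_eq_0_iff not_le[symmetric] if_False)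
  then show ?thesis by simp
next
  case (real i)
  \<comment> \<open>The index is a pair of a centre and a dyadic exponent, so that the radius is a
    function of the index, as the covering lemma wants.\<close>
  define K where "K = {(x, k::int). ennreal l <
    ennreal (1 / (2 powr k) ^ DIM('a)) * (\<integral>\<^sup>+y. indicator (ball x (2 powr k)) y * g y \<partial>lborel)}"
  let ?r = "\<lambda>(x::'a, k::int). 2 powr real_of_int k"
  have key: "ennreal (l * ?r w ^ DIM('a)) \<le> (\<integral>\<^sup>+y. indicator (ball (fst w) (?r w)) y * g y \<partial>lborel)"
    if "w \<in> K" for w
  proof -
    obtain x k where w: "w = (x, k)" by (cases w)
    define b where "b = (2 powr real_of_int k) ^ DIM('a)"
    have b: "0 < b" by (simp add: b_def)
    have "ennreal l \<le> ennreal (1 / b) * (\<integral>\<^sup>+y. indicator (ball x (2 powr k)) y * g y \<partial>lborel)"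
      using that by (auto simp: K_def w b_def)
    then have "ennreal b * ennreal l \<le> ennreal b * (ennreal (1 / b) * (\<integral>\<^sup>+y. indicator (ball x (2 powr k)) y * g y \<partial>lborel))"
      by (intro mult_left_mono) auto
    then show ?thesis using b l
      by (simp add: w mult.assoc[symmetric] ennreal_mult[symmetric] b_def[symmetric] mult.commute)
  qed
  \<comment> \<open>The covering lemma asks for bounded radii. The finite total integral i bounds
    r^d by i / l, and r \<le> r^d once r \<ge> 1. This is why an infinite integral was treated
    separately.\<close>
  have bd: "0 < ?r w \<and> ?r w \<le> max 1 (i / l)" if "w \<in> K" for w
  proof -
    have "ennreal (l * ?r w ^ DIM('a)) \<le> (\<integral>\<^sup>+y. g y \<partial>lborel)"
      by (rule order_trans[OF key[OF that]]) (intro nn_integral_mono, auto simp: indicator_def)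
    then have "l * ?r w ^ DIM('a) \<le> i" using real l by (auto simp: split_beta)
    then have *: "?r w ^ DIM('a) \<le> i / l" using l by (simp add: field_simps)
    have "?r w \<le> ?r w ^ DIM('a)" if "1 \<le> ?r w"
      using that power_increasing[of 1 "DIM('a)" "?r w"] by (simp add: Suc_leI)
    then show ?thesis using * by (cases "1 \<le> ?r w") (auto simp: split_beta)
  qed
  obtain C where C: "countable C" "C \<subseteq> K"
     "pairwise (\<lambda>i j. disjnt (ball (fst i) (?r i)) (ball (fst j) (?r j))) C"
     "(\<Union>w\<in>K. ball (fst w) (?r w)) \<subseteq> (\<Union>i\<in>C. ball (fst i) (5 * ?r i))"
    by (rule Vitali_covering_lemma_balls[OF order_refl bd, where a = fst])
  have "{x. ennreal l < hlmax g x} \<subseteq> (\<Union>w\<in>K. ball (fst w) (?r w))"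
  proof
    fix x assume "x \<in> {x. ennreal l < hlmax g x}"
    then obtain k where "(x, k) \<in> K" unfolding hlmax_def K_def by (auto simp: less_SUP_iff)
    then show "x \<in> (\<Union>w\<in>K. ball (fst w) (?r w))"
      by (intro UN_I[of "(x,k)"]) auto
  qed
  then have "{x. ennreal l < hlmax g x} \<subseteq> (\<Union>i\<in>C. ball (fst i) (5 * ?r i))" using C(4) by blast
  then have "emeasure lborel {x. ennreal l < hlmax g x} \<le> emeasure lborel (\<Union>i\<in>C. ball (fst i) (5 * ?r i))"
    by (intro emeasure_mono) (auto simp: sets_lborel intro!: sets.countable_UN' C)
  also have "\<dots> \<le> (\<integral>\<^sup>+i. emeasure lborel (ball (fst i) (5 * ?r i)) \<partial>count_space C)"
    by (intro emeasure_UN_countable_le C) auto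
  also have "\<dots> \<le> (\<integral>\<^sup>+i. ennreal (unit_ball_vol DIM('a) * 5 ^ DIM('a) / l) *
      (\<integral>\<^sup>+y. indicator (ball (fst i) (?r i)) y * g y \<partial>lborel) \<partial>count_space C)"
  proof (intro nn_integral_mono)
    fix w assume "w \<in> space (count_space C)"
    then have w: "w \<in> K" using C by auto
    have "emeasure lborel (ball (fst w) (5 * ?r w)) = ennreal (unit_ball_vol DIM('a) * (5 * ?r w) ^ DIM('a))"
      using bd[OF w] by (intro emeasure_ball) (auto simp: split_beta)
    also have "\<dots> = ennreal (unit_ball_vol DIM('a) * 5 ^ DIM('a) / l) * ennreal (l * ?r w ^ DIM('a))"
      using l bd[OF w] by (subst ennreal_mult[symmetric]) (auto simp: field_simps split_beta power_mult_distrib)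
    also have "\<dots> \<le> ennreal (unit_ball_vol DIM('a) * 5 ^ DIM('a) / l) *
      (\<integral>\<^sup>+y. indicator (ball (fst w) (?r w)) y * g y \<partial>lborel)"
      by (intro mult_left_mono key w) auto
    finally show "emeasure lborel (ball (fst w) (5 * ?r w)) \<le> \<dots>" .
  qed
  also have "\<dots> = ennreal (unit_ball_vol DIM('a) * 5 ^ DIM('a) / l) *
      (\<integral>\<^sup>+i. (\<integral>\<^sup>+y. indicator (ball (fst i) (?r i)) y * g y \<partial>lborel) \<partial>count_space C)"
    by (subst nn_integral_cmult) auto
  also have "\<dots> \<le> ennreal (unit_ball_vol DIM('a) * 5 ^ DIM('a) / l) * (\<integral>\<^sup>+x. g x \<partial>lborel)"
    using C by (intro mult_left_mono nn_integral_disjoint_le)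
      (auto simp: disjoint_family_on_def pairwise_def disjnt_def)
  finally show ?thesis .
qed

text \<open>Layer-cake formula for a single value X. In this pointwise form it can be inserted under
  an outer integral, to which Tonelli is then applied.\<close>

lemma nn_integral_layer:
  fixes X :: ennreal
  assumes a: "0 < a"
  shows "(\<integral>\<^sup>+l. indicator {0<..} l * ennreal (l powr (a - 1)) * indicator {..<X} (ennreal l) \<partial>lborel)
    = ennreal (1 / a) * ennpowr X a"
proof (cases X)
  case (real u)
  have "(\<integral>\<^sup>+l. indicator {0<..} l * ennreal (l powr (a - 1)) * indicator {..<X} (ennreal l) \<partial>lborel)
    = (\<integral>\<^sup>+l. indicator {0<..u} l * ennreal (l powr (a - 1)) \<partial>lborel)"
  proof (rule nn_integral_cong_AE)
    have "AE l in lborel. l \<noteq> u" by (rule AE_lborel_singleton)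
    then show "AE l in lborel. indicator {0<..} l * ennreal (l powr (a - 1)) * indicator {..<X} (ennreal l)
      = indicator {0<..u} l * ennreal (l powr (a - 1))"
      by eventually_elim (use real in \<open>auto simp: indicator_def ennreal_less_iff\<close>)
  qed
  then show ?thesis using nn_integral_powr_from_0[OF a, of u] real a
    by (simp add: ennpowr_ennreal ennreal_mult[symmetric])
next
  case top
  have "ennreal n \<le> (\<integral>\<^sup>+l. indicator {0<..} l * ennreal (l powr (a - 1)) * indicator {..<X} (ennreal l) \<partial>lborel)"
    if "0 < n" for n
  proof -
    \<comment> \<open>The upper limit is chosen so that the integral up to it is exactly n; as n is
      arbitrary, the whole integral is infinite.\<close>
    have "ennreal n = (\<integral>\<^sup>+l. indicator {0<..(n * a) powr (1/a)} l * ennreal (l powr (a - 1)) \<partial>lborel)"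
      using a that by (subst nn_integral_powr_from_0) (auto simp: powr_powr)
    also have "\<dots> \<le> (\<integral>\<^sup>+l. indicator {0<..} l * ennreal (l powr (a - 1)) * indicator {..<X} (ennreal l) \<partial>lborel)"
      using top by (intro nn_integral_mono) (auto simp: indicator_def)
    finally show ?thesis .
  qed
  note below = this
  have "(\<integral>\<^sup>+l. indicator {0<..} l * ennreal (l powr (a - 1)) * indicator {..<X} (ennreal l) \<partial>lborel) = top"
    (is "?I = top")
  proof (rule ccontr)
    assume "?I \<noteq> top"
    then obtain u where u: "?I = ennreal u" "0 \<le> u" by (cases ?I) auto
    have "ennreal (u + 1) \<le> ?I"
      using below[of "u + 1"] u(2) by linarith
    then show False using u by simp
  qed
  then show ?thesis using top a by (simp add: ennreal_mult_top)
qed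

text \<open>Marcinkiewicz interpolation between the weak type (1,1) bound and the bound for bounded
  functions: at each height l the function g is cut at a multiple of l. Since p > 1, the remaining
  integral over l, of order p - 1, converges at 0.\<close>

theorem hlmax_strong_type:
  assumes p: "1 < p"
  shows "\<exists>C>0. \<forall>g\<in>borel_measurable borel.
    (\<integral>\<^sup>+x. ennpowr (hlmax g (x::'a::euclidean_space)) p \<partial>lborel) \<le> ennreal C * (\<integral>\<^sup>+x. ennpowr (g x) p \<partial>lborel)"
proof -
  define V where "V = unit_ball_vol (real DIM('a))"
  have V: "0 < V" by (simp add: V_def)
  \<comment> \<open>With this c the part of g below the height c * l has maximal function at most V
    * c * l = l / 2, so where the maximal function of g exceeds l, that of the upper part exceeds l
    / 2.\<close>
  define c where "c = 1 / (2 * V)"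
  have c: "0 < c" using V by (simp add: c_def)
  define D where "D = V * 5 ^ DIM('a) * 2"
  have D: "0 < D" using V by (simp add: D_def)
  define C where "C = p * D / (p - 1) * (1/c) powr (p-1)"
  have C: "0 < C" using p D c by (simp add: C_def)
  have "(\<integral>\<^sup>+x. ennpowr (hlmax g x) p \<partial>lborel) \<le> ennreal C * (\<integral>\<^sup>+x. ennpowr (g x) p \<partial>lborel)"
    if [measurable]: "g \<in> borel_measurable borel" for g :: "'a \<Rightarrow> ennreal"
  proof -
    let ?w = "\<lambda>l. indicator {0<..} l * ennreal (l powr (p - 1))"
    have weak: "emeasure lborel {x. ennreal l < hlmax g x}
        \<le> ennreal (D / l) * (\<integral>\<^sup>+x. g x * indicator {..<g x} (ennreal (c * l)) \<partial>lborel)" if l: "0 < l" for l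
    proof -
      let ?g = "\<lambda>x. g x * indicator {..<g x} (ennreal (c * l))"
      have [measurable]: "?g \<in> borel_measurable borel" by measurable
      have "hlmax g x \<le> hlmax ?g x + ennreal (l / 2)" for x
      proof -
        have "hlmax g x \<le> hlmax (\<lambda>y. ?g y + ennreal (c * l)) x"
          by (intro hlmax_mono) (auto simp: indicator_def)
        also have "\<dots> \<le> hlmax ?g x + hlmax (\<lambda>_. ennreal (c * l)) x" by (intro hlmax_add_le) auto
        also have "hlmax (\<lambda>_. ennreal (c * l)) x \<le> ennreal V * ennreal (c * l)"
          unfolding V_def by (rule hlmax_const_le)
        also have "ennreal V * ennreal (c * l) = ennreal (l / 2)"
          using V l c by (simp add: ennreal_mult[symmetric]) (simp add: c_def)
        finally show ?thesis by (simp add: add_left_mono)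
      qed
      note split = this
      have "{x. ennreal l < hlmax g x} \<subseteq> {x. ennreal (l / 2) < hlmax ?g x}"
      proof (intro subsetI CollectI, rule ccontr)
        fix x assume x: "x \<in> {x. ennreal l < hlmax g x}" "\<not> ennreal (l / 2) < hlmax ?g x"
        have "hlmax g x \<le> hlmax ?g x + ennreal (l / 2)" by (rule split)
        also have "\<dots> \<le> ennreal (l / 2) + ennreal (l / 2)" using x by (intro add_right_mono) auto
        also have "\<dots> = ennreal l" using l by (simp add: ennreal_plus[symmetric] del: ennreal_plus)
        finally show False using x by auto
      qed
      then have "emeasure lborel {x. ennreal l < hlmax g x} \<le> emeasure lborel {x. ennreal (l / 2) < hlmax ?g x}"
        by (intro emeasure_mono) auto
      also have "\<dots> \<le> ennreal (D / l) * (\<integral>\<^sup>+x. ?g x \<partial>lborel)"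
        using hlmax_weak_type[of ?g "l / 2"] l by (simp add: D_def V_def mult.commute)
      finally show ?thesis .
    qed
    have "(\<integral>\<^sup>+x. ennpowr (hlmax g x) p \<partial>lborel)
       = (\<integral>\<^sup>+x. ennreal p * (\<integral>\<^sup>+l. ?w l * indicator {..<hlmax g x} (ennreal l) \<partial>lborel) \<partial>lborel)"
      using p by (subst nn_integral_layer) (auto simp: mult.assoc[symmetric] ennreal_mult[symmetric])
    also have "\<dots> = ennreal p * (\<integral>\<^sup>+x. (\<integral>\<^sup>+l. ?w l * indicator {..<hlmax g x} (ennreal l) \<partial>lborel) \<partial>lborel)"
      by (rule nn_integral_cmult) measurable
    also have "(\<integral>\<^sup>+x. (\<integral>\<^sup>+l. ?w l * indicator {..<hlmax g x} (ennreal l) \<partial>lborel) \<partial>lborel)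
       = (\<integral>\<^sup>+l. (\<integral>\<^sup>+x. ?w l * indicator {..<hlmax g x} (ennreal l) \<partial>lborel) \<partial>lborel)"
      by (intro lborel_nn_integral_swap) measurable
    also have "\<dots> = (\<integral>\<^sup>+l. ?w l * emeasure lborel {x. ennreal l < hlmax g x} \<partial>lborel)"
    proof (rule nn_integral_cong)
      fix l :: real
      have "(\<integral>\<^sup>+x. indicator {..<hlmax g x} (ennreal l) \<partial>lborel) = (\<integral>\<^sup>+x. indicator {x. ennreal l < hlmax g x} x \<partial>lborel)"
        by (intro nn_integral_cong) (auto simp: indicator_def)
      also have "\<dots> = emeasure lborel {x. ennreal l < hlmax g x}" by (subst nn_integral_indicator) auto
      finally show "(\<integral>\<^sup>+x. ?w l * indicator {..<hlmax g x} (ennreal l) \<partial>lborel) = ?w l * emeasure lborel {x. ennreal l < hlmax g x}"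
        by (subst nn_integral_cmult) auto
    qed
    also have "\<dots> \<le> (\<integral>\<^sup>+l. (\<integral>\<^sup>+x. ennreal D * (indicator {0<..} l * ennreal (l powr ((p - 1) - 1)) * (g x * indicator {..<g x} (ennreal (c * l)))) \<partial>lborel) \<partial>lborel)"
    proof (rule nn_integral_mono)
      fix l :: real
      show "?w l * emeasure lborel {x. ennreal l < hlmax g x} \<le>
        (\<integral>\<^sup>+x. ennreal D * (indicator {0<..} l * ennreal (l powr ((p - 1) - 1)) * (g x * indicator {..<g x} (ennreal (c * l)))) \<partial>lborel)"
      proof (cases "0 < l")
        case True
        have "?w l * emeasure lborel {x. ennreal l < hlmax g x}
           \<le> ennreal (l powr (p - 1)) * (ennreal (D / l) * (\<integral>\<^sup>+x. g x * indicator {..<g x} (ennreal (c * l)) \<partial>lborel))"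
          using weak[OF True] True by (auto intro!: mult_left_mono)
        also have "\<dots> = ennreal D * ennreal (l powr ((p - 1) - 1)) * (\<integral>\<^sup>+x. g x * indicator {..<g x} (ennreal (c * l)) \<partial>lborel)"
          using True D by (simp add: mult.assoc[symmetric] ennreal_mult[symmetric] powr_diff mult.commute power2_eq_square)
        also have "\<dots> = (\<integral>\<^sup>+x. ennreal D * ennreal (l powr ((p - 1) - 1)) * (g x * indicator {..<g x} (ennreal (c * l))) \<partial>lborel)"
          by (subst nn_integral_cmult) auto
        finally show ?thesis using True by (simp add: mult.assoc)
      qed simp
    qed
    also have "\<dots> = (\<integral>\<^sup>+x. (\<integral>\<^sup>+l. ennreal D * (indicator {0<..} l * ennreal (l powr ((p - 1) - 1)) * (g x * indicator {..<g x} (ennreal (c * l)))) \<partial>lborel) \<partial>lborel)"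
      by (intro lborel_nn_integral_swap) measurable
    also have "\<dots> = (\<integral>\<^sup>+x. ennreal (D / (p-1) * (1/c) powr (p-1)) * ennpowr (g x) p \<partial>lborel)"
    proof (rule nn_integral_cong)
      fix x
      \<comment> \<open>Moving c to the other side brings the inner integral into the form of the
        layer-cake formula with X = g x / c and exponent p - 1; the remaining factor g x restores
        the power p.\<close>
      have eq: "indicator {..<g x} (ennreal (c * l)) = (indicator {..<ennreal (1/c) * g x} (ennreal l) :: ennreal)" if "0 < l" for l
      proof -
        have "ennreal (c * l) < g x \<longleftrightarrow> ennreal l < ennreal (1/c) * g x"
        proof (cases "g x")
          case (real u)
          then show ?thesis using c that by (auto simp: ennreal_mult[symmetric] ennreal_less_iff field_simps)
        next
          case top
          then show ?thesis using c that by (auto simp: ennreal_mult_top)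
        qed
        then show ?thesis by (auto simp: indicator_def)
      qed
      have "(\<integral>\<^sup>+l. ennreal D * (indicator {0<..} l * ennreal (l powr ((p - 1) - 1)) * (g x * indicator {..<g x} (ennreal (c * l)))) \<partial>lborel)
        = (\<integral>\<^sup>+l. (ennreal D * g x) * (indicator {0<..} l * ennreal (l powr ((p - 1) - 1)) * indicator {..<ennreal (1/c) * g x} (ennreal l)) \<partial>lborel)"
      proof (rule nn_integral_cong)
        fix l :: real
        show "ennreal D * (indicator {0<..} l * ennreal (l powr ((p - 1) - 1)) * (g x * indicator {..<g x} (ennreal (c * l))))
          = (ennreal D * g x) * (indicator {0<..} l * ennreal (l powr ((p - 1) - 1)) * indicator {..<ennreal (1/c) * g x} (ennreal l))"
        proof (cases "0 < l")
          case True
          show ?thesis unfolding eq[OF True] by (simp add: mult_ac)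
        qed simp
      qed
      also have "\<dots> = (ennreal D * g x) * (ennreal (1 / (p-1)) * ennpowr (ennreal (1/c) * g x) (p-1))"
      proof -
        have [measurable]: "(\<lambda>l. indicator {..<ennreal (1/c) * g x} (ennreal l) :: ennreal) \<in> borel_measurable borel"
          by (rule borel_measurable_indicator_lessThan) auto
        have "0 < p - 1" using p by simp
        show ?thesis
          unfolding nn_integral_layer[OF \<open>0 < p - 1\<close>, of "ennreal (1/c) * g x", symmetric]
          by (rule nn_integral_cmult) measurable
      qed
      also have "\<dots> = ennreal D * ennreal (1 / (p-1)) * ennreal ((1/c) powr (p-1)) * (ennpowr (g x) 1 * ennpowr (g x) (p-1))"
        using p c by (simp add: ennpowr_mult ennpowr_ennreal mult_ac del: ennpowr_1) simp
      also have "ennpowr (g x) 1 * ennpowr (g x) (p-1) = ennpowr (g x) p"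
        using p by (subst ennpowr_add[symmetric]) auto
      finally show "(\<integral>\<^sup>+l. ennreal D * (indicator {0<..} l * ennreal (l powr ((p - 1) - 1)) * (g x * indicator {..<g x} (ennreal (c * l)))) \<partial>lborel)
        = ennreal (D / (p-1) * (1/c) powr (p-1)) * ennpowr (g x) p"
        using p D c by (simp add: ennreal_mult[symmetric])
    qed
    also have "\<dots> = ennreal (D / (p-1) * (1/c) powr (p-1)) * (\<integral>\<^sup>+x. ennpowr (g x) p \<partial>lborel)"
      by (subst nn_integral_cmult) auto
    finally show ?thesis
      using p D c by (simp add: C_def mult.assoc[symmetric] ennreal_mult[symmetric] mult_left_mono)
  qed
  then show ?thesis using C by blast
qed

section \<open>Radial kernels, Hardy inequalities and power weights\<close>

lemma AE_lborel_nonzero: "AE x in lborel. (x::'a::euclidean_space) \<noteq> 0"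
  by (rule AE_lborel_singleton)

text \<open>The hypothesis on \<open>k\<close> says that it is at most a superposition of indicator functions of balls
  around \<open>x\<close>, as is every radially decreasing kernel.\<close>

lemma radial_kernel_le_hlmax:
  fixes g :: "'a::euclidean_space \<Rightarrow> ennreal"
  assumes [measurable]: "g \<in> borel_measurable borel" "w \<in> borel_measurable borel"
    and k: "\<And>y. y \<noteq> x \<Longrightarrow> k y \<le> (\<integral>\<^sup>+\<rho>. indicator (ball x \<rho>) y * w \<rho> \<partial>lborel)"
  shows "(\<integral>\<^sup>+y. k y * g y \<partial>lborel)
    \<le> (\<integral>\<^sup>+\<rho>. indicator {0<..} \<rho> * w \<rho> * ennreal (\<rho> ^ DIM('a)) \<partial>lborel) * (ennreal (2 ^ DIM('a)) * hlmax g x)"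
proof -
  have "(\<integral>\<^sup>+y. k y * g y \<partial>lborel) \<le> (\<integral>\<^sup>+y. (\<integral>\<^sup>+\<rho>. indicator (ball x \<rho>) y * w \<rho> \<partial>lborel) * g y \<partial>lborel)"
    by (intro nn_integral_mono_AE, use AE_lborel_singleton[of x] in eventually_elim)
       (intro mult_right_mono k, auto)
  also have "\<dots> = (\<integral>\<^sup>+y. (\<integral>\<^sup>+\<rho>. indicator (ball x \<rho>) y * w \<rho> * g y \<partial>lborel) \<partial>lborel)"
    by (intro nn_integral_cong nn_integral_multc[symmetric]) measurable
  also have "\<dots> = (\<integral>\<^sup>+\<rho>. (\<integral>\<^sup>+y. indicator (ball x \<rho>) y * w \<rho> * g y \<partial>lborel) \<partial>lborel)"
    by (rule lborel_nn_integral_swap) measurable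
  also have "\<dots> \<le> (\<integral>\<^sup>+\<rho>. indicator {0<..} \<rho> * w \<rho> * ennreal (\<rho> ^ DIM('a)) * (ennreal (2 ^ DIM('a)) * hlmax g x) \<partial>lborel)"
  proof (rule nn_integral_mono)
    fix \<rho> :: real
    show "(\<integral>\<^sup>+y. indicator (ball x \<rho>) y * w \<rho> * g y \<partial>lborel)
      \<le> indicator {0<..} \<rho> * w \<rho> * ennreal (\<rho> ^ DIM('a)) * (ennreal (2 ^ DIM('a)) * hlmax g x)"
    proof (cases "0 < \<rho>")
      case True
      have "(\<integral>\<^sup>+y. indicator (ball x \<rho>) y * w \<rho> * g y \<partial>lborel) = (\<integral>\<^sup>+y. w \<rho> * (indicator (ball x \<rho>) y * g y) \<partial>lborel)"
        by (intro nn_integral_cong) (simp add: mult_ac)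
      also have "\<dots> = w \<rho> * (\<integral>\<^sup>+y. indicator (ball x \<rho>) y * g y \<partial>lborel)"
        by (rule nn_integral_cmult) measurable
      also have "\<dots> \<le> w \<rho> * (ennreal (2 ^ DIM('a) * \<rho> ^ DIM('a)) * hlmax g x)"
        by (intro mult_left_mono average_le_hlmax True) auto
      also have "\<dots> = indicator {0<..} \<rho> * w \<rho> * ennreal (\<rho> ^ DIM('a)) * (ennreal (2 ^ DIM('a)) * hlmax g x)"
        using True by (simp add: ennreal_mult mult_ac)
      finally show ?thesis .
    next
      case False
      then have "ball x \<rho> = {}" by simp
      then show ?thesis by (simp only: ball_empty) (simp add: indicator_def)
    qed
  qed
  also have "\<dots> = (\<integral>\<^sup>+\<rho>. indicator {0<..} \<rho> * w \<rho> * ennreal (\<rho> ^ DIM('a)) \<partial>lborel) * (ennreal (2 ^ DIM('a)) * hlmax g x)"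
    by (rule nn_integral_multc) measurable
  finally show ?thesis .
qed

text \<open>Makes a power of either sign a superposition of indicators of balls: the interval (r, 2
  r) has length r, and on it \<rho> powr (c - 1) varies at most by the factor 2 powr \<bar>c -
  1\<bar>. Using only radii comparable to r lets truncations of the kernel be read off from
  \<rho>.\<close>

lemma powr_le_dyadic_integral:
  fixes c r :: real
  assumes r: "0 < r"
  shows "ennreal (r powr c) \<le> (\<integral>\<^sup>+\<rho>. indicator {r<..<2*r} \<rho> * ennreal (2 powr \<bar>c - 1\<bar> * \<rho> powr (c - 1)) \<partial>lborel)"
proof -
  have "ennreal (r powr c) = ennreal (r powr (c - 1)) * emeasure lborel {r<..<2*r}"
    using r by (simp add: ennreal_mult[symmetric] powr_diff)
  also have "\<dots> = (\<integral>\<^sup>+\<rho>. ennreal (r powr (c - 1)) * indicator {r<..<2*r} \<rho> \<partial>lborel)"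
    by (subst nn_integral_cmult_indicator) auto
  also have "\<dots> \<le> (\<integral>\<^sup>+\<rho>. indicator {r<..<2*r} \<rho> * ennreal (2 powr \<bar>c - 1\<bar> * \<rho> powr (c - 1)) \<partial>lborel)"
  proof (rule nn_integral_mono)
    fix \<rho> :: real
    have "r powr (c - 1) \<le> 2 powr \<bar>c - 1\<bar> * \<rho> powr (c - 1)" if "r < \<rho>" "\<rho> < 2 * r"
    proof -
      have "(r / \<rho>) powr (c - 1) \<le> 2 powr \<bar>c - 1\<bar>"
      proof (cases "c - 1 \<ge> 0")
        case True
        have "(r / \<rho>) powr (c - 1) \<le> 2 powr (c - 1)" using that r True by (intro powr_mono2) (auto simp: field_simps)
        then show ?thesis using True by simp
      next
        case False
        have "(r / \<rho>) powr (c - 1) \<le> (1/2) powr (c - 1)" using that r False by (intro powr_mono2') (auto simp: field_simps)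
        then show ?thesis using False by (simp add: powr_divide powr_minus_divide[symmetric])
      qed
      then show ?thesis using that r by (simp add: powr_divide field_simps)
    qed
    then show "ennreal (r powr (c - 1)) * indicator {r<..<2*r} \<rho> \<le> indicator {r<..<2*r} \<rho> * ennreal (2 powr \<bar>c - 1\<bar> * \<rho> powr (c - 1))"
      by (auto simp: indicator_def intro!: ennreal_leI)
  qed
  finally show ?thesis .
qed

lemma power_eq_powr: "0 < \<rho> \<Longrightarrow> \<rho> ^ n = \<rho> powr real n"
  by (simp add: powr_realpow)

text \<open>The weight \<rho> powr (e - 1) that remains after counting volumes is integrable at 0
  because e > 0. This is the near part of Hedberg's splitting; applied to the constant 1 it also
  integrates powers over balls.\<close>

lemma truncated_riesz_le_hlmax:
  fixes x :: "'a::euclidean_space"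
  assumes e: "0 < e"
  shows "\<exists>C>0. \<forall>g\<in>borel_measurable borel. \<forall>x. \<forall>\<delta>>0.
    (\<integral>\<^sup>+y. ennreal (if dist (x::'a) y < \<delta> then dist x y powr (e - real DIM('a)) else 0) * g y \<partial>lborel)
      \<le> ennreal (C * \<delta> powr e) * hlmax g x"
proof -
  let ?d = "real DIM('a)"
  define K where "K = 2 powr \<bar>e - ?d - 1\<bar>"
  define C where "C = K * 2 powr e / e * 2 ^ DIM('a)"
  have "(\<integral>\<^sup>+y. ennreal (if dist x y < \<delta> then dist x y powr (e - ?d) else 0) * g y \<partial>lborel)
      \<le> ennreal (C * \<delta> powr e) * hlmax g x"
    if [measurable]: "g \<in> borel_measurable borel" and \<delta>: "0 < \<delta>" for g and x :: 'a and \<delta>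
  proof -
    \<comment> \<open>Radii up to 2 \<delta> are needed, because the dyadic interval of a point at
      distance below \<delta> reaches that far.\<close>
    define w where "w = (\<lambda>\<rho>. indicator {0<..2 * \<delta>} \<rho> * ennreal (K * \<rho> powr (e - ?d - 1)))"
    have [measurable]: "w \<in> borel_measurable borel" unfolding w_def by measurable
    have "(\<integral>\<^sup>+y. ennreal (if dist x y < \<delta> then dist x y powr (e - ?d) else 0) * g y \<partial>lborel)
       \<le> (\<integral>\<^sup>+\<rho>. indicator {0<..} \<rho> * w \<rho> * ennreal (\<rho> ^ DIM('a)) \<partial>lborel) * (ennreal (2 ^ DIM('a)) * hlmax g x)"
    proof (rule radial_kernel_le_hlmax)
      fix y assume y: "y \<noteq> x"
      show "ennreal (if dist x y < \<delta> then dist x y powr (e - ?d) else 0) \<le> (\<integral>\<^sup>+\<rho>. indicator (ball x \<rho>) y * w \<rho> \<partial>lborel)"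
      proof (cases "dist x y < \<delta>")
        case True
        have "ennreal (dist x y powr (e - ?d)) \<le> (\<integral>\<^sup>+\<rho>. indicator {dist x y<..<2*dist x y} \<rho> * ennreal (K * \<rho> powr (e - ?d - 1)) \<partial>lborel)"
          using y unfolding K_def by (intro powr_le_dyadic_integral) auto
        also have "\<dots> \<le> (\<integral>\<^sup>+\<rho>. indicator (ball x \<rho>) y * w \<rho> \<partial>lborel)"
          using True by (intro nn_integral_mono) (auto simp: w_def indicator_def)
        finally show ?thesis using True by simp
      qed simp
    qed measurable
    also have "(\<integral>\<^sup>+\<rho>. indicator {0<..} \<rho> * w \<rho> * ennreal (\<rho> ^ DIM('a)) \<partial>lborel)
       = (\<integral>\<^sup>+\<rho>. ennreal K * (indicator {0<..2*\<delta>} \<rho> * ennreal (\<rho> powr (e - 1))) \<partial>lborel)"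
    proof (rule nn_integral_cong)
      fix \<rho> :: real
      have eq: "K * \<rho> powr (e - ?d - 1) * \<rho> ^ DIM('a) = K * \<rho> powr (e - 1)" if "0 < \<rho>"
        unfolding power_eq_powr[OF that] mult.assoc powr_add[symmetric] by simp
      have "ennreal (K * \<rho> powr (e - ?d - 1)) * ennreal (\<rho> ^ DIM('a)) = ennreal K * ennreal (\<rho> powr (e - 1))" if "0 < \<rho>"
      proof -
        have "ennreal (K * \<rho> powr (e - ?d - 1)) * ennreal (\<rho> ^ DIM('a)) = ennreal (K * \<rho> powr (e - ?d - 1) * \<rho> ^ DIM('a))"
          using that by (intro ennreal_mult''[symmetric]) simp
        also have "\<dots> = ennreal (K * \<rho> powr (e - 1))" by (simp only: eq[OF that])
        also have "\<dots> = ennreal K * ennreal (\<rho> powr (e - 1))" by (rule ennreal_mult'') simp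
        finally show ?thesis .
      qed
      then show "indicator {0<..} \<rho> * w \<rho> * ennreal (\<rho> ^ DIM('a)) = ennreal K * (indicator {0<..2*\<delta>} \<rho> * ennreal (\<rho> powr (e - 1)))"
        by (simp add: w_def indicator_def)
    qed
    also have "\<dots> = ennreal K * ennreal ((2*\<delta>) powr e / e)"
      using e \<delta> by (subst nn_integral_cmult) (auto simp: nn_integral_powr_from_0)
    also have "ennreal K * ennreal ((2*\<delta>) powr e / e) * (ennreal (2 ^ DIM('a)) * hlmax g x) = ennreal (C * \<delta> powr e) * hlmax g x"
    proof -
      have "0 \<le> K" by (simp add: K_def)
      then have "ennreal K * ennreal ((2*\<delta>) powr e / e) * ennreal (2 ^ DIM('a)) = ennreal (K * ((2*\<delta>) powr e / e) * 2 ^ DIM('a))"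
        using e \<delta> by (simp add: ennreal_mult[symmetric])
      also have "K * ((2*\<delta>) powr e / e) * 2 ^ DIM('a) = C * \<delta> powr e"
        using \<delta> by (simp add: C_def powr_mult)
      finally show ?thesis by (simp only: mult.assoc[symmetric])
    qed
    finally show ?thesis .
  qed
  moreover have "0 < C" using e by (simp add: C_def K_def)
  ultimately show ?thesis by blast
qed

text \<open>In place of polar coordinates: the kernel bound at the origin for the constant function
  1, whose maximal function is at most the volume of the unit ball. Doubling R turns the closed ball
  into an open one.\<close>

lemma nn_integral_norm_powr_inside:
  assumes \<kappa>: "\<kappa> > - real DIM('a::euclidean_space)"
  shows "\<exists>C>0. \<forall>R>0. (\<integral>\<^sup>+y. ennreal (if norm (y::'a) \<le> R then norm y powr \<kappa> else 0) \<partial>lborel)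
    \<le> ennreal (C * R powr (\<kappa> + real DIM('a)))"
proof -
  let ?d = "real DIM('a)"
  obtain C where C: "C > 0" "\<And>g x \<delta>. g \<in> borel_measurable borel \<Longrightarrow> \<delta> > 0 \<Longrightarrow>
    (\<integral>\<^sup>+y. ennreal (if dist (x::'a) y < \<delta> then dist x y powr (\<kappa> + ?d - ?d) else 0) * g y \<partial>lborel)
      \<le> ennreal (C * \<delta> powr (\<kappa> + ?d)) * hlmax g x"
    using truncated_riesz_le_hlmax[of "\<kappa> + ?d"] \<kappa> by auto
  define V where "V = unit_ball_vol ?d"
  have V: "0 < V" by (simp add: V_def)
  have "(\<integral>\<^sup>+y. ennreal (if norm (y::'a) \<le> R then norm y powr \<kappa> else 0) \<partial>lborel) \<le> ennreal ((C * 2 powr (\<kappa> + ?d) * V) * R powr (\<kappa> + ?d))" if R: "R > 0" for R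
  proof -
    have "(\<integral>\<^sup>+y. ennreal (if norm (y::'a) \<le> R then norm y powr \<kappa> else 0) \<partial>lborel)
      \<le> (\<integral>\<^sup>+y. ennreal (if dist (0::'a) y < 2 * R then dist 0 y powr (\<kappa> + ?d - ?d) else 0) * 1 \<partial>lborel)"
      using R by (intro nn_integral_mono) (auto intro!: ennreal_leI)
    also have "\<dots> \<le> ennreal (C * (2*R) powr (\<kappa> + ?d)) * hlmax (\<lambda>_. 1) (0::'a)"
      using R C(2)[of "\<lambda>_. 1" "2 * R" 0] by simp
    also have "\<dots> \<le> ennreal (C * (2*R) powr (\<kappa> + ?d)) * (ennreal V * 1)"
      unfolding V_def by (intro mult_left_mono hlmax_const_le) auto
    also have "\<dots> = ennreal ((C * 2 powr (\<kappa> + ?d) * V) * R powr (\<kappa> + ?d))"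
      using R V C(1) by (simp add: ennreal_mult[symmetric] powr_mult mult_ac)
    finally show ?thesis .
  qed
  moreover have "0 < C * 2 powr (\<kappa> + ?d) * V" using C V by simp
  ultimately show ?thesis by blast
qed

text \<open>The same device with radii starting at R; \<kappa> < - d makes the integral over large
  radii converge.\<close>

lemma nn_integral_norm_powr_outside:
  assumes \<kappa>: "\<kappa> < - real DIM('a::euclidean_space)"
  shows "\<exists>C>0. \<forall>R>0. (\<integral>\<^sup>+y. ennreal (if R \<le> norm (y::'a) then norm y powr \<kappa> else 0) \<partial>lborel)
    \<le> ennreal (C * R powr (\<kappa> + real DIM('a)))"
proof -
  let ?d = "real DIM('a)"
  define V where "V = unit_ball_vol ?d"
  have V: "0 < V" by (simp add: V_def)
  define K where "K = 2 powr \<bar>\<kappa> - 1\<bar>"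
  have K: "0 < K" by (simp add: K_def)
  define C where "C = K / (- \<kappa> - ?d) * 2 ^ DIM('a) * V"
  have "(\<integral>\<^sup>+y. ennreal (if R \<le> norm (y::'a) then norm y powr \<kappa> else 0) \<partial>lborel) \<le> ennreal (C * R powr (\<kappa> + ?d))" if R: "R > 0" for R
  proof -
    define w where "w = (\<lambda>\<rho>. indicator {R..} \<rho> * ennreal (K * \<rho> powr (\<kappa> - 1)))"
    have [measurable]: "w \<in> borel_measurable borel" unfolding w_def by measurable
    have "(\<integral>\<^sup>+y. ennreal (if R \<le> norm (y::'a) then norm y powr \<kappa> else 0) * 1 \<partial>lborel)
       \<le> (\<integral>\<^sup>+\<rho>. indicator {0<..} \<rho> * w \<rho> * ennreal (\<rho> ^ DIM('a)) \<partial>lborel) * (ennreal (2 ^ DIM('a)) * hlmax (\<lambda>_. 1) (0::'a))"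
    proof (rule radial_kernel_le_hlmax)
      fix y :: 'a assume y: "y \<noteq> 0"
      show "ennreal (if R \<le> norm y then norm y powr \<kappa> else 0) \<le> (\<integral>\<^sup>+\<rho>. indicator (ball 0 \<rho>) y * w \<rho> \<partial>lborel)"
      proof (cases "R \<le> norm y")
        case True
        have "ennreal (norm y powr \<kappa>) \<le> (\<integral>\<^sup>+\<rho>. indicator {norm y<..<2*norm y} \<rho> * ennreal (K * \<rho> powr (\<kappa> - 1)) \<partial>lborel)"
          using y unfolding K_def by (intro powr_le_dyadic_integral) auto
        also have "\<dots> \<le> (\<integral>\<^sup>+\<rho>. indicator (ball 0 \<rho>) y * w \<rho> \<partial>lborel)"
          using True by (intro nn_integral_mono) (auto simp: w_def indicator_def)
        finally show ?thesis using True by simp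
      qed simp
    qed measurable
    also have "(\<integral>\<^sup>+\<rho>. indicator {0<..} \<rho> * w \<rho> * ennreal (\<rho> ^ DIM('a)) \<partial>lborel)
       = (\<integral>\<^sup>+\<rho>. ennreal K * (indicator {R..} \<rho> * ennreal (\<rho> powr (- (- \<kappa> - ?d) - 1))) \<partial>lborel)"
    proof (rule nn_integral_cong)
      fix \<rho> :: real
      have eq: "K * \<rho> powr (\<kappa> - 1) * \<rho> ^ DIM('a) = K * \<rho> powr (- (- \<kappa> - ?d) - 1)" if "0 < \<rho>"
        unfolding power_eq_powr[OF that] mult.assoc powr_add[symmetric] by (simp add: algebra_simps)
      have "ennreal (K * \<rho> powr (\<kappa> - 1)) * ennreal (\<rho> ^ DIM('a)) = ennreal K * ennreal (\<rho> powr (- (- \<kappa> - ?d) - 1))" if "0 < \<rho>"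
      proof -
        have "ennreal (K * \<rho> powr (\<kappa> - 1)) * ennreal (\<rho> ^ DIM('a)) = ennreal (K * \<rho> powr (\<kappa> - 1) * \<rho> ^ DIM('a))"
          using that by (intro ennreal_mult''[symmetric]) simp
        also have "\<dots> = ennreal (K * \<rho> powr (- (- \<kappa> - ?d) - 1))" by (simp only: eq[OF that])
        also have "\<dots> = ennreal K * ennreal (\<rho> powr (- (- \<kappa> - ?d) - 1))" by (rule ennreal_mult'') simp
        finally show ?thesis .
      qed
      then show "indicator {0<..} \<rho> * w \<rho> * ennreal (\<rho> ^ DIM('a)) = ennreal K * (indicator {R..} \<rho> * ennreal (\<rho> powr (- (- \<kappa> - ?d) - 1)))"
        using R by (simp add: w_def indicator_def)
    qed
    also have "\<dots> = ennreal K * ennreal (R powr (- (- \<kappa> - ?d)) / (- \<kappa> - ?d))"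
      using \<kappa> R nn_integral_powr_to_inf[of "- \<kappa> - ?d" R] by (subst nn_integral_cmult) auto
    also have "\<dots> * (ennreal (2 ^ DIM('a)) * hlmax (\<lambda>_. 1) (0::'a)) \<le> \<dots> * (ennreal (2 ^ DIM('a)) * (ennreal V * 1))"
      unfolding V_def by (intro mult_left_mono hlmax_const_le) auto
    also have "\<dots> = ennreal (C * R powr (\<kappa> + ?d))"
    proof -
      have "ennreal K * ennreal (R powr (- (- \<kappa> - ?d)) / (- \<kappa> - ?d)) * ennreal (2 ^ DIM('a)) * ennreal V
        = ennreal (K * (R powr (- (- \<kappa> - ?d)) / (- \<kappa> - ?d)) * 2 ^ DIM('a) * V)"
        using \<kappa> V K by (simp add: ennreal_mult[symmetric])
      also have "K * (R powr (- (- \<kappa> - ?d)) / (- \<kappa> - ?d)) * 2 ^ DIM('a) * V = C * R powr (\<kappa> + ?d)"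
        by (simp add: C_def add.commute)
      finally show ?thesis by (simp only: mult.assoc[symmetric] mult_1_right)
    qed
    finally show ?thesis by simp
  qed
  moreover have "0 < C" using \<kappa> V K by (simp add: C_def)
  ultimately show ?thesis by blast
qed

text \<open>Schur's test with test function u: write K h as the product of K^(1/p) h / u and K^(1/q)
  u and apply Hoelder. The row and column bounds exclude the origin, where a power of the norm is
  not positive.\<close>

lemma schur_test:
  fixes K :: "'a::euclidean_space \<Rightarrow> 'a \<Rightarrow> ennreal" and u :: "'a \<Rightarrow> real"
  assumes [measurable]: "case_prod K \<in> borel_measurable (borel \<Otimes>\<^sub>M borel)"
      "u \<in> borel_measurable borel" "h \<in> borel_measurable borel"
    and p: "1 < p" "1 / p + 1 / q = 1"
    and u: "\<And>x. x \<noteq> 0 \<Longrightarrow> 0 < u x"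
    and A: "0 \<le> A" "\<And>x. x \<noteq> 0 \<Longrightarrow> (\<integral>\<^sup>+y. K x y * ennreal (u y powr q) \<partial>lborel) \<le> ennreal (A * u x powr q)"
    and B: "\<And>y. y \<noteq> 0 \<Longrightarrow> (\<integral>\<^sup>+x. K x y * ennreal (u x powr p) \<partial>lborel) \<le> ennreal (B * u y powr p)"
  shows "(\<integral>\<^sup>+x. ennpowr (\<integral>\<^sup>+y. K x y * h y \<partial>lborel) p \<partial>lborel)
    \<le> ennreal (A powr (p / q) * B) * (\<integral>\<^sup>+y. ennpowr (h y) p \<partial>lborel)"
proof -
  have q: "1 / q = 1 - 1 / p" "0 < q"
  proof -
    show "1 / q = 1 - 1 / p" using p by simp
    moreover have "1 - 1 / p > 0" using p by simp
    ultimately show "0 < q" by (metis zero_less_divide_1_iff)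
  qed
  have pq: "p * (1 / q) = p / q" by simp
  define H where "H = (\<lambda>y. ennpowr (h y) p * ennreal (u y powr (- p)))"
  have [measurable]: "H \<in> borel_measurable borel" unfolding H_def by measurable
  have 1: "ennpowr (\<integral>\<^sup>+y. K x y * h y \<partial>lborel) p \<le> ennreal (A powr (p / q) * u x powr p) * (\<integral>\<^sup>+y. K x y * H y \<partial>lborel)"
    if x: "x \<noteq> 0" for x
  proof -
    have "(\<integral>\<^sup>+y. K x y * h y \<partial>lborel) = (\<integral>\<^sup>+y. ennpowr (K x y * H y) (1 / p) * ennpowr (K x y * ennreal (u y powr q)) (1 - 1 / p) \<partial>lborel)"
    proof (rule nn_integral_cong_AE)
      show "AE y in lborel. K x y * h y = ennpowr (K x y * H y) (1 / p) * ennpowr (K x y * ennreal (u y powr q)) (1 - 1 / p)"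
        using AE_lborel_nonzero
      proof eventually_elim
        case (elim y)
        have uy: "0 < u y" using u[OF elim] .
        have "ennpowr (K x y * H y) (1 / p) * ennpowr (K x y * ennreal (u y powr q)) (1 / q)
          = (ennpowr (K x y) (1/p) * ennpowr (K x y) (1/q)) * h y * (ennreal (u y powr (-1)) * ennreal (u y powr 1))"
          unfolding H_def using p q(2) uy
          by (simp add: ennpowr_mult ennpowr_ennpowr ennpowr_ennreal powr_powr mult_ac)
        also have "ennpowr (K x y) (1/p) * ennpowr (K x y) (1/q) = K x y"
          using p q by (subst ennpowr_add[symmetric]) auto
        also have "ennreal (u y powr (-1)) * ennreal (u y powr 1) = 1"
          using uy by (subst ennreal_mult[symmetric]) (auto simp: powr_add[symmetric])
        finally show ?case unfolding q by simp
      qed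
    qed
    also have "\<dots> \<le> ennpowr (\<integral>\<^sup>+y. K x y * H y \<partial>lborel) (1/p) * ennpowr (\<integral>\<^sup>+y. K x y * ennreal (u y powr q) \<partial>lborel) (1 - 1/p)"
      using p by (intro nn_integral_Holder) auto
    also have "\<dots> \<le> ennpowr (\<integral>\<^sup>+y. K x y * H y \<partial>lborel) (1/p) * ennpowr (ennreal (A * u x powr q)) (1 / q)"
      unfolding q(1)[symmetric] using A x q(2) by (intro mult_left_mono ennpowr_mono) auto
    finally have "ennpowr (\<integral>\<^sup>+y. K x y * h y \<partial>lborel) p
      \<le> ennpowr (ennpowr (\<integral>\<^sup>+y. K x y * H y \<partial>lborel) (1/p) * ennpowr (ennreal (A * u x powr q)) (1 / q)) p"
      using p by (intro ennpowr_mono) auto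
    also have "\<dots> = (\<integral>\<^sup>+y. K x y * H y \<partial>lborel) * ennpowr (ennreal (A * u x powr q)) (p / q)"
      using p q(2) by (simp add: ennpowr_mult ennpowr_ennpowr)
    also have "ennpowr (ennreal (A * u x powr q)) (p / q) = ennreal (A powr (p / q) * u x powr p)"
      using p q(2) A(1) by (simp add: ennpowr_ennreal powr_mult powr_powr)
    finally show ?thesis by (simp add: mult.commute)
  qed
  have "(\<integral>\<^sup>+x. ennpowr (\<integral>\<^sup>+y. K x y * h y \<partial>lborel) p \<partial>lborel)
     \<le> (\<integral>\<^sup>+x. ennreal (A powr (p / q) * u x powr p) * (\<integral>\<^sup>+y. K x y * H y \<partial>lborel) \<partial>lborel)"
    by (intro nn_integral_mono_AE, use AE_lborel_nonzero in eventually_elim) (rule 1)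
  also have "\<dots> = (\<integral>\<^sup>+x. (\<integral>\<^sup>+y. ennreal (A powr (p / q) * u x powr p) * (K x y * H y) \<partial>lborel) \<partial>lborel)"
    by (intro nn_integral_cong nn_integral_cmult[symmetric]) measurable
  also have "\<dots> = (\<integral>\<^sup>+y. (\<integral>\<^sup>+x. ennreal (A powr (p / q) * u x powr p) * (K x y * H y) \<partial>lborel) \<partial>lborel)"
    by (rule lborel_nn_integral_swap) measurable
  also have "\<dots> = (\<integral>\<^sup>+y. ennreal (A powr (p / q)) * H y * (\<integral>\<^sup>+x. K x y * ennreal (u x powr p) \<partial>lborel) \<partial>lborel)"
    by (intro nn_integral_cong, subst nn_integral_cmult[symmetric])
       (auto simp: ennreal_mult mult_ac)
  also have "\<dots> \<le> (\<integral>\<^sup>+y. ennreal (A powr (p / q) * B) * ennpowr (h y) p \<partial>lborel)"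
  proof (intro nn_integral_mono_AE, use AE_lborel_nonzero in eventually_elim)
    case (elim y)
    have "ennreal (A powr (p / q)) * H y * (\<integral>\<^sup>+x. K x y * ennreal (u x powr p) \<partial>lborel)
       \<le> ennreal (A powr (p / q)) * H y * ennreal (B * u y powr p)"
      by (intro mult_left_mono B elim) auto
    also have "\<dots> \<le> ennreal (A powr (p / q) * B) * ennpowr (h y) p"
    proof (cases "0 \<le> B")
      case True
      have "ennreal (A powr (p / q)) * H y * ennreal (B * u y powr p)
        = ennreal (A powr (p / q)) * ennreal (u y powr (- p)) * ennreal (B * u y powr p) * ennpowr (h y) p"
        unfolding H_def by (simp add: mult_ac)
      also have "ennreal (A powr (p / q)) * ennreal (u y powr (- p)) * ennreal (B * u y powr p) = ennreal (A powr (p / q) * B)"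
        using u[OF elim] True by (simp add: ennreal_mult[symmetric] powr_minus)
      finally show ?thesis by simp
    next
      \<comment> \<open>For B < 0 the column bound says that the integral vanishes, since
        \<open>ennreal\<close> maps negative numbers to 0.\<close>
      case False
      then have "B * u y powr p \<le> 0" by (simp add: mult_nonpos_nonneg)
      then show ?thesis by (simp add: ennreal_neg)
    qed
    finally show ?case .
  qed
  also have "\<dots> = ennreal (A powr (p / q) * B) * (\<integral>\<^sup>+y. ennpowr (h y) p \<partial>lborel)"
    by (rule nn_integral_cmult) measurable
  finally show ?thesis .
qed

text \<open>Here and in \<open>hardy_out\<close>: kernels homogeneous of degree - d, namely those of
  the Hardy averaging operator and of its dual, conjugated by powers of the norm. They absorb the
  interaction of points of very different norm, where a power weight is far from constant.\<close>

definition hardy_in :: "real \<Rightarrow> 'a::euclidean_space \<Rightarrow> 'a \<Rightarrow> real" where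
  "hardy_in \<mu> x y = (if norm y \<le> norm x then norm x powr \<mu> * norm y powr (- real DIM('a) - \<mu>) else 0)"

definition hardy_out :: "real \<Rightarrow> 'a::euclidean_space \<Rightarrow> 'a \<Rightarrow> real" where
  "hardy_out \<mu> x y = (if norm x \<le> norm y then norm x powr \<mu> * norm y powr (- real DIM('a) - \<mu>) else 0)"

lemma measurable_hardy [measurable]:
  "case_prod (hardy_in \<mu>) \<in> borel_measurable (borel \<Otimes>\<^sub>M borel)"
  "case_prod (hardy_out \<mu>) \<in> borel_measurable (borel \<Otimes>\<^sub>M borel)"
  unfolding hardy_in_def hardy_out_def by measurable

lemma hardy_nonneg [simp]: "0 \<le> hardy_in \<mu> x y" "0 \<le> hardy_out \<mu> x y"
  by (simp_all add: hardy_in_def hardy_out_def)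

lemma conj_exponent:
  assumes "1 < p"
  obtains q where "1 < q" "1 / p + 1 / q = (1::real)"
proof
  show "1 < p / (p - 1)" using assms by simp
  show "1 / p + 1 / (p / (p - 1)) = 1" using assms by (simp add: field_simps)
qed

text \<open>Common part of the two Hardy inequalities, P choosing the side. The test function is a
  power of the norm; by homogeneity the Schur integrals are powers of the radius again, with A and B
  independent of it.\<close>

lemma hardy_schur:
  fixes P :: "real \<Rightarrow> real \<Rightarrow> bool" and K :: "'a::euclidean_space \<Rightarrow> 'a \<Rightarrow> real"
  assumes p: "1 < p" "1 / p + 1 / q = 1" "q \<noteq> 0" and h: "h \<in> borel_measurable borel"
    and K: "\<And>x y. K x y = (if P (norm x) (norm y) then norm x powr \<mu> * norm y powr (- real DIM('a) - \<mu>) else 0)"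
    and [measurable]: "case_prod K \<in> borel_measurable (borel \<Otimes>\<^sub>M borel)"
    and A: "0 \<le> A" "\<And>R. 0 < R \<Longrightarrow> (\<integral>\<^sup>+y. ennreal (if P R (norm (y::'a)) then norm y powr (- real DIM('a) - \<mu> - l * q) else 0) \<partial>lborel)
      \<le> ennreal (A * R powr (- real DIM('a) - \<mu> - l * q + real DIM('a)))"
    and B: "0 \<le> B" "\<And>R. 0 < R \<Longrightarrow> (\<integral>\<^sup>+x. ennreal (if P (norm (x::'a)) R then norm x powr (\<mu> - l * p) else 0) \<partial>lborel)
      \<le> ennreal (B * R powr (\<mu> - l * p + real DIM('a)))"
    and [measurable]: "Measurable.pred (borel \<Otimes>\<^sub>M borel) (case_prod P)"
  shows "(\<integral>\<^sup>+x. ennpowr (\<integral>\<^sup>+y. ennreal (K (x::'a) y) * h y \<partial>lborel) p \<partial>lborel)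
    \<le> ennreal (A powr (p / q) * B) * (\<integral>\<^sup>+y. ennpowr (h y) p \<partial>lborel)"
proof (rule schur_test[where u = "\<lambda>y. norm y powr (- l)"])
  let ?d = "real DIM('a)"
  have [measurable]: "(\<lambda>y. P (f y) (g y)) \<in> measurable borel (count_space UNIV)"
    if [measurable]: "f \<in> borel_measurable borel" "g \<in> borel_measurable borel" for f g :: "'a \<Rightarrow> real"
    using measurable_compose[of "\<lambda>y. (f y, g y)" borel "borel \<Otimes>\<^sub>M borel" "case_prod P"] by simp
  {
    fix x :: 'a assume x: "x \<noteq> 0"
    have "(\<integral>\<^sup>+y. ennreal (K x y) * ennreal ((norm y powr (- l)) powr q) \<partial>lborel)
       = (\<integral>\<^sup>+y. ennreal (norm x powr \<mu>) * ennreal (if P (norm x) (norm (y::'a)) then norm y powr (- ?d - \<mu> - l * q) else 0) \<partial>lborel)"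
      by (rule nn_integral_cong, simp add: K ennreal_mult[symmetric] powr_powr powr_add[symmetric] mult.assoc)
    also have "\<dots> \<le> ennreal (norm x powr \<mu>) * ennreal (A * norm x powr (- ?d - \<mu> - l * q + ?d))"
      using A(2)[of "norm x"] x by (subst nn_integral_cmult) (auto intro!: mult_left_mono)
    also have "\<dots> = ennreal (A * (norm x powr (- l)) powr q)"
      using A(1) x by (simp add: ennreal_mult[symmetric] powr_powr powr_add[symmetric] mult.left_commute)
    finally show "(\<integral>\<^sup>+y. ennreal (K x y) * ennreal ((norm y powr (- l)) powr q) \<partial>lborel) \<le> \<dots>" .
  next
    fix y :: 'a assume y: "y \<noteq> 0"
    have "(\<integral>\<^sup>+x. ennreal (K x y) * ennreal ((norm x powr (- l)) powr p) \<partial>lborel)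
       = (\<integral>\<^sup>+x. ennreal (norm y powr (- ?d - \<mu>)) * ennreal (if P (norm (x::'a)) (norm y) then norm x powr (\<mu> - l * p) else 0) \<partial>lborel)"
      by (rule nn_integral_cong, simp add: K ennreal_mult[symmetric] powr_powr powr_add[symmetric] mult_ac)
    also have "\<dots> \<le> ennreal (norm y powr (- ?d - \<mu>)) * ennreal (B * norm y powr (\<mu> - l * p + ?d))"
      using B(2)[of "norm y"] y by (subst nn_integral_cmult) (auto intro!: mult_left_mono)
    also have "\<dots> = ennreal (B * (norm y powr (- l)) powr p)"
      using B(1) y by (simp add: ennreal_mult[symmetric] powr_powr powr_add[symmetric] mult.left_commute)
    finally show "(\<integral>\<^sup>+x. ennreal (K x y) * ennreal ((norm x powr (- l)) powr p) \<partial>lborel) \<le> \<dots>" .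
  }
qed (use A p h in auto)

lemma hardy_in_bounded:
  assumes p: "1 < p" and \<mu>: "\<mu> < - real DIM('a::euclidean_space) / p"
  shows "\<exists>C>0. \<forall>h\<in>borel_measurable borel.
    (\<integral>\<^sup>+x. ennpowr (\<integral>\<^sup>+y. ennreal (hardy_in \<mu> (x::'a) y) * h y \<partial>lborel) p \<partial>lborel) \<le> ennreal C * (\<integral>\<^sup>+y. ennpowr (h y) p \<partial>lborel)"
proof -
  let ?d = "real DIM('a)"
  obtain q where q: "1 < q" "1 / p + 1 / q = 1" using conj_exponent[OF p] .
  \<comment> \<open>The exponent l must exceed (\<mu> + d) / p, so that the column integral
    converges outside a ball, and stay below - \<mu> / q, so that the row integral converges inside
    one. Such an l exists exactly when \<mu> < - d / p.\<close>
  have "(\<mu> + ?d) / p + \<mu> / q = \<mu> * (1 / p + 1 / q) + ?d / p" by (simp add: algebra_simps add_divide_distrib)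
  then have "(\<mu> + ?d) / p < - \<mu> / q" using q \<mu> by simp
  then obtain l where l: "(\<mu> + ?d) / p < l" "l < - \<mu> / q" using dense by blast
  have l1: "- ?d - \<mu> - l * q > - ?d" and l2: "\<mu> - l * p < - ?d" using l p q by (simp_all add: field_simps)
  obtain A where A: "A > 0" "\<And>R. R > 0 \<Longrightarrow> (\<integral>\<^sup>+y. ennreal (if norm (y::'a) \<le> R then norm y powr (- ?d - \<mu> - l * q) else 0) \<partial>lborel)
    \<le> ennreal (A * R powr (- ?d - \<mu> - l * q + ?d))" using nn_integral_norm_powr_inside[OF l1] by blast
  obtain B where B: "B > 0" "\<And>R. R > 0 \<Longrightarrow> (\<integral>\<^sup>+y. ennreal (if R \<le> norm (y::'a) then norm y powr (\<mu> - l * p) else 0) \<partial>lborel)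
    \<le> ennreal (B * R powr (\<mu> - l * p + ?d))" using nn_integral_norm_powr_outside[OF l2] by blast
  have "(\<integral>\<^sup>+x. ennpowr (\<integral>\<^sup>+y. ennreal (hardy_in \<mu> (x::'a) y) * h y \<partial>lborel) p \<partial>lborel)
    \<le> ennreal (A powr (p / q) * B) * (\<integral>\<^sup>+y. ennpowr (h y) p \<partial>lborel)" if "h \<in> borel_measurable borel" for h
    by (rule hardy_schur[where P = "\<lambda>R S. S \<le> R", OF p q(2) _ that hardy_in_def measurable_hardy(1) _ A(2) _ B(2)])
       (use q A B in \<open>auto simp: less_imp_le\<close>)
  moreover have "0 < A powr (p / q) * B" using A B by simp
  ultimately show ?thesis by blast
qed

lemma hardy_out_bounded:
  assumes p: "1 < p" and \<mu>: "\<mu> > - real DIM('a::euclidean_space) / p"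
  shows "\<exists>C>0. \<forall>h\<in>borel_measurable borel.
    (\<integral>\<^sup>+x. ennpowr (\<integral>\<^sup>+y. ennreal (hardy_out \<mu> (x::'a) y) * h y \<partial>lborel) p \<partial>lborel) \<le> ennreal C * (\<integral>\<^sup>+y. ennpowr (h y) p \<partial>lborel)"
proof -
  let ?d = "real DIM('a)"
  obtain q where q: "1 < q" "1 / p + 1 / q = 1" using conj_exponent[OF p] .
  have "(\<mu> + ?d) / p + \<mu> / q = \<mu> * (1 / p + 1 / q) + ?d / p" by (simp add: algebra_simps add_divide_distrib)
  then have "(\<mu> + ?d) / p > - \<mu> / q" using q \<mu> by simp
  then obtain l where l: "(\<mu> + ?d) / p > l" "l > - \<mu> / q" using dense by blast
  have l1: "- ?d - \<mu> - l * q < - ?d" and l2: "\<mu> - l * p > - ?d" using l p q by (simp_all add: field_simps)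
  obtain A where A: "A > 0" "\<And>R. R > 0 \<Longrightarrow> (\<integral>\<^sup>+y. ennreal (if R \<le> norm (y::'a) then norm y powr (- ?d - \<mu> - l * q) else 0) \<partial>lborel)
    \<le> ennreal (A * R powr (- ?d - \<mu> - l * q + ?d))" using nn_integral_norm_powr_outside[OF l1] by blast
  obtain B where B: "B > 0" "\<And>R. R > 0 \<Longrightarrow> (\<integral>\<^sup>+y. ennreal (if norm (y::'a) \<le> R then norm y powr (\<mu> - l * p) else 0) \<partial>lborel)
    \<le> ennreal (B * R powr (\<mu> - l * p + ?d))" using nn_integral_norm_powr_inside[OF l2] by blast
  have "(\<integral>\<^sup>+x. ennpowr (\<integral>\<^sup>+y. ennreal (hardy_out \<mu> (x::'a) y) * h y \<partial>lborel) p \<partial>lborel)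
    \<le> ennreal (A powr (p / q) * B) * (\<integral>\<^sup>+y. ennpowr (h y) p \<partial>lborel)" if "h \<in> borel_measurable borel" for h
    by (rule hardy_schur[where P = "\<lambda>R S. R \<le> S", OF p q(2) _ that hardy_out_def measurable_hardy(2) _ A(2) _ B(2)])
       (use q A B in \<open>auto simp: less_imp_le\<close>)
  moreover have "0 < A powr (p / q) * B" using A B by simp
  ultimately show ?thesis by blast
qed

section \<open>Power weights for the maximal operator\<close>

lemma powr_comparable:
  fixes \<alpha> a b :: real
  assumes "0 < a" "0 < b" "a \<le> 2 * b" "b \<le> 2 * a"
  shows "a powr \<alpha> \<le> 2 powr \<bar>\<alpha>\<bar> * b powr \<alpha>"
proof -
  have "(a / b) powr \<alpha> \<le> 2 powr \<bar>\<alpha>\<bar>"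
  proof (cases "0 \<le> \<alpha>")
    case True
    have "(a / b) powr \<alpha> \<le> 2 powr \<alpha>" using assms True by (intro powr_mono2) (auto simp: field_simps)
    then show ?thesis using True by simp
  next
    case False
    have "(a / b) powr \<alpha> \<le> (1/2) powr \<alpha>" using assms False by (intro powr_mono2') (auto simp: field_simps)
    then show ?thesis using False by (simp add: powr_divide powr_minus_divide[symmetric])
  qed
  then show ?thesis using assms by (simp add: powr_divide field_simps)
qed

text \<open>Conjugate by the weight and compare |y| with |x| for y in a ball around x. If |y| \<le>
  |x| / 2 or |y| \<ge> 2 |x|, the radius is at least half the larger norm, and a Hardy kernel
  dominates: \<alpha> < d - d / p is the condition for the inner kernel, \<alpha> > - d / p for the
  outer one. Where the norms are comparable so are the weights, and the unweighted bound
  applies.\<close>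

lemma hlmax_weighted:
  assumes p: "1 < p" and \<alpha>: "- real DIM('a::euclidean_space) / p < \<alpha>" "\<alpha> < real DIM('a) - real DIM('a) / p"
  shows "\<exists>C>0. \<forall>u\<in>borel_measurable borel.
    (\<integral>\<^sup>+x. ennpowr (ennreal (norm x powr \<alpha>) * hlmax u (x::'a)) p \<partial>lborel)
      \<le> ennreal C * (\<integral>\<^sup>+x. ennpowr (ennreal (norm x powr \<alpha>) * u x) p \<partial>lborel)"
proof -
  let ?d = "real DIM('a)"
  obtain C1 where C1: "C1 > 0" "\<And>h. h \<in> borel_measurable borel \<Longrightarrow>
    (\<integral>\<^sup>+x. ennpowr (\<integral>\<^sup>+y. ennreal (hardy_in (\<alpha> - ?d) (x::'a) y) * h y \<partial>lborel) p \<partial>lborel) \<le> ennreal C1 * (\<integral>\<^sup>+y. ennpowr (h y) p \<partial>lborel)"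
    using hardy_in_bounded[where 'a='a, OF p, of "\<alpha> - ?d"] \<alpha> by (auto simp: algebra_simps)
  obtain C2 where C2: "C2 > 0" "\<And>h. h \<in> borel_measurable borel \<Longrightarrow>
    (\<integral>\<^sup>+x. ennpowr (\<integral>\<^sup>+y. ennreal (hardy_out \<alpha> (x::'a) y) * h y \<partial>lborel) p \<partial>lborel) \<le> ennreal C2 * (\<integral>\<^sup>+y. ennpowr (h y) p \<partial>lborel)"
    using hardy_out_bounded[where 'a='a, OF p, of "\<alpha>"] \<alpha> by auto
  obtain C3 where C3: "C3 > 0" "\<And>h. h \<in> borel_measurable borel \<Longrightarrow>
    (\<integral>\<^sup>+x. ennpowr (hlmax h (x::'a)) p \<partial>lborel) \<le> ennreal C3 * (\<integral>\<^sup>+y. ennpowr (h y) p \<partial>lborel)"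
    using hlmax_strong_type[where 'a='a, OF p] by auto
  define c where "c = 2 powr (?d + \<bar>\<alpha>\<bar>)"
  have c: "0 < c" by (simp add: c_def)
  have c1: "2 ^ DIM('a) \<le> c" "2 powr \<bar>\<alpha>\<bar> \<le> c"
    by (simp_all add: c_def powr_realpow[symmetric])
  define D where "D = c powr p * (2 powr p * (2 powr p * (C1 + C2) + C3))"
  have D: "0 < D" using c C1 C2 C3 by (simp add: D_def add_pos_pos)
  have "(\<integral>\<^sup>+x. ennpowr (ennreal (norm x powr \<alpha>) * hlmax u (x::'a)) p \<partial>lborel)
      \<le> ennreal D * (\<integral>\<^sup>+x. ennpowr (ennreal (norm x powr \<alpha>) * u x) p \<partial>lborel)"
    if [measurable]: "u \<in> borel_measurable borel" for u
  proof -
    define h where "h = (\<lambda>y::'a. ennreal (norm y powr \<alpha>) * u y)"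
    have [measurable]: "h \<in> borel_measurable borel" unfolding h_def by measurable
    let ?A = "\<lambda>x. (\<integral>\<^sup>+y. ennreal (hardy_in (\<alpha> - ?d) x y) * h y \<partial>lborel)"
    let ?B = "\<lambda>x. (\<integral>\<^sup>+y. ennreal (hardy_out \<alpha> x y) * h y \<partial>lborel)"
    have split: "norm x powr \<alpha> * (1 / R ^ DIM('a)) \<le>
        c * (hardy_in (\<alpha> - ?d) x y + hardy_out \<alpha> x y + 1 / R ^ DIM('a)) * norm y powr \<alpha>"
      if xy: "x \<noteq> 0" "y \<noteq> 0" "dist x y < R" for x y :: 'a and R
    proof -
      have R: "0 < R" using xy zero_le_dist[of x y] by linarith
      have tri: "norm x - norm y \<le> dist x y" "norm y - norm x \<le> dist x y"
        using norm_triangle_ineq2[of x y] norm_triangle_ineq2[of y x] by (simp_all add: dist_norm norm_minus_commute)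
      have ne: "0 < norm x" "0 < norm y" using xy by auto
      consider "norm y \<le> norm x / 2" | "2 * norm x \<le> norm y" | "norm x / 2 < norm y" "norm y < 2 * norm x" by linarith
      then show ?thesis
      proof cases
        case 1
        have yx: "norm y \<le> norm x" using 1 ne by linarith
        have "norm x / 2 \<le> R" using 1 tri xy by linarith
        then have "1 / R ^ DIM('a) \<le> 1 / (norm x / 2) ^ DIM('a)"
          using ne R by (intro divide_left_mono power_mono mult_pos_pos zero_less_power) auto
        also have "\<dots> = 2 ^ DIM('a) * norm x powr (- ?d)"
          using ne by (simp add: power_divide powr_minus powr_realpow field_simps)
        also have "\<dots> \<le> c * norm x powr (- ?d)" using c1 by (intro mult_right_mono) auto
        finally have "norm x powr \<alpha> * (1 / R ^ DIM('a)) \<le> norm x powr \<alpha> * (c * norm x powr (- ?d))"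
          by (intro mult_left_mono) auto
        also have "\<dots> = c * hardy_in (\<alpha> - ?d) x y * norm y powr \<alpha>"
          using yx ne by (simp add: hardy_in_def powr_diff powr_minus field_simps)
        also have "\<dots> \<le> c * (hardy_in (\<alpha> - ?d) x y + hardy_out \<alpha> x y + 1 / R ^ DIM('a)) * norm y powr \<alpha>"
          using c R by (intro mult_right_mono mult_left_mono) auto
        finally show ?thesis .
      next
        case 2
        have yx: "norm x \<le> norm y" using 2 ne by linarith
        have "norm y / 2 \<le> R" using 2 tri xy by linarith
        then have "1 / R ^ DIM('a) \<le> 1 / (norm y / 2) ^ DIM('a)"
          using ne R by (intro divide_left_mono power_mono mult_pos_pos zero_less_power) auto
        also have "\<dots> = 2 ^ DIM('a) * norm y powr (- ?d)"
          using ne by (simp add: power_divide powr_minus powr_realpow field_simps)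
        also have "\<dots> \<le> c * norm y powr (- ?d)" using c1 by (intro mult_right_mono) auto
        finally have "norm x powr \<alpha> * (1 / R ^ DIM('a)) \<le> norm x powr \<alpha> * (c * norm y powr (- ?d))"
          by (intro mult_left_mono) auto
        also have "\<dots> = c * hardy_out \<alpha> x y * norm y powr \<alpha>"
          using yx ne by (simp add: hardy_out_def powr_diff powr_minus field_simps)
        also have "\<dots> \<le> c * (hardy_in (\<alpha> - ?d) x y + hardy_out \<alpha> x y + 1 / R ^ DIM('a)) * norm y powr \<alpha>"
          using c R by (intro mult_right_mono mult_left_mono) auto
        finally show ?thesis .
      next
        case 3
        have "norm x powr \<alpha> \<le> 2 powr \<bar>\<alpha>\<bar> * norm y powr \<alpha>"
          using 3 ne by (intro powr_comparable) auto
        also have "\<dots> \<le> c * norm y powr \<alpha>" using c1 by (intro mult_right_mono) auto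
        finally have "norm x powr \<alpha> * (1 / R ^ DIM('a)) \<le> c * norm y powr \<alpha> * (1 / R ^ DIM('a))"
          using R by (intro mult_right_mono) auto
        also have "\<dots> \<le> c * (hardy_in (\<alpha> - ?d) x y + hardy_out \<alpha> x y + 1 / R ^ DIM('a)) * norm y powr \<alpha>"
          using c R by (simp add: algebra_simps)
        finally show ?thesis .
      qed
    qed
    have pw: "ennreal (norm x powr \<alpha>) * hlmax u x \<le> ennreal c * ((?A x + ?B x) + hlmax h x)" if x: "x \<noteq> 0" for x
    proof -
      have "ennreal (norm x powr \<alpha>) * (ennreal (1 / (2 powr k) ^ DIM('a)) * (\<integral>\<^sup>+y. indicator (ball x (2 powr k)) y * u y \<partial>lborel))
         \<le> ennreal c * ((?A x + ?B x) + hlmax h x)" for k :: int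
      proof -
        define b where "b = 1 / (2 powr real_of_int k) ^ DIM('a)"
        have b: "0 < b" by (simp add: b_def)
        have "ennreal (norm x powr \<alpha>) * (ennreal b * (\<integral>\<^sup>+y. indicator (ball x (2 powr k)) y * u y \<partial>lborel))
          = (\<integral>\<^sup>+y. ennreal (norm x powr \<alpha> * b) * (indicator (ball x (2 powr k)) y * u y) \<partial>lborel)"
          using b by (subst nn_integral_cmult) (auto simp: ennreal_mult mult.assoc)
        also have "\<dots> \<le> (\<integral>\<^sup>+y. ennreal c * ((ennreal (hardy_in (\<alpha> - ?d) x y) * h y + ennreal (hardy_out \<alpha> x y) * h y)
              + ennreal b * (indicator (ball x (2 powr k)) y * h y)) \<partial>lborel)"
        proof (intro nn_integral_mono_AE, use AE_lborel_nonzero in eventually_elim)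
          case (elim y)
          show ?case
          proof (cases "dist x y < 2 powr k")
            case True
            have "ennreal (norm x powr \<alpha> * b) * u y
               \<le> ennreal (c * (hardy_in (\<alpha> - ?d) x y + hardy_out \<alpha> x y + b) * norm y powr \<alpha>) * u y"
              using split[OF x elim True] by (intro mult_right_mono ennreal_leI) (auto simp: b_def)
            also have "\<dots> = ennreal c * ((ennreal (hardy_in (\<alpha> - ?d) x y) * h y + ennreal (hardy_out \<alpha> x y) * h y)
              + ennreal b * h y)"
              using c b by (simp add: h_def ennreal_mult ennreal_plus distrib_left distrib_right mult_ac)
            finally show ?thesis using True by simp
          qed simp
        qed
        also have "\<dots> = ennreal c * ((?A x + ?B x) + ennreal b * (\<integral>\<^sup>+y. indicator (ball x (2 powr k)) y * h y \<partial>lborel))"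
          by (simp add: nn_integral_cmult nn_integral_add)
        also have "\<dots> \<le> ennreal c * ((?A x + ?B x) + hlmax h x)"
          unfolding hlmax_def b_def by (intro mult_left_mono add_left_mono SUP_upper2[OF UNIV_I order_refl]) auto
        finally show ?thesis by (simp add: b_def)
      qed
      then show ?thesis
        unfolding hlmax_def[of u] SUP_mult_left_ennreal by (rule SUP_least)
    qed
    have "(\<integral>\<^sup>+x. ennpowr (ennreal (norm x powr \<alpha>) * hlmax u (x::'a)) p \<partial>lborel)
      \<le> (\<integral>\<^sup>+x. ennreal (c powr p) * (ennreal (2 powr p) * (ennreal (2 powr p) * (ennpowr (?A x) p + ennpowr (?B x) p) + ennpowr (hlmax h x) p)) \<partial>lborel)"
    proof (intro nn_integral_mono_AE, use AE_lborel_nonzero in eventually_elim)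
      case (elim x)
      have "ennpowr (ennreal (norm x powr \<alpha>) * hlmax u x) p \<le> ennpowr (ennreal c * ((?A x + ?B x) + hlmax h x)) p"
        using p by (intro ennpowr_mono pw elim) auto
      also have "\<dots> = ennreal (c powr p) * ennpowr ((?A x + ?B x) + hlmax h x) p"
        using c p by (simp add: ennpowr_mult ennpowr_ennreal)
      also have "\<dots> \<le> ennreal (c powr p) * (ennreal (2 powr p) * (ennpowr (?A x + ?B x) p + ennpowr (hlmax h x) p))"
        using p by (intro mult_left_mono ennpowr_add_le) auto
      also have "\<dots> \<le> ennreal (c powr p) * (ennreal (2 powr p) * (ennreal (2 powr p) * (ennpowr (?A x) p + ennpowr (?B x) p) + ennpowr (hlmax h x) p))"
        using p by (intro mult_left_mono add_right_mono ennpowr_add_le) auto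
      finally show ?case .
    qed
    also have "\<dots> = ennreal (c powr p) * (ennreal (2 powr p) * (ennreal (2 powr p) *
        ((\<integral>\<^sup>+x. ennpowr (?A x) p \<partial>lborel) + (\<integral>\<^sup>+x. ennpowr (?B x) p \<partial>lborel)) + (\<integral>\<^sup>+x. ennpowr (hlmax h x) p \<partial>lborel)))"
      by (simp add: nn_integral_cmult nn_integral_add)
    also have "\<dots> \<le> ennreal (c powr p) * (ennreal (2 powr p) * (ennreal (2 powr p) *
        (ennreal C1 * (\<integral>\<^sup>+y. ennpowr (h y) p \<partial>lborel) + ennreal C2 * (\<integral>\<^sup>+y. ennpowr (h y) p \<partial>lborel))
          + ennreal C3 * (\<integral>\<^sup>+y. ennpowr (h y) p \<partial>lborel)))"
      by (intro mult_left_mono add_mono C1 C2 C3) auto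
    also have "\<dots> = ennreal D * (\<integral>\<^sup>+y. ennpowr (h y) p \<partial>lborel)"
      using C1(1) C2(1) C3(1) c
      by (simp add: D_def ennreal_mult ennreal_plus distrib_left distrib_right mult.assoc)
    finally show ?thesis by (simp add: h_def)
  qed
  then show ?thesis using D by blast
qed

lemma measurable_hlmax_funpow [measurable]:
  fixes u :: "'a::euclidean_space \<Rightarrow> ennreal"
  assumes "u \<in> borel_measurable borel"
  shows "(hlmax ^^ n) u \<in> borel_measurable borel"
  by (induction n) (auto intro: measurable_hlmax assms)

lemma hlmax_funpow_weighted:
  assumes p: "1 < p" and \<alpha>: "- real DIM('a::euclidean_space) / p < \<alpha>" "\<alpha> < real DIM('a) - real DIM('a) / p"
  shows "\<exists>C>0. \<forall>u\<in>borel_measurable borel.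
    (\<integral>\<^sup>+x. ennpowr (ennreal (norm x powr \<alpha>) * (hlmax ^^ n) u (x::'a)) p \<partial>lborel)
      \<le> ennreal C * (\<integral>\<^sup>+x. ennpowr (ennreal (norm x powr \<alpha>) * u x) p \<partial>lborel)"
proof (induction n)
  case 0
  show ?case by (intro exI[of _ 1]) auto
next
  case (Suc n)
  obtain C1 where C1: "C1 > 0" "\<And>u. u \<in> borel_measurable borel \<Longrightarrow>
    (\<integral>\<^sup>+x. ennpowr (ennreal (norm x powr \<alpha>) * (hlmax ^^ n) u (x::'a)) p \<partial>lborel)
      \<le> ennreal C1 * (\<integral>\<^sup>+x. ennpowr (ennreal (norm x powr \<alpha>) * u x) p \<partial>lborel)"
    using Suc by blast
  obtain C2 where C2: "C2 > 0" "\<And>u. u \<in> borel_measurable borel \<Longrightarrow>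
    (\<integral>\<^sup>+x. ennpowr (ennreal (norm x powr \<alpha>) * hlmax u (x::'a)) p \<partial>lborel)
      \<le> ennreal C2 * (\<integral>\<^sup>+x. ennpowr (ennreal (norm x powr \<alpha>) * u x) p \<partial>lborel)"
    using hlmax_weighted[OF p \<alpha>] by blast
  have "(\<integral>\<^sup>+x. ennpowr (ennreal (norm x powr \<alpha>) * (hlmax ^^ Suc n) u (x::'a)) p \<partial>lborel)
      \<le> ennreal (C2 * C1) * (\<integral>\<^sup>+x. ennpowr (ennreal (norm x powr \<alpha>) * u x) p \<partial>lborel)"
    if u [measurable]: "u \<in> borel_measurable borel" for u
  proof -
    have "(\<integral>\<^sup>+x. ennpowr (ennreal (norm x powr \<alpha>) * (hlmax ^^ Suc n) u (x::'a)) p \<partial>lborel)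
      \<le> ennreal C2 * (\<integral>\<^sup>+x. ennpowr (ennreal (norm x powr \<alpha>) * (hlmax ^^ n) u x) p \<partial>lborel)"
      using C2(2)[of "(hlmax ^^ n) u"] by simp
    also have "\<dots> \<le> ennreal C2 * (ennreal C1 * (\<integral>\<^sup>+x. ennpowr (ennreal (norm x powr \<alpha>) * u x) p \<partial>lborel))"
      by (intro mult_left_mono C1 u) auto
    finally show ?thesis using C1 C2 by (simp add: ennreal_mult mult.assoc)
  qed
  moreover have "0 < C2 * C1" using C1 C2 by simp
  ultimately show ?case by blast
qed

section \<open>Fourier multipliers dominated by the maximal function\<close>

lemma norm_exp_pi [simp]: "norm (exp (2 * of_real pi * \<i> * of_real r)) = 1"
  by (simp add: norm_exp_eq_Re)

lemma lborel_Fubini_complex: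
  fixes f :: "'a::euclidean_space \<Rightarrow> 'b::euclidean_space \<Rightarrow> complex"
  assumes [measurable]: "case_prod f \<in> borel_measurable (borel \<Otimes>\<^sub>M borel)"
    and fin: "(\<integral>\<^sup>+x. (\<integral>\<^sup>+y. ennreal (norm (f x y)) \<partial>lborel) \<partial>lborel) < \<infinity>"
  shows "(\<integral>x. (\<integral>y. f x y \<partial>lborel) \<partial>lborel) = (\<integral>y. (\<integral>x. f x y \<partial>lborel) \<partial>lborel)"
proof -
  have m: "case_prod f \<in> borel_measurable (lborel \<Otimes>\<^sub>M lborel)"
    using assms(1) by (simp cong: measurable_cong_sets)
  have "(\<integral>\<^sup>+z. ennreal (norm (case_prod f z)) \<partial>(lborel \<Otimes>\<^sub>M lborel))
     = (\<integral>\<^sup>+x. (\<integral>\<^sup>+y. ennreal (norm (f x y)) \<partial>lborel) \<partial>lborel)"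
    using m by (subst lborel.nn_integral_fst[symmetric]) auto
  then have "integrable (lborel \<Otimes>\<^sub>M lborel) (case_prod f)"
    using m fin by (intro integrableI_bounded) auto
  then show ?thesis by (rule lborel_pair.Fubini_integral[symmetric])
qed

lemma nn_integral_lborel_reflect:
  fixes h :: "'a::euclidean_space \<Rightarrow> ennreal"
  assumes [measurable]: "h \<in> borel_measurable borel"
  shows "(\<integral>\<^sup>+z. h (x - z) \<partial>lborel) = (\<integral>\<^sup>+y. h y \<partial>lborel)"
  by (subst (2) lborel_affine[of "-1" x]) (simp_all add: nn_integral_density nn_integral_distr)

lemma norm_integral_le_nn_integral:
  fixes f :: "'a \<Rightarrow> 'b::{banach, second_countable_topology}"
  shows "ennreal (norm (integral\<^sup>L M f)) \<le> (\<integral>\<^sup>+x. ennreal (norm (f x)) \<partial>M)"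
  by (cases "integrable M f") (auto simp: integral_norm_bound_ennreal not_integrable_integral_eq)

lemma measurable_inv_fourier [measurable]:
  fixes G :: "'a::euclidean_space \<Rightarrow> complex"
  assumes [measurable]: "G \<in> borel_measurable borel"
  shows "inv_fourier G \<in> borel_measurable borel"
  unfolding inv_fourier_def by measurable

lemma integrable_exp_mult [simp]:
  fixes G :: "'a::euclidean_space \<Rightarrow> complex"
  assumes G: "integrable lborel G"
  shows "integrable lborel (\<lambda>\<xi>. exp (2 * of_real pi * \<i> * of_real (x \<bullet> \<xi>)) * G \<xi>)"
proof (rule Bochner_Integration.integrable_bound[OF G])
  have [measurable]: "G \<in> borel_measurable borel" using G by auto
  show "(\<lambda>\<xi>. exp (2 * of_real pi * \<i> * of_real (x \<bullet> \<xi>)) * G \<xi>) \<in> borel_measurable lborel"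
    by measurable
qed (simp add: norm_mult)

lemma integrable_bounded_mult:
  fixes G :: "'a::euclidean_space \<Rightarrow> complex" and m :: "'a \<Rightarrow> real"
  assumes G: "integrable lborel G" and [measurable]: "m \<in> borel_measurable borel" and b: "\<And>\<xi>. \<bar>m \<xi>\<bar> \<le> B"
  shows "integrable lborel (\<lambda>\<xi>. of_real (m \<xi>) * G \<xi>)"
proof (rule Bochner_Integration.integrable_bound)
  show "integrable lborel (\<lambda>\<xi>. of_real B * G \<xi>)" using G by simp
  have [measurable]: "G \<in> borel_measurable borel" using G by auto
  show "(\<lambda>\<xi>. of_real (m \<xi>) * G \<xi>) \<in> borel_measurable lborel" by measurable
  show "AE \<xi> in lborel. norm (of_real (m \<xi>) * G \<xi>) \<le> norm (of_real B * G \<xi>)"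
  proof (intro AE_I2)
    fix \<xi>
    have "\<bar>m \<xi>\<bar> \<le> \<bar>B\<bar>" using b[of \<xi>] by linarith
    then show "norm (of_real (m \<xi>) * G \<xi>) \<le> norm (of_real B * G \<xi>)"
      by (simp add: norm_mult mult_right_mono)
  qed
qed

text \<open>Identities between powers of the symbol may break at the origin, where
  \<open>powr\<close> takes its default value; this lemma discards that point.\<close>

lemma inv_fourier_cong_AE:
  fixes G :: "'a::euclidean_space \<Rightarrow> complex"
  assumes [measurable]: "G \<in> borel_measurable borel" "H \<in> borel_measurable borel"
    and ae: "AE \<xi> in lborel. G \<xi> = H \<xi>"
  shows "inv_fourier G x = inv_fourier H x"
  unfolding inv_fourier_def
  by (intro integral_cong_AE, measurable, use ae in eventually_elim) simp

subsection \<open>The Gaussian\<close>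

text \<open>Heat kernel in one variable, with time normalised so that, in the convention with 2 pi
  in the exponent, its Fourier transform is exp (- \<tau> \<eta>^2); hence the pi^2.\<close>

definition gauss1 :: "real \<Rightarrow> real \<Rightarrow> real" where
  "gauss1 \<tau> y = sqrt (pi / \<tau>) * exp (- (pi\<^sup>2 * y\<^sup>2 / \<tau>))"

definition gauss :: "real \<Rightarrow> 'a::euclidean_space \<Rightarrow> real" where
  "gauss \<tau> z = (\<Prod>b\<in>Basis. gauss1 \<tau> (z \<bullet> b))"

text \<open>A change of variables in the characteristic function of the standard normal
  distribution.\<close>

lemma gauss1_fourier:
  assumes \<tau>: "0 < \<tau>"
  shows "has_bochner_integral lborel (\<lambda>y. of_real (gauss1 \<tau> y) * exp (- (2 * of_real pi * \<i> * of_real (y * \<eta>))))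
     (complex_of_real (exp (- (\<tau> * \<eta>\<^sup>2))))"
proof -
  \<comment> \<open>Chosen so that (c y)^2 / 2 = pi^2 y^2 / \<tau>, the exponent in
    \<open>gauss1\<close>; the frequency t is then such that t * (c y) = - 2 pi y \<eta>.\<close>
  define c where "c = pi * sqrt (2 / \<tau>)"
  have c: "0 < c" using \<tau> by (simp add: c_def)
  have c2: "c\<^sup>2 = 2 * pi\<^sup>2 / \<tau>" using \<tau> by (simp add: c_def power_mult_distrib)
  define t where "t = - 2 * pi * \<eta> / c"
  define F where "F = (\<lambda>u. std_normal_density u *\<^sub>R exp (\<i> * complex_of_real (t * u)))"
  have Fm [measurable]: "F \<in> borel_measurable borel" unfolding F_def by measurable
  have intF: "integrable lborel F"
  proof (rule Bochner_Integration.integrable_bound)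
    show "integrable lborel std_normal_density"
      using integrable_std_normal_moment[of 0] by simp
    show "AE u in lborel. norm (F u) \<le> norm (std_normal_density u)"
      by (simp add: F_def)
  qed simp
  have "integral\<^sup>L lborel F = char std_normal_distribution t"
    unfolding F_def char_def by (subst integral_density) auto
  also have "\<dots> = complex_of_real (exp (- (t\<^sup>2) / 2))" by (simp add: char_std_normal_distribution)
  also have "t\<^sup>2 / 2 = \<tau> * \<eta>\<^sup>2"
  proof -
    have "t\<^sup>2 / 2 = 2 * pi\<^sup>2 * \<eta>\<^sup>2 / c\<^sup>2" by (simp add: t_def power_divide power_mult_distrib)
    also have "\<dots> = \<tau> * \<eta>\<^sup>2" using \<tau> by (simp add: c2)
    finally show ?thesis .
  qed
  then have "- (t\<^sup>2) / 2 = - (\<tau> * \<eta>\<^sup>2)" by simp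
  finally have I: "has_bochner_integral lborel F (complex_of_real (exp (- (\<tau> * \<eta>\<^sup>2))))"
    using intF by (simp add: has_bochner_integral_iff)
  then have "has_bochner_integral lborel (\<lambda>y. F (0 + c * y)) (complex_of_real (exp (- (\<tau> * \<eta>\<^sup>2))) /\<^sub>R \<bar>c\<bar>)"
    using c by (subst (asm) lborel_has_bochner_integral_real_affine_iff[where c = c and t = 0]) auto
  then have "has_bochner_integral lborel (\<lambda>y. c *\<^sub>R F (0 + c * y)) (c *\<^sub>R (complex_of_real (exp (- (\<tau> * \<eta>\<^sup>2))) /\<^sub>R \<bar>c\<bar>))"
    using c by (intro has_bochner_integral_scaleR_right) auto
  moreover have "c *\<^sub>R (complex_of_real (exp (- (\<tau> * \<eta>\<^sup>2))) /\<^sub>R \<bar>c\<bar>) = complex_of_real (exp (- (\<tau> * \<eta>\<^sup>2)))"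
    using c by simp
  moreover have "c *\<^sub>R F (0 + c * y) = of_real (gauss1 \<tau> y) * exp (- (2 * of_real pi * \<i> * of_real (y * \<eta>)))" for y
  proof -
    have "c * std_normal_density (c * y) = gauss1 \<tau> y"
    proof -
      have "c * (1 / sqrt (2 * pi)) = sqrt (pi / \<tau>)"
      proof -
        have "c * (1 / sqrt (2 * pi)) = pi * (sqrt 2 / sqrt \<tau>) / (sqrt 2 * sqrt pi)"
          by (simp add: c_def real_sqrt_divide real_sqrt_mult)
        also have "\<dots> = pi / sqrt pi / sqrt \<tau>" by simp
        also have "pi / sqrt pi = sqrt pi" by (simp add: real_div_sqrt)
        finally show ?thesis by (simp add: real_sqrt_divide)
      qed
      moreover have "- (c * y)\<^sup>2 / 2 = - (pi\<^sup>2 * y\<^sup>2 / \<tau>)" by (simp add: power_mult_distrib c2)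
      ultimately show ?thesis unfolding std_normal_density_def gauss1_def
        by (metis mult.assoc)
    qed
    moreover have "\<i> * complex_of_real (t * (c * y)) = - (2 * of_real pi * \<i> * of_real (y * \<eta>))"
      using c by (simp add: t_def)
    ultimately show ?thesis unfolding F_def
      by (simp add: scaleR_conv_of_real) (metis mult.assoc of_real_mult)
  qed
  ultimately show ?thesis by simp
qed

lemma gauss_eq: "gauss \<tau> (z::'a::euclidean_space) = sqrt (pi / \<tau>) ^ DIM('a) * exp (- (pi\<^sup>2 * (norm z)\<^sup>2 / \<tau>))"
proof -
  have "(norm z)\<^sup>2 = (\<Sum>b\<in>Basis. (z \<bullet> b)\<^sup>2)"
    by (simp only: power2_norm_eq_inner euclidean_inner[of z z]) (simp only: power2_eq_square)
  then have "- (pi\<^sup>2 * (norm z)\<^sup>2 / \<tau>) = (\<Sum>b\<in>Basis. - (pi\<^sup>2 * (z \<bullet> b)\<^sup>2 / \<tau>))"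
    by (simp add: sum_distrib_left sum_divide_distrib sum_negf)
  then show ?thesis
    unfolding gauss_def gauss1_def by (simp add: prod.distrib exp_sum)
qed

lemma gauss_nonneg [simp]: "0 \<le> \<tau> \<Longrightarrow> 0 \<le> gauss \<tau> z"
  by (simp add: gauss_eq)

lemma measurable_gauss [measurable]: "gauss \<tau> \<in> borel_measurable borel"
  unfolding gauss_eq[abs_def] by measurable

text \<open>Lebesgue measure is the image of a product measure under coordinates, and both the
  Gaussian and the exponential factor, so the transform is a product of one-dimensional
  ones.\<close>

lemma gauss_fourier:
  assumes \<tau>: "0 < \<tau>"
  shows "has_bochner_integral lborel (\<lambda>z::'a::euclidean_space. of_real (gauss \<tau> z) * exp (- (2 * of_real pi * \<i> * of_real (z \<bullet> \<xi>))))
     (complex_of_real (exp (- (\<tau> * (norm \<xi>)\<^sup>2))))"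
proof -
  interpret product_sigma_finite "\<lambda>_::'a. lborel :: real measure"
    by standard
  define f where "f = (\<lambda>(b::'a) y. of_real (gauss1 \<tau> y) * exp (- (2 * of_real pi * \<i> * complex_of_real (y * (\<xi> \<bullet> b)))))"
  define F where "F = (\<lambda>z::'a. of_real (gauss \<tau> z) * exp (- (2 * of_real pi * \<i> * complex_of_real (z \<bullet> \<xi>))))"
  have Fm [measurable]: "F \<in> borel_measurable borel" unfolding F_def by measurable
  have f1: "integrable lborel (f b)" "integral\<^sup>L lborel (f b) = of_real (exp (- (\<tau> * (\<xi> \<bullet> b)\<^sup>2)))" for b
    using gauss1_fourier[OF \<tau>, of "\<xi> \<bullet> b"] by (auto simp: f_def has_bochner_integral_iff)
  have Ff: "F z = (\<Prod>b\<in>Basis. f b (z \<bullet> b))" for z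
  proof -
    have "z \<bullet> \<xi> = (\<Sum>b\<in>Basis. (z \<bullet> b) * (\<xi> \<bullet> b))" by (rule euclidean_inner)
    then have "- (2 * of_real pi * \<i> * complex_of_real (z \<bullet> \<xi>)) = (\<Sum>b\<in>Basis. - (2 * of_real pi * \<i> * complex_of_real ((z \<bullet> b) * (\<xi> \<bullet> b))))"
      by (simp add: sum_distrib_left sum_negf)
    then show ?thesis
      unfolding F_def f_def gauss_def by (simp only: exp_sum[OF finite_Basis] of_real_prod prod.distrib)
  qed
  let ?T = "\<lambda>g::'a \<Rightarrow> real. \<Sum>b\<in>Basis. g b *\<^sub>R b"
  have FT: "F (?T g) = (\<Prod>b\<in>Basis. f b (g b))" for g
    unfolding Ff by (intro prod.cong refl) (simp add: inner_sum_left_Basis)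
  have T: "?T \<in> measurable (\<Pi>\<^sub>M b\<in>Basis. lborel) borel" by measurable
  have "integrable (\<Pi>\<^sub>M b\<in>Basis. lborel) (\<lambda>g. \<Prod>b\<in>Basis. f b (g b))"
    by (intro product_integrable_prod f1) auto
  then have "integrable lborel F"
    by (subst lborel_eq, subst integrable_distr_eq[OF T Fm]) (simp add: FT)
  moreover have "integral\<^sup>L lborel F = of_real (exp (- (\<tau> * (norm \<xi>)\<^sup>2)))"
  proof -
    have "integral\<^sup>L lborel F = (\<integral>g. (\<Prod>b\<in>Basis. f b (g b)) \<partial>(\<Pi>\<^sub>M b\<in>Basis. lborel))"
      by (subst lborel_eq, subst integral_distr[OF T Fm]) (simp add: FT)
    also have "\<dots> = (\<Prod>b\<in>Basis. of_real (exp (- (\<tau> * (\<xi> \<bullet> b)\<^sup>2))))"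
      by (subst product_integral_prod) (auto simp: f1)
    also have "\<dots> = of_real (exp (\<Sum>b\<in>Basis. - (\<tau> * (\<xi> \<bullet> b)\<^sup>2)))"
      by (simp add: exp_sum)
    also have "(\<Sum>b\<in>Basis. - (\<tau> * (\<xi> \<bullet> b)\<^sup>2)) = - (\<tau> * (norm \<xi>)\<^sup>2)"
      by (simp only: power2_norm_eq_inner euclidean_inner[of \<xi> \<xi>])
         (simp only: power2_eq_square sum_distrib_left sum_negf)
    finally show ?thesis .
  qed
  ultimately show ?thesis by (simp add: has_bochner_integral_iff F_def)
qed

lemma integrable_gauss: "0 < \<tau> \<Longrightarrow> integrable lborel (gauss \<tau> :: 'a::euclidean_space \<Rightarrow> real)"
proof -
  assume "0 < \<tau>"
  then have "integrable lborel (\<lambda>z::'a. complex_of_real (gauss \<tau> z))"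
    using gauss_fourier[of \<tau> "0::'a"] by (auto simp: has_bochner_integral_iff)
  then show ?thesis using integrable_Re by fastforce
qed

lemma integral_gauss: "0 < \<tau> \<Longrightarrow> (\<integral>z. gauss \<tau> (z::'a::euclidean_space) \<partial>lborel) = 1"
proof -
  assume "0 < \<tau>"
  then have "(\<integral>z. complex_of_real (gauss \<tau> (z::'a)) \<partial>lborel) = 1"
    using gauss_fourier[of \<tau> "0::'a"] by (auto simp: has_bochner_integral_iff)
  then show ?thesis by (metis integral_complex_of_real of_real_eq_1_iff)
qed

text \<open>Fubini, with the Gaussian written as the transform of its kernel. An arbitrary
  integrable G is allowed, so that the formula applies again after multiplication by further
  symbols.\<close>

lemma gauss_convolution:
  fixes G :: "'a::euclidean_space \<Rightarrow> complex"
  assumes \<tau>: "0 < \<tau>" and G: "integrable lborel G"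
  shows "inv_fourier (\<lambda>\<xi>. of_real (exp (- (\<tau> * (norm \<xi>)\<^sup>2))) * G \<xi>) x
     = (\<integral>z. of_real (gauss \<tau> z) * inv_fourier G (x - z) \<partial>lborel)"
proof -
  have [measurable]: "G \<in> borel_measurable borel" using G by auto
  let ?e = "\<lambda>z \<xi>. exp (2 * of_real pi * \<i> * complex_of_real ((x - z) \<bullet> \<xi>))"
  have e: "exp (2 * of_real pi * \<i> * of_real (x \<bullet> \<xi>)) * exp (- (2 * of_real pi * \<i> * of_real (z \<bullet> \<xi>))) = ?e z \<xi>" for z \<xi>
    by (simp add: mult_exp_exp inner_diff_left algebra_simps)
  have "inv_fourier (\<lambda>\<xi>. of_real (exp (- (\<tau> * (norm \<xi>)\<^sup>2))) * G \<xi>) x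
    = (\<integral>\<xi>. (\<integral>z. of_real (gauss \<tau> z) * (?e z \<xi> * G \<xi>) \<partial>lborel) \<partial>lborel)"
    unfolding inv_fourier_def
  proof (rule Bochner_Integration.integral_cong[OF refl])
    fix \<xi> :: 'a
    have "complex_of_real (exp (- (\<tau> * (norm \<xi>)\<^sup>2))) = (\<integral>z. of_real (gauss \<tau> z) * exp (- (2 * of_real pi * \<i> * of_real (z \<bullet> \<xi>))) \<partial>lborel)"
      using gauss_fourier[OF \<tau>, of \<xi>] by (simp add: has_bochner_integral_iff)
    then have "exp (2 * of_real pi * \<i> * of_real (x \<bullet> \<xi>)) * (of_real (exp (- (\<tau> * (norm \<xi>)\<^sup>2))) * G \<xi>)
       = (\<integral>z. of_real (gauss \<tau> z) * exp (- (2 * of_real pi * \<i> * of_real (z \<bullet> \<xi>))) \<partial>lborel) * (exp (2 * of_real pi * \<i> * of_real (x \<bullet> \<xi>)) * G \<xi>)"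
      by (simp only: mult.left_commute)
    also have "\<dots> = (\<integral>z. of_real (gauss \<tau> z) * exp (- (2 * of_real pi * \<i> * of_real (z \<bullet> \<xi>))) * (exp (2 * of_real pi * \<i> * of_real (x \<bullet> \<xi>)) * G \<xi>) \<partial>lborel)"
      using gauss_fourier[OF \<tau>, of \<xi>] by (intro integral_mult_left_zero[symmetric])
    also have "\<dots> = (\<integral>z. of_real (gauss \<tau> z) * (?e z \<xi> * G \<xi>) \<partial>lborel)"
      unfolding e[symmetric] by (simp only: mult_ac)
    finally show "exp (2 * of_real pi * \<i> * of_real (x \<bullet> \<xi>)) * (of_real (exp (- (\<tau> * (norm \<xi>)\<^sup>2))) * G \<xi>) = \<dots>" .
  qed
  also have "\<dots> = (\<integral>z. (\<integral>\<xi>. of_real (gauss \<tau> z) * (?e z \<xi> * G \<xi>) \<partial>lborel) \<partial>lborel)"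
  proof (rule lborel_Fubini_complex)
    have "(\<integral>\<^sup>+\<xi>. (\<integral>\<^sup>+z. ennreal (norm (of_real (gauss \<tau> z) * (?e z \<xi> * G \<xi>))) \<partial>lborel) \<partial>lborel)
        = (\<integral>\<^sup>+\<xi>. (\<integral>\<^sup>+z. ennreal (gauss \<tau> (z::'a)) * ennreal (norm (G \<xi>)) \<partial>lborel) \<partial>lborel)"
      using \<tau> by (intro nn_integral_cong) (simp add: norm_mult ennreal_mult)
    also have "\<dots> = (\<integral>\<^sup>+z. ennreal (gauss \<tau> (z::'a)) \<partial>lborel) * (\<integral>\<^sup>+\<xi>. ennreal (norm (G \<xi>)) \<partial>lborel)"
      by (simp add: nn_integral_multc nn_integral_cmult)
    also have "\<dots> < \<infinity>"
      using G integrable_gauss[OF \<tau>, where 'a='a] \<tau>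
      by (auto simp: integrable_iff_bounded ennreal_mult_less_top)
    finally show "(\<integral>\<^sup>+\<xi>. (\<integral>\<^sup>+z. ennreal (norm (of_real (gauss \<tau> z) * (?e z \<xi> * G \<xi>))) \<partial>lborel) \<partial>lborel) < \<infinity>" .
  qed measurable
  also have "\<dots> = (\<integral>z. of_real (gauss \<tau> z) * inv_fourier G (x - z) \<partial>lborel)"
    unfolding inv_fourier_def by (intro Bochner_Integration.integral_cong refl integral_mult_right_zero)
  finally show ?thesis .
qed

definition symbol :: "real \<Rightarrow> 'a::euclidean_space \<Rightarrow> real" where
  "symbol \<kappa> \<xi> = \<kappa> + (norm \<xi>)\<^sup>2"

lemma symbol_nonneg [simp]: "0 \<le> \<kappa> \<Longrightarrow> 0 \<le> symbol \<kappa> \<xi>"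
  by (simp add: symbol_def)

lemma symbol_pos: "0 \<le> \<kappa> \<Longrightarrow> \<xi> \<noteq> 0 \<Longrightarrow> 0 < symbol \<kappa> \<xi>"
  by (simp add: symbol_def add_nonneg_pos)

lemma measurable_symbol [measurable]: "symbol \<kappa> \<in> borel_measurable borel"
  unfolding symbol_def[abs_def] by measurable

definition abs_inv_fourier :: "('a::euclidean_space \<Rightarrow> complex) \<Rightarrow> 'a \<Rightarrow> ennreal" where
  "abs_inv_fourier G = (\<lambda>y. ennreal (norm (inv_fourier G y)))"

lemma measurable_abs_inv_fourier [measurable]:
  fixes G :: "'a::euclidean_space \<Rightarrow> complex"
  assumes [measurable]: "G \<in> borel_measurable borel"
  shows "abs_inv_fourier G \<in> borel_measurable borel"
  unfolding abs_inv_fourier_def by measurable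

text \<open>The factor exp (- \<tau> * \<kappa>) \<le> 1 is dropped, which makes the later kernel
  bounds uniform in \<kappa>.\<close>

lemma heat_le_convolution:
  fixes G :: "'a::euclidean_space \<Rightarrow> complex"
  assumes \<tau>: "0 < \<tau>" and \<kappa>: "0 \<le> \<kappa>" and G: "integrable lborel G"
  shows "abs_inv_fourier (\<lambda>\<xi>. of_real (exp (- (\<tau> * symbol \<kappa> \<xi>))) * G \<xi>) x \<le> (\<integral>\<^sup>+y. ennreal (gauss \<tau> (x - y)) * abs_inv_fourier G y \<partial>lborel)"
proof -
  have [measurable]: "G \<in> borel_measurable borel" using G by auto
  have "inv_fourier (\<lambda>\<xi>. of_real (exp (- (\<tau> * symbol \<kappa> \<xi>))) * G \<xi>) x
      = of_real (exp (- (\<tau> * \<kappa>))) * inv_fourier (\<lambda>\<xi>. of_real (exp (- (\<tau> * (norm \<xi>)\<^sup>2))) * G \<xi>) x"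
    unfolding inv_fourier_def symbol_def
    by (subst integral_mult_right_zero[symmetric])
       (intro Bochner_Integration.integral_cong refl, simp add: distrib_left exp_add[symmetric] mult_ac flip: of_real_mult)
  then have "abs_inv_fourier (\<lambda>\<xi>. of_real (exp (- (\<tau> * symbol \<kappa> \<xi>))) * G \<xi>) x
     = ennreal (exp (- (\<tau> * \<kappa>)) * norm (inv_fourier (\<lambda>\<xi>. of_real (exp (- (\<tau> * (norm \<xi>)\<^sup>2))) * G \<xi>) x))"
    by (simp add: abs_inv_fourier_def norm_mult)
  also have "\<dots> \<le> ennreal (1 * norm (inv_fourier (\<lambda>\<xi>. of_real (exp (- (\<tau> * (norm \<xi>)\<^sup>2))) * G \<xi>) x))"
    using \<tau> \<kappa> by (intro ennreal_leI mult_right_mono) auto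
  also have "\<dots> = ennreal (norm (\<integral>z. of_real (gauss \<tau> z) * inv_fourier G (x - z) \<partial>lborel))"
    by (simp add: gauss_convolution[OF \<tau> G])
  also have "\<dots> \<le> (\<integral>\<^sup>+z. ennreal (norm (of_real (gauss \<tau> z) * inv_fourier G (x - z))) \<partial>lborel)"
    by (rule norm_integral_le_nn_integral)
  also have "\<dots> = (\<integral>\<^sup>+z. ennreal (gauss \<tau> (x - (x - z))) * abs_inv_fourier G (x - z) \<partial>lborel)"
    using \<tau> by (intro nn_integral_cong) (simp add: norm_mult ennreal_mult abs_inv_fourier_def)
  also have "\<dots> = (\<integral>\<^sup>+y. ennreal (gauss \<tau> (x - y)) * abs_inv_fourier G y \<partial>lborel)"
    by (rule nn_integral_lborel_reflect) measurable
  finally show ?thesis .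
qed

lemma power_exp_bound:
  fixes u :: real
  assumes "0 \<le> u"
  shows "u ^ n * exp (- u) \<le> fact n"
proof -
  have "u ^ n / fact n \<le> exp u"
  proof -
    have "u ^ n /\<^sub>R fact n \<le> (\<Sum>k. u ^ k /\<^sub>R fact k)"
      using summable_exp_generic[of u] assms sum_le_suminf[of "\<lambda>k. u ^ k /\<^sub>R fact k" "{n}"] by simp
    then show ?thesis by (simp add: exp_def field_simps)
  qed
  then show ?thesis by (simp add: exp_minus field_simps)
qed

text \<open>Replaces the Gaussian by a kernel of Poisson type. Its tail of order |z|^(-d-1) is still
  integrable and is an elementary integral over radii, so that the superposition of balls can be
  written down.\<close>

lemma gauss_le:
  assumes \<tau>: "0 < \<tau>"
  shows "gauss \<tau> (z::'a::euclidean_space)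
    \<le> sqrt pi ^ DIM('a) * (1 + fact (DIM('a) + 1)) * (sqrt \<tau> * max (norm z) (sqrt \<tau>) powr (- real DIM('a) - 1))"
proof -
  define n where "n = DIM('a) + 1"
  define s where "s = sqrt \<tau>"
  have s: "0 < s" "s\<^sup>2 = \<tau>" using \<tau> by (simp_all add: s_def)
  define r where "r = norm z"
  have r: "0 \<le> r" by (simp add: r_def)
  have F: "(0::real) \<le> fact n" by simp
  define e where "e = exp (- (pi\<^sup>2 * r\<^sup>2 / \<tau>))"
  have key: "(max r s / s) ^ n * e \<le> 1 + fact n"
  proof (cases "r \<le> s")
    case True
    then have "(max r s / s) ^ n * e = e" using s by (simp add: max_def)
    also have "e \<le> 1" using \<tau> by (simp add: e_def)
    finally show ?thesis using F by linarith
  next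
    case False
    define v where "v = pi\<^sup>2 * r\<^sup>2 / \<tau>"
    have v0: "0 \<le> v" using \<tau> by (simp add: v_def)
    have "1 \<le> r / s" using False s by simp
    \<comment> \<open>Since r / s \<ge> 1 it is at most its square, which is at most v because pi^2
      \<ge> 1.\<close>
    have "r / s \<le> v"
    proof -
      have "r / s * 1 \<le> (r / s) * (r / s)" using \<open>1 \<le> r / s\<close> by (intro mult_left_mono) auto
      also have "\<dots> = 1 * (r\<^sup>2 / \<tau>)" using s by (simp add: power2_eq_square s(2)[symmetric])
      also have "\<dots> \<le> pi\<^sup>2 * (r\<^sup>2 / \<tau>)"
        using \<tau> pi_ge_two by (intro mult_right_mono) (auto intro: one_le_power)
      finally show ?thesis by (simp add: v_def)
    qed
    have "(max r s / s) ^ n * e = (r / s) ^ n * exp (- v)" using False by (simp add: e_def v_def max_def)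
    also have "\<dots> \<le> v ^ n * exp (- v)" using \<open>r / s \<le> v\<close> \<open>1 \<le> r / s\<close> by (intro mult_right_mono power_mono) auto
    also have "\<dots> \<le> fact n" by (rule power_exp_bound[OF v0])
    finally show ?thesis by simp
  qed
  have m: "0 < max r s" using s by simp
  have "gauss \<tau> z = sqrt pi ^ DIM('a) * ((1 / s) ^ DIM('a) * e)"
    by (simp add: gauss_eq e_def r_def s_def real_sqrt_divide power_divide)
  also have "(1 / s) ^ DIM('a) * e = ((max r s / s) ^ n * e) * (s * (1 / max r s ^ n))"
    using s m by (simp add: n_def power_divide field_simps)
  also have "\<dots> \<le> (1 + fact n) * (s * (1 / max r s ^ n))"
    using key s m by (intro mult_right_mono) auto
  also have "1 / max r s ^ n = max r s powr (- real DIM('a) - 1)"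
    using m by (simp add: n_def powr_realpow[symmetric] powr_minus[symmetric] inverse_eq_divide[symmetric] del: power_Suc)
       (simp add: powr_realpow[symmetric] powr_minus powr_diff powr_add field_simps)
  finally show ?thesis
    by (simp add: n_def r_def s_def mult.assoc mult_left_mono)
qed

lemma heat_le_hlmax:
  "\<exists>C>0. \<forall>\<tau>>0. \<forall>\<kappa>\<ge>0. \<forall>G::'a::euclidean_space \<Rightarrow> complex. integrable lborel G \<longrightarrow>
    (\<forall>x. abs_inv_fourier (\<lambda>\<xi>. of_real (exp (- (\<tau> * symbol \<kappa> \<xi>))) * G \<xi>) x \<le> ennreal C * hlmax (abs_inv_fourier G) x)"
proof -
  let ?d = "real DIM('a)"
  define K where "K = sqrt pi ^ DIM('a) * (1 + fact (DIM('a) + 1)) * (?d + 1)"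
  have K: "0 < K" by (simp add: K_def add_pos_pos)
  define C where "C = K * 2 ^ DIM('a)"
  have "abs_inv_fourier (\<lambda>\<xi>. of_real (exp (- (\<tau> * symbol \<kappa> \<xi>))) * G \<xi>) x \<le> ennreal C * hlmax (abs_inv_fourier G) x"
    if \<tau>: "0 < \<tau>" and \<kappa>: "0 \<le> \<kappa>" and G: "integrable lborel G" for \<tau> \<kappa> and G :: "'a \<Rightarrow> complex" and x
  proof -
    have [measurable]: "G \<in> borel_measurable borel" using G by auto
    define s where "s = sqrt \<tau>"
    have s: "0 < s" using \<tau> by (simp add: s_def)
    define w where "w = (\<lambda>\<rho>. ennreal (K * s) * (indicator {s..} \<rho> * ennreal (\<rho> powr (- ?d - 2))))"
    have [measurable]: "w \<in> borel_measurable borel" unfolding w_def by measurable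
    have "abs_inv_fourier (\<lambda>\<xi>. of_real (exp (- (\<tau> * symbol \<kappa> \<xi>))) * G \<xi>) x \<le> (\<integral>\<^sup>+y. ennreal (gauss \<tau> (x - y)) * abs_inv_fourier G y \<partial>lborel)"
      by (rule heat_le_convolution[OF \<tau> \<kappa> G])
    also have "\<dots> \<le> (\<integral>\<^sup>+\<rho>. indicator {0<..} \<rho> * w \<rho> * ennreal (\<rho> ^ DIM('a)) \<partial>lborel) * (ennreal (2 ^ DIM('a)) * hlmax (abs_inv_fourier G) x)"
    proof (rule radial_kernel_le_hlmax)
      fix y
      define m where "m = max (dist x y) s"
      have m: "0 < m" using s by (simp add: m_def)
      have "gauss \<tau> (x - y) \<le> K * s * (m powr (- ?d - 1) / (?d + 1))"
        using gauss_le[OF \<tau>, of "x - y"] by (simp add: K_def m_def s_def dist_norm mult_ac)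
      then have "ennreal (gauss \<tau> (x - y)) \<le> ennreal (K * s * (m powr (- ?d - 1) / (?d + 1)))"
        by (rule ennreal_leI)
      also have "\<dots> = ennreal (K * s) * ennreal (m powr (- (?d + 1)) / (?d + 1))"
        using K s by (subst ennreal_mult[symmetric]) (auto simp: minus_add_distrib)
      \<comment> \<open>The integral of \<rho> powr (- d - 2) from m to infinity is m powr (- d - 1)
        / (d + 1); K contains d + 1 for this. The factor s in front will cancel the moment integral
        over {s..}, so that the final constant does not depend on \<tau>.\<close>
      also have "\<dots> = ennreal (K * s) * (\<integral>\<^sup>+\<rho>. indicator {m..} \<rho> * ennreal (\<rho> powr (- (?d + 1) - 1)) \<partial>lborel)"
        using m by (subst nn_integral_powr_to_inf) auto
      also have "\<dots> = (\<integral>\<^sup>+\<rho>. ennreal (K * s) * (indicator {m..} \<rho> * ennreal (\<rho> powr (- (?d + 1) - 1))) \<partial>lborel)"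
        by (subst nn_integral_cmult) auto
      also have "\<dots> \<le> (\<integral>\<^sup>+\<rho>. indicator (ball x \<rho>) y * w \<rho> \<partial>lborel)"
      proof (intro nn_integral_mono_AE, use AE_lborel_singleton[of m] in eventually_elim)
        case (elim \<rho>)
        have "- (?d + 1) - 1 = - ?d - 2" by simp
        then show ?case unfolding w_def \<open>- (?d + 1) - 1 = - ?d - 2\<close> using elim
          by (cases "m \<le> \<rho>") (auto simp: indicator_def m_def max_def split: if_splits)
      qed
      finally show "ennreal (gauss \<tau> (x - y)) \<le> (\<integral>\<^sup>+\<rho>. indicator (ball x \<rho>) y * w \<rho> \<partial>lborel)" .
    qed measurable
    also have "(\<integral>\<^sup>+\<rho>. indicator {0<..} \<rho> * w \<rho> * ennreal (\<rho> ^ DIM('a)) \<partial>lborel)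
       = (\<integral>\<^sup>+\<rho>. ennreal (K * s) * (indicator {s..} \<rho> * ennreal (\<rho> powr (- 1 - 1))) \<partial>lborel)"
    proof (rule nn_integral_cong)
      fix \<rho> :: real
      have "ennreal (\<rho> powr (- ?d - 2)) * ennreal (\<rho> ^ DIM('a)) = ennreal (\<rho> powr (- 1 - 1))" if "0 < \<rho>"
        using that unfolding power_eq_powr[OF that] by (subst ennreal_mult[symmetric]) (auto simp: powr_add[symmetric])
      then show "indicator {0<..} \<rho> * w \<rho> * ennreal (\<rho> ^ DIM('a)) = ennreal (K * s) * (indicator {s..} \<rho> * ennreal (\<rho> powr (- 1 - 1)))"
        using s by (simp add: w_def indicator_def mult.assoc)
    qed
    also have "\<dots> = ennreal (K * s) * ennreal (s powr (- 1) / 1)"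
      using s nn_integral_powr_to_inf[of 1 s] by (subst nn_integral_cmult) auto
    also have "\<dots> = ennreal K"
      using s K by (subst ennreal_mult[symmetric]) (auto simp: powr_minus field_simps)
    also have "ennreal K * (ennreal (2 ^ DIM('a)) * hlmax (abs_inv_fourier G) x) = ennreal C * hlmax (abs_inv_fourier G) x"
      using K by (simp add: C_def ennreal_mult mult.assoc)
    finally show ?thesis .
  qed
  moreover have "0 < C" using K by (simp add: C_def)
  ultimately show ?thesis by blast
qed

text \<open>Stands in for Lebesgue differentiation, at every point: the inverse transform of an
  integrable G is the limit of its heat means at times 1 / (n + 1), and these obey one common bound.
  It lets the identity enter the estimate of 1 - R(\<tau>).\<close>

lemma abs_inv_fourier_le_hlmax:
  "\<exists>C>0. \<forall>G::'a::euclidean_space \<Rightarrow> complex. integrable lborel G \<longrightarrow> (\<forall>x. abs_inv_fourier G x \<le> ennreal C * hlmax (abs_inv_fourier G) x)"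
proof -
  obtain C where C0: "C > 0 \<and> (\<forall>\<tau>>0. \<forall>\<kappa>\<ge>0. \<forall>G::'a \<Rightarrow> complex. integrable lborel G \<longrightarrow>
    (\<forall>x. abs_inv_fourier (\<lambda>\<xi>. of_real (exp (- (\<tau> * symbol \<kappa> \<xi>))) * G \<xi>) x \<le> ennreal C * hlmax (abs_inv_fourier G) x))"
    using heat_le_hlmax[where 'a='a] by (rule exE)
  note C = conjunct1[OF C0] conjunct2[OF C0, rule_format]
  have "abs_inv_fourier G x \<le> ennreal C * hlmax (abs_inv_fourier G) x" if G: "integrable lborel G" for G :: "'a \<Rightarrow> complex" and x
  proof -
    have [measurable]: "G \<in> borel_measurable borel" using G by auto
    let ?H = "\<lambda>n::nat. \<lambda>\<xi>. complex_of_real (exp (- (1 / real (Suc n) * symbol 0 \<xi>))) * G \<xi>"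
    have "(\<lambda>n. inv_fourier (?H n) x) \<longlonglongrightarrow> inv_fourier G x"
      unfolding inv_fourier_def
    proof (rule integral_dominated_convergence[where w = "\<lambda>\<xi>. norm (G \<xi>)"])
      show "integrable lborel (\<lambda>\<xi>. norm (G \<xi>))" using G by simp
      show "AE \<xi> in lborel. (\<lambda>n. exp (2 * of_real pi * \<i> * of_real (x \<bullet> \<xi>)) * ?H n \<xi>)
        \<longlonglongrightarrow> exp (2 * of_real pi * \<i> * of_real (x \<bullet> \<xi>)) * G \<xi>"
      proof (intro AE_I2)
        fix \<xi> :: 'a
        have "(\<lambda>n. exp (- (1 / real (Suc n) * symbol 0 \<xi>))) \<longlonglongrightarrow> exp (- (0 * symbol 0 \<xi>))"
          by (intro tendsto_intros LIMSEQ_Suc[OF lim_1_over_n])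
        then have "(\<lambda>n. complex_of_real (exp (- (1 / real (Suc n) * symbol 0 \<xi>)))) \<longlonglongrightarrow> complex_of_real 1"
          by (intro tendsto_of_real) simp
        from tendsto_mult[OF tendsto_const tendsto_mult[OF this tendsto_const]]
        show "(\<lambda>n. exp (2 * of_real pi * \<i> * of_real (x \<bullet> \<xi>)) * ?H n \<xi>)
          \<longlonglongrightarrow> exp (2 * of_real pi * \<i> * of_real (x \<bullet> \<xi>)) * G \<xi>" by simp
      qed
      show "AE \<xi> in lborel. norm (exp (2 * of_real pi * \<i> * of_real (x \<bullet> \<xi>)) * ?H n \<xi>) \<le> norm (G \<xi>)" for n
        by (intro AE_I2) (simp add: norm_mult mult_left_le_one_le)
    qed measurable
    then have lim: "(\<lambda>n. abs_inv_fourier (?H n) x) \<longlonglongrightarrow> abs_inv_fourier G x"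
      unfolding abs_inv_fourier_def by (intro tendsto_ennrealI tendsto_norm)
    show ?thesis
      by (rule Lim_bounded[OF lim, of 0]) (intro allI impI C(2)[of _ 0] G, auto)
  qed
  then show ?thesis using C(1) by blast
qed

text \<open>Triangle inequality for a multiplier that is a superposition of nonnegative ones.
  Nonnegativity reduces the Fubini condition to the integrability of M G. The formula for M is
  required only off the origin, where the symbol is positive even for \<kappa> = 0.\<close>

lemma inv_fourier_superpose:
  fixes G :: "'a::euclidean_space \<Rightarrow> complex" and m :: "real \<Rightarrow> 'a \<Rightarrow> real"
  assumes [measurable]: "case_prod m \<in> borel_measurable (borel \<Otimes>\<^sub>M borel)" "M \<in> borel_measurable borel"
      "G \<in> borel_measurable borel"
    and m0: "\<And>v \<xi>. 0 \<le> m v \<xi>" and M0: "\<And>\<xi>. 0 \<le> M \<xi>"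
    and mM: "\<And>\<xi>. \<xi> \<noteq> 0 \<Longrightarrow> (\<integral>\<^sup>+v. ennreal (m v \<xi>) \<partial>lborel) = ennreal (M \<xi>)"
    and int: "integrable lborel (\<lambda>\<xi>. of_real (M \<xi>) * G \<xi>)"
  shows "abs_inv_fourier (\<lambda>\<xi>. of_real (M \<xi>) * G \<xi>) x \<le> (\<integral>\<^sup>+v. abs_inv_fourier (\<lambda>\<xi>. of_real (m v \<xi>) * G \<xi>) x \<partial>lborel)"
proof -
  let ?e = "\<lambda>\<xi>. exp (2 * of_real pi * \<i> * of_real (x \<bullet> \<xi>))"
  have M: "complex_of_real (M \<xi>) = (\<integral>v. of_real (m v \<xi>) \<partial>lborel)" if "\<xi> \<noteq> 0" for \<xi>
  proof -
    have "(\<integral>v. m v \<xi> \<partial>lborel) = M \<xi>"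
      using mM[OF that] m0 M0 by (subst integral_eq_nn_integral) auto
    then show ?thesis by simp
  qed
  have "inv_fourier (\<lambda>\<xi>. of_real (M \<xi>) * G \<xi>) x = (\<integral>\<xi>. (\<integral>v. ?e \<xi> * (of_real (m v \<xi>) * G \<xi>) \<partial>lborel) \<partial>lborel)"
    unfolding inv_fourier_def
  proof (rule integral_cong_AE)
    show "AE \<xi> in lborel. ?e \<xi> * (of_real (M \<xi>) * G \<xi>) = (\<integral>v. ?e \<xi> * (of_real (m v \<xi>) * G \<xi>) \<partial>lborel)"
      using AE_lborel_nonzero
    proof eventually_elim
      case (elim \<xi>)
      have "(\<integral>v. ?e \<xi> * (of_real (m v \<xi>) * G \<xi>) \<partial>lborel) = (\<integral>v. of_real (m v \<xi>) * (?e \<xi> * G \<xi>) \<partial>lborel)"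
        by (simp only: mult.left_commute)
      also have "\<dots> = of_real (M \<xi>) * (?e \<xi> * G \<xi>)"
        unfolding M[OF elim] by (rule integral_mult_left_zero)
      finally show ?case by (simp only: mult.left_commute)
    qed
  qed measurable
  also have "\<dots> = (\<integral>v. (\<integral>\<xi>. ?e \<xi> * (of_real (m v \<xi>) * G \<xi>) \<partial>lborel) \<partial>lborel)"
  proof (rule lborel_Fubini_complex)
    have "(\<integral>\<^sup>+\<xi>. (\<integral>\<^sup>+v. ennreal (norm (?e \<xi> * (of_real (m v \<xi>) * G \<xi>))) \<partial>lborel) \<partial>lborel)
       = (\<integral>\<^sup>+\<xi>. ennreal (norm (of_real (M \<xi>) * G \<xi>)) \<partial>lborel)"
    proof (intro nn_integral_cong_AE, use AE_lborel_nonzero in eventually_elim)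
      case (elim \<xi>)
      have "(\<integral>\<^sup>+v. ennreal (norm (?e \<xi> * (of_real (m v \<xi>) * G \<xi>))) \<partial>lborel)
         = (\<integral>\<^sup>+v. ennreal (m v \<xi>) * ennreal (norm (G \<xi>)) \<partial>lborel)"
        using m0 by (intro nn_integral_cong) (simp add: norm_mult ennreal_mult)
      also have "\<dots> = ennreal (M \<xi>) * ennreal (norm (G \<xi>))"
        by (subst nn_integral_multc) (auto simp: mM[OF elim])
      finally show ?case using M0[of \<xi>] by (simp add: norm_mult ennreal_mult)
    qed
    also have "\<dots> < \<infinity>" using int by (simp add: integrable_iff_bounded)
    finally show "(\<integral>\<^sup>+\<xi>. (\<integral>\<^sup>+v. ennreal (norm (?e \<xi> * (of_real (m v \<xi>) * G \<xi>))) \<partial>lborel) \<partial>lborel) < \<infinity>" .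
  qed measurable
  also have "ennreal (norm \<dots>) \<le> (\<integral>\<^sup>+v. abs_inv_fourier (\<lambda>\<xi>. of_real (m v \<xi>) * G \<xi>) x \<partial>lborel)"
    unfolding abs_inv_fourier_def inv_fourier_def by (rule norm_integral_le_nn_integral)
  finally show ?thesis by (simp add: abs_inv_fourier_def)
qed

lemma abs_inv_fourier_cmult:
  fixes G :: "'a::euclidean_space \<Rightarrow> complex"
  assumes c: "0 \<le> c"
  shows "abs_inv_fourier (\<lambda>\<xi>. of_real (c * m \<xi>) * G \<xi>) x = ennreal c * abs_inv_fourier (\<lambda>\<xi>. of_real (m \<xi>) * G \<xi>) x"
proof -
  have "inv_fourier (\<lambda>\<xi>. of_real (c * m \<xi>) * G \<xi>) x = of_real c * inv_fourier (\<lambda>\<xi>. of_real (m \<xi>) * G \<xi>) x"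
    unfolding inv_fourier_def
    by (subst integral_mult_right_zero[symmetric]) (simp add: mult_ac)
  then show ?thesis
    using c by (simp add: abs_inv_fourier_def norm_mult ennreal_mult)
qed

subsection \<open>Multipliers bounded by iterated maximal functions\<close>

lemma hlmax_funpow_mono:
  assumes "\<And>y. g y \<le> h y"
  shows "(hlmax ^^ n) g x \<le> (hlmax ^^ n) h x"
  by (induction n arbitrary: x) (auto intro: hlmax_mono assms)

lemma hlmax_funpow_cmult:
  fixes g :: "'a::euclidean_space \<Rightarrow> ennreal"
  assumes [measurable]: "g \<in> borel_measurable borel"
  shows "(hlmax ^^ n) (\<lambda>y. c * g y) x = c * (hlmax ^^ n) g x"
proof (induction n arbitrary: x)
  case (Suc n)
  then have "(hlmax ^^ n) (\<lambda>y. c * g y) = (\<lambda>x. c * (hlmax ^^ n) g x)" by blast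
  then show ?case by (simp add: hlmax_cmult)
qed simp

lemma hlmax_funpow_bound:
  fixes g :: "'a::euclidean_space \<Rightarrow> ennreal"
  assumes "\<And>y. g y \<le> ennreal c"
  shows "(hlmax ^^ n) g x < \<infinity>"
proof -
  have "(hlmax ^^ n) g x \<le> ennreal (unit_ball_vol DIM('a)) ^ n * ennreal c"
  proof (induction n arbitrary: x)
    case (Suc n)
    have "hlmax ((hlmax ^^ n) g) x \<le> ennreal (unit_ball_vol DIM('a)) * (ennreal (unit_ball_vol DIM('a)) ^ n * ennreal c)"
      by (rule hlmax_le_bound) (rule Suc)
    then show ?case by (simp add: mult.assoc)
  qed (use assms in simp)
  also have "\<dots> < \<infinity>" by (simp add: ennreal_mult_less_top ennreal_power)
  finally show ?thesis .
qed

text \<open>Bounds are by powers of \<^const>\<open>hlmax\<close> rather than by \<^const>\<open>hlmax\<close> itself, so that they compose.\<close>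

definition multiplier_bound :: "nat \<Rightarrow> real \<Rightarrow> ('a::euclidean_space \<Rightarrow> real) \<Rightarrow> bool" where
  "multiplier_bound n C m \<longleftrightarrow> 0 \<le> C \<and> m \<in> borel_measurable borel \<and> (\<exists>B. \<forall>\<xi>. \<bar>m \<xi>\<bar> \<le> B) \<and>
    (\<forall>G. integrable lborel G \<longrightarrow> (\<forall>x. abs_inv_fourier (\<lambda>\<xi>. of_real (m \<xi>) * G \<xi>) x \<le> ennreal C * (hlmax ^^ n) (abs_inv_fourier G) x))"

lemma multiplier_boundD:
  "multiplier_bound n C m \<Longrightarrow> integrable lborel G \<Longrightarrow> abs_inv_fourier (\<lambda>\<xi>. of_real (m \<xi>) * G \<xi>) x \<le> ennreal C * (hlmax ^^ n) (abs_inv_fourier G) x"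
  by (simp add: multiplier_bound_def)

lemma multiplier_bound_integrable:
  fixes G :: "'a::euclidean_space \<Rightarrow> complex"
  shows "multiplier_bound n C m \<Longrightarrow> integrable lborel G \<Longrightarrow> integrable lborel (\<lambda>\<xi>. of_real (m \<xi>) * G \<xi>)"
  by (auto simp: multiplier_bound_def intro: integrable_bounded_mult)

text \<open>Monotonicity and homogeneity of the maximal operator move the bound for m2 inside the
  iterate belonging to m1. That m2 is bounded keeps the intermediate function integrable.\<close>

lemma multiplier_bound_mult:
  fixes m1 m2 :: "'a::euclidean_space \<Rightarrow> real"
  assumes 1: "multiplier_bound n1 C1 m1" and 2: "multiplier_bound n2 C2 m2"
  shows "multiplier_bound (n1 + n2) (C1 * C2) (\<lambda>\<xi>. m1 \<xi> * m2 \<xi>)"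
  unfolding multiplier_bound_def
proof (intro conjI allI impI)
  show "0 \<le> C1 * C2" using 1 2 by (simp add: multiplier_bound_def)
  have [measurable]: "m1 \<in> borel_measurable borel" "m2 \<in> borel_measurable borel"
    using 1 2 by (simp_all add: multiplier_bound_def)
  show "(\<lambda>\<xi>. m1 \<xi> * m2 \<xi>) \<in> borel_measurable borel" by measurable
  obtain B1 B2 where "\<And>\<xi>. \<bar>m1 \<xi>\<bar> \<le> B1" "\<And>\<xi>. \<bar>m2 \<xi>\<bar> \<le> B2" using 1 2 by (auto simp: multiplier_bound_def)
  then have "\<bar>m1 \<xi> * m2 \<xi>\<bar> \<le> B1 * B2" for \<xi>
    by (simp add: abs_mult) (meson abs_ge_zero mult_mono order_trans)
  then show "\<exists>B. \<forall>\<xi>. \<bar>m1 \<xi> * m2 \<xi>\<bar> \<le> B" by blast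
  fix G :: "'a \<Rightarrow> complex" and x assume G: "integrable lborel G"
  have [measurable]: "G \<in> borel_measurable borel" using G by auto
  have G2: "integrable lborel (\<lambda>\<xi>. of_real (m2 \<xi>) * G \<xi>)" by (rule multiplier_bound_integrable[OF 2 G])
  have "abs_inv_fourier (\<lambda>\<xi>. of_real (m1 \<xi> * m2 \<xi>) * G \<xi>) x = abs_inv_fourier (\<lambda>\<xi>. of_real (m1 \<xi>) * (of_real (m2 \<xi>) * G \<xi>)) x"
    by (simp add: mult.assoc)
  also have "\<dots> \<le> ennreal C1 * (hlmax ^^ n1) (abs_inv_fourier (\<lambda>\<xi>. of_real (m2 \<xi>) * G \<xi>)) x"
    by (rule multiplier_boundD[OF 1 G2])
  also have "\<dots> \<le> ennreal C1 * (hlmax ^^ n1) (\<lambda>y. ennreal C2 * (hlmax ^^ n2) (abs_inv_fourier G) y) x"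
    by (intro mult_left_mono hlmax_funpow_mono multiplier_boundD[OF 2 G]) auto
  also have "\<dots> = ennreal (C1 * C2) * (hlmax ^^ (n1 + n2)) (abs_inv_fourier G) x"
    using 1 2 by (subst hlmax_funpow_cmult) (auto simp: funpow_add ennreal_mult mult.assoc multiplier_bound_def)
  finally show "abs_inv_fourier (\<lambda>\<xi>. of_real (m1 \<xi> * m2 \<xi>) * G \<xi>) x \<le> \<dots>" .
qed

lemma multiplier_bound_one: "multiplier_bound 0 1 (\<lambda>_. 1)"
  unfolding multiplier_bound_def by (auto intro: exI[of _ 1])

lemma multiplier_bound_power:
  assumes "multiplier_bound n C m"
  shows "multiplier_bound (k * n) (C ^ k) (\<lambda>\<xi>. m \<xi> ^ k)"
proof (induction k)
  case 0
  show ?case using multiplier_bound_one by simp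
next
  case (Suc k)
  show ?case using multiplier_bound_mult[OF assms Suc] by simp
qed

lemma multiplier_bound_cmult:
  assumes m: "multiplier_bound n C m" and c: "0 \<le> c"
  shows "multiplier_bound n (c * C) (\<lambda>\<xi>. c * m \<xi>)"
  unfolding multiplier_bound_def
proof (intro conjI allI impI)
  show "0 \<le> c * C" using m c by (simp add: multiplier_bound_def)
  have [measurable]: "m \<in> borel_measurable borel" using m by (simp add: multiplier_bound_def)
  show "(\<lambda>\<xi>. c * m \<xi>) \<in> borel_measurable borel" by measurable
  obtain B where "\<And>\<xi>. \<bar>m \<xi>\<bar> \<le> B" using m by (auto simp: multiplier_bound_def)
  then have "\<bar>c * m \<xi>\<bar> \<le> c * B" for \<xi> using c by (simp add: abs_mult mult_left_mono)
  then show "\<exists>B. \<forall>\<xi>. \<bar>c * m \<xi>\<bar> \<le> B" by blast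
  fix G :: "'a \<Rightarrow> complex" and x assume G: "integrable lborel G"
  have "abs_inv_fourier (\<lambda>\<xi>. of_real (c * m \<xi>) * G \<xi>) x = ennreal c * abs_inv_fourier (\<lambda>\<xi>. of_real (m \<xi>) * G \<xi>) x"
    by (rule abs_inv_fourier_cmult[OF c])
  also have "\<dots> \<le> ennreal c * (ennreal C * (hlmax ^^ n) (abs_inv_fourier G) x)"
    by (intro mult_left_mono multiplier_boundD[OF m G]) auto
  finally show "abs_inv_fourier (\<lambda>\<xi>. of_real (c * m \<xi>) * G \<xi>) x \<le> ennreal (c * C) * (hlmax ^^ n) (abs_inv_fourier G) x"
    using m c by (simp add: ennreal_mult mult.assoc multiplier_bound_def)
qed

section \<open>Resolvents as averages of heat multipliers\<close>

definition resolvent :: "real \<Rightarrow> real \<Rightarrow> 'a::euclidean_space \<Rightarrow> real" where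
  "resolvent \<kappa> \<tau> \<xi> = 1 / (1 + \<tau> * symbol \<kappa> \<xi>)"

lemma nn_integral_exp:
  assumes a: "0 < a"
  shows "(\<integral>\<^sup>+v. ennreal (indicator {0..} v * exp (- (a * v))) \<partial>lborel) = ennreal (1 / a)"
proof -
  have "(\<integral>\<^sup>+v. ennreal (exp (- (a * v))) * indicator {0..} v \<partial>lborel) = ennreal (0 - (- (exp (- (a * 0)) / a)))"
  proof (rule nn_integral_FTC_atLeast)
    show "DERIV (\<lambda>v. - (exp (- (a * v)) / a)) x :> exp (- (a * x))" for x
      using a by (auto intro!: derivative_eq_intros)
    have "((\<lambda>v. exp (- (a * v))) \<longlongrightarrow> 0) at_top"
      using a by (intro filterlim_compose[OF exp_at_bot] filterlim_compose[OF filterlim_uminus_at_bot_at_top]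
          filterlim_tendsto_pos_mult_at_top[OF tendsto_const] filterlim_ident)
    then show "((\<lambda>v. - (exp (- (a * v)) / a)) \<longlongrightarrow> 0) at_top"
      by (intro tendsto_eq_rhs[OF tendsto_minus[OF tendsto_divide[OF _ tendsto_const]]]) (use a in auto)
  qed auto
  moreover have "(\<integral>\<^sup>+v. ennreal (indicator {0..} v * exp (- (a * v))) \<partial>lborel) = (\<integral>\<^sup>+v. ennreal (exp (- (a * v))) * indicator {0..} v \<partial>lborel)"
    by (intro nn_integral_cong) (auto simp: indicator_def)
  ultimately show ?thesis by simp
qed

lemma resolvent_bounds:
  assumes "0 < \<tau>" "0 \<le> \<kappa>"
  shows "0 < resolvent \<kappa> \<tau> \<xi>" "resolvent \<kappa> \<tau> \<xi> \<le> 1"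
  using assms mult_nonneg_nonneg[of \<tau> "symbol \<kappa> \<xi>"] by (auto simp: resolvent_def add_pos_nonneg divide_le_eq_1)

lemma measurable_resolvent [measurable]: "resolvent \<kappa> \<tau> \<in> borel_measurable borel"
  unfolding resolvent_def[abs_def] by measurable

text \<open>1 / (1 + \<tau> a) is the integral of exp (- v) * exp (- v \<tau> a) over v > 0, an
  average of heat multipliers of total mass 1, and inherits their constant. For 1 - R(\<tau>) the
  bound of the identity is added; one constant serves both, so that products can be treated
  alike.\<close>

lemma resolvent_multiplier_bound:
  "\<exists>C>0. \<forall>\<tau>>0. \<forall>\<kappa>\<ge>0. multiplier_bound 1 C (resolvent \<kappa> \<tau> :: 'a::euclidean_space \<Rightarrow> real)
     \<and> multiplier_bound 1 C (\<lambda>\<xi>::'a. 1 - resolvent \<kappa> \<tau> \<xi>)"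
proof -
  obtain C1 where C10: "C1 > 0 \<and> (\<forall>\<tau>>0. \<forall>\<kappa>\<ge>0. \<forall>G::'a \<Rightarrow> complex. integrable lborel G \<longrightarrow>
    (\<forall>x. abs_inv_fourier (\<lambda>\<xi>. of_real (exp (- (\<tau> * symbol \<kappa> \<xi>))) * G \<xi>) x \<le> ennreal C1 * hlmax (abs_inv_fourier G) x))"
    using heat_le_hlmax[where 'a='a] by (rule exE)
  note C1 = conjunct1[OF C10] conjunct2[OF C10, rule_format]
  obtain C2 where C2: "C2 > 0" "\<And>G x. integrable lborel (G::'a \<Rightarrow> complex) \<Longrightarrow> abs_inv_fourier G x \<le> ennreal C2 * hlmax (abs_inv_fourier G) x"
    using abs_inv_fourier_le_hlmax[where 'a='a] by blast
  have *: "abs_inv_fourier (\<lambda>\<xi>. of_real (resolvent \<kappa> \<tau> \<xi>) * G \<xi>) x \<le> ennreal C1 * hlmax (abs_inv_fourier G) x"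
    if \<tau>: "0 < \<tau>" and \<kappa>: "0 \<le> \<kappa>" and G: "integrable lborel G" for \<tau> \<kappa> and G :: "'a \<Rightarrow> complex" and x
  proof -
    have [measurable]: "G \<in> borel_measurable borel" using G by auto
    define m where "m = (\<lambda>v \<xi>. indicator {0..} v * exp (- ((1 + \<tau> * symbol \<kappa> (\<xi>::'a)) * v)))"
    have "abs_inv_fourier (\<lambda>\<xi>. of_real (resolvent \<kappa> \<tau> \<xi>) * G \<xi>) x \<le> (\<integral>\<^sup>+v. abs_inv_fourier (\<lambda>\<xi>. of_real (m v \<xi>) * G \<xi>) x \<partial>lborel)"
    proof (rule inv_fourier_superpose)
      show "case_prod m \<in> borel_measurable (borel \<Otimes>\<^sub>M borel)" unfolding m_def by measurable
      show "0 \<le> m v \<xi>" for v \<xi> by (simp add: m_def)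
      show "0 \<le> resolvent \<kappa> \<tau> \<xi>" for \<xi> :: 'a using resolvent_bounds[OF \<tau> \<kappa>, of \<xi>] by simp
      show "(\<integral>\<^sup>+v. ennreal (m v \<xi>) \<partial>lborel) = ennreal (resolvent \<kappa> \<tau> \<xi>)" for \<xi>
        unfolding m_def resolvent_def using \<tau> \<kappa> mult_nonneg_nonneg[of \<tau> "symbol \<kappa> \<xi>"]
        by (intro nn_integral_exp) (simp add: add_pos_nonneg)
      show "integrable lborel (\<lambda>\<xi>. of_real (resolvent \<kappa> \<tau> \<xi>) * G \<xi>)"
        using resolvent_bounds[OF \<tau> \<kappa>, where 'a='a]
        by (intro integrable_bounded_mult[OF G, of _ 1]) (auto simp: less_imp_le)
    qed measurable
    also have "\<dots> \<le> (\<integral>\<^sup>+v. ennreal (indicator {0..} v * exp (- (1 * v))) * (ennreal C1 * hlmax (abs_inv_fourier G) x) \<partial>lborel)"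
    proof (intro nn_integral_mono_AE, use AE_lborel_singleton[of 0] in eventually_elim)
      case (elim v)
      show ?case
      proof (cases "0 < v")
        case True
        have "inv_fourier (\<lambda>\<xi>. of_real (m v \<xi>) * G \<xi>) x
           = of_real (exp (- v)) * inv_fourier (\<lambda>\<xi>. of_real (exp (- ((v * \<tau>) * symbol \<kappa> \<xi>))) * G \<xi>) x"
          unfolding inv_fourier_def m_def using True
          by (subst integral_mult_right_zero[symmetric])
             (intro Bochner_Integration.integral_cong refl, simp add: algebra_simps exp_diff exp_minus divide_inverse)
        then have "abs_inv_fourier (\<lambda>\<xi>. of_real (m v \<xi>) * G \<xi>) x = ennreal (exp (- v)) * abs_inv_fourier (\<lambda>\<xi>. of_real (exp (- ((v * \<tau>) * symbol \<kappa> \<xi>))) * G \<xi>) x"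
          by (simp add: abs_inv_fourier_def norm_mult ennreal_mult)
        also have "\<dots> \<le> ennreal (exp (- v)) * (ennreal C1 * hlmax (abs_inv_fourier G) x)"
          using True \<tau> \<kappa> G by (intro mult_left_mono C1) auto
        finally show ?thesis using True by simp
      next
        case False
        then have "abs_inv_fourier (\<lambda>\<xi>. of_real (m v \<xi>) * G \<xi>) x = 0" using elim
          by (simp add: abs_inv_fourier_def m_def inv_fourier_def)
        then show ?thesis by simp
      qed
    qed
    also have "\<dots> = ennreal 1 * (ennreal C1 * hlmax (abs_inv_fourier G) x)"
      by (subst nn_integral_multc) (auto simp: nn_integral_exp[of 1, simplified])
    finally show ?thesis by simp
  qed
  have **: "abs_inv_fourier (\<lambda>\<xi>. of_real (1 - resolvent \<kappa> \<tau> \<xi>) * G \<xi>) x \<le> ennreal (C1 + C2) * hlmax (abs_inv_fourier G) x"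
    if \<tau>: "0 < \<tau>" and \<kappa>: "0 \<le> \<kappa>" and G: "integrable lborel G" for \<tau> \<kappa> and G :: "'a \<Rightarrow> complex" and x
  proof -
    have RG: "integrable lborel (\<lambda>\<xi>. of_real (resolvent \<kappa> \<tau> \<xi>) * G \<xi>)"
      using resolvent_bounds[OF \<tau> \<kappa>, where 'a='a]
      by (intro integrable_bounded_mult[OF G, of _ 1]) (auto simp: less_imp_le)
    have "inv_fourier (\<lambda>\<xi>. of_real (1 - resolvent \<kappa> \<tau> \<xi>) * G \<xi>) x = inv_fourier G x - inv_fourier (\<lambda>\<xi>. of_real (resolvent \<kappa> \<tau> \<xi>) * G \<xi>) x"
      unfolding inv_fourier_def
      by (subst Bochner_Integration.integral_diff[OF integrable_exp_mult[OF G] integrable_exp_mult[OF RG], symmetric])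
         (simp add: algebra_simps)
    then have "abs_inv_fourier (\<lambda>\<xi>. of_real (1 - resolvent \<kappa> \<tau> \<xi>) * G \<xi>) x \<le> ennreal (norm (inv_fourier G x) + norm (inv_fourier (\<lambda>\<xi>. of_real (resolvent \<kappa> \<tau> \<xi>) * G \<xi>) x))"
      unfolding abs_inv_fourier_def by (intro ennreal_leI) (simp add: norm_triangle_ineq4)
    also have "\<dots> = abs_inv_fourier G x + abs_inv_fourier (\<lambda>\<xi>. of_real (resolvent \<kappa> \<tau> \<xi>) * G \<xi>) x"
      by (simp add: abs_inv_fourier_def ennreal_plus)
    also have "\<dots> \<le> ennreal C2 * hlmax (abs_inv_fourier G) x + ennreal C1 * hlmax (abs_inv_fourier G) x"
      by (intro add_mono C2 * \<tau> \<kappa> G)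
    also have "\<dots> = ennreal (C1 + C2) * hlmax (abs_inv_fourier G) x"
      using C1(1) C2(1) by (simp add: ennreal_plus distrib_right add.commute)
    finally show ?thesis .
  qed
  have "multiplier_bound 1 (C1 + C2) (resolvent \<kappa> \<tau> :: 'a \<Rightarrow> real)
     \<and> multiplier_bound 1 (C1 + C2) (\<lambda>\<xi>::'a. 1 - resolvent \<kappa> \<tau> \<xi>)" if \<tau>: "0 < \<tau>" and \<kappa>: "0 \<le> \<kappa>" for \<tau> \<kappa>
  proof -
    have b: "\<bar>resolvent \<kappa> \<tau> \<xi>\<bar> \<le> 1" "\<bar>1 - resolvent \<kappa> \<tau> \<xi>\<bar> \<le> 1" for \<xi> :: 'a
      using resolvent_bounds[OF \<tau> \<kappa>, of \<xi>] by auto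
    have "ennreal C1 * hlmax (abs_inv_fourier G) x \<le> ennreal (C1 + C2) * hlmax (abs_inv_fourier G) x" for G :: "'a \<Rightarrow> complex" and x
      using C1(1) C2(1) by (intro mult_right_mono ennreal_leI) auto
    then have "abs_inv_fourier (\<lambda>\<xi>. of_real (resolvent \<kappa> \<tau> \<xi>) * G \<xi>) x \<le> ennreal (C1 + C2) * hlmax (abs_inv_fourier G) x"
      if "integrable lborel G" for G :: "'a \<Rightarrow> complex" and x
      using *[OF \<tau> \<kappa> that, of x] order_trans by blast
    then show ?thesis unfolding multiplier_bound_def
      using C1(1) C2(1) b **[OF \<tau> \<kappa>] by (auto intro: exI[of _ 1])
  qed
  moreover have "0 < C1 + C2" using C1 C2 by simp
  ultimately show ?thesis by blast
qed

section \<open>A pointwise interpolation inequality\<close>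

lemma abs_inv_fourier_le_integral:
  fixes G :: "'a::euclidean_space \<Rightarrow> complex"
  shows "abs_inv_fourier G x \<le> (\<integral>\<^sup>+\<xi>. ennreal (norm (G \<xi>)) \<partial>lborel)"
  unfolding abs_inv_fourier_def inv_fourier_def
  by (rule order_trans[OF norm_integral_le_nn_integral]) (simp add: norm_mult)

text \<open>An inverse transform is bounded by the L^1 norm, and iterates of the maximal operator
  stay bounded. Finite values are needed later to balance two such iterates against each
  other.\<close>

lemma hlmax_funpow_abs_inv_fourier_finite:
  fixes G :: "'a::euclidean_space \<Rightarrow> complex"
  assumes "integrable lborel G"
  shows "(hlmax ^^ n) (abs_inv_fourier G) x < \<infinity>"
proof -
  obtain c where "(\<integral>\<^sup>+\<xi>. ennreal (norm (G \<xi>)) \<partial>lborel) = ennreal c"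
    using assms by (cases "\<integral>\<^sup>+\<xi>. ennreal (norm (G \<xi>)) \<partial>lborel") (auto simp: integrable_iff_bounded)
  then show ?thesis using abs_inv_fourier_le_integral[of G] by (intro hlmax_funpow_bound[of _ c]) auto
qed

lemma one_minus_resolvent:
  assumes "0 < \<tau>" "0 \<le> \<kappa>"
  shows "1 - resolvent \<kappa> \<tau> \<xi> = (\<tau> * symbol \<kappa> \<xi>) / (1 + \<tau> * symbol \<kappa> \<xi>)"
proof -
  define D where "D = 1 + \<tau> * symbol \<kappa> \<xi>"
  have "0 < D" using assms mult_nonneg_nonneg[of \<tau> "symbol \<kappa> \<xi>"] by (simp add: D_def add_pos_nonneg)
  moreover have "\<tau> * symbol \<kappa> \<xi> = D - 1" by (simp add: D_def)
  ultimately show ?thesis unfolding resolvent_def D_def[symmetric] by (simp add: diff_divide_distrib)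
qed

lemma ennreal_positive_finite:
  assumes "(x::ennreal) < \<infinity>" "0 < x"
  obtains c where "0 < c" "x = ennreal c"
  using assms by (cases x) auto

text \<open>For \<tau> \<le> \<rho> the product equals (\<tau> / \<rho>) R(\<tau>) (1 - R(\<rho>)),
  which yields the small factor; for \<tau> > \<rho> the separate bounds are enough. Each of the n
  factors costs two maximal operators, hence n * 2.\<close>

lemma resolvent_product_multiplier_bound:
  "\<exists>C>0. \<forall>\<kappa>\<ge>0. \<forall>\<tau>>0. \<forall>\<rho>>0.
     multiplier_bound (n * 2) ((C * min 1 (\<tau> / \<rho>)) ^ n)
       (\<lambda>\<xi>::'a::euclidean_space. ((1 - resolvent \<kappa> \<tau> \<xi>) * resolvent \<kappa> \<rho> \<xi>) ^ n)"
proof -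
  obtain C0 where C00: "C0 > 0 \<and> (\<forall>\<tau>>0. \<forall>\<kappa>\<ge>0. multiplier_bound 1 C0 (resolvent \<kappa> \<tau> :: 'a \<Rightarrow> real)
     \<and> multiplier_bound 1 C0 (\<lambda>\<xi>::'a. 1 - resolvent \<kappa> \<tau> \<xi>))"
    using resolvent_multiplier_bound[where 'a='a] by (rule exE)
  note C0 = conjunct1[OF C00] and R = conjunct1[OF conjunct2[OF C00, rule_format]]
    and R1 = conjunct2[OF conjunct2[OF C00, rule_format]]
  define C where "C = C0 * C0"
  have C: "0 < C" using C0 by (simp add: C_def)
  have "multiplier_bound (n * 2) ((C * min 1 (\<tau> / \<rho>)) ^ n) (\<lambda>\<xi>::'a. ((1 - resolvent \<kappa> \<tau> \<xi>) * resolvent \<kappa> \<rho> \<xi>) ^ n)"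
    if \<kappa>: "0 \<le> \<kappa>" and \<tau>: "0 < \<tau>" and \<rho>: "0 < \<rho>" for \<kappa> \<tau> \<rho>
  proof (rule multiplier_bound_power)
    show "multiplier_bound 2 (C * min 1 (\<tau> / \<rho>)) (\<lambda>\<xi>::'a. (1 - resolvent \<kappa> \<tau> \<xi>) * resolvent \<kappa> \<rho> \<xi>)"
    proof (cases "\<tau> / \<rho> \<le> 1")
      case True
      have "multiplier_bound (1 + 1) ((\<tau> / \<rho>) * (C0 * C0)) (\<lambda>\<xi>::'a. (\<tau> / \<rho>) * (resolvent \<kappa> \<tau> \<xi> * (1 - resolvent \<kappa> \<rho> \<xi>)))"
        using \<tau> \<rho> \<kappa> by (intro multiplier_bound_cmult multiplier_bound_mult R R1) auto
      moreover have "(\<tau> / \<rho>) * (resolvent \<kappa> \<tau> \<xi> * (1 - resolvent \<kappa> \<rho> \<xi>)) = (1 - resolvent \<kappa> \<tau> \<xi>) * resolvent \<kappa> \<rho> \<xi>" for \<xi> :: 'a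
        using \<rho> by (simp only: one_minus_resolvent[OF \<tau> \<kappa>] one_minus_resolvent[OF \<rho> \<kappa>]) (simp add: resolvent_def)
      ultimately show ?thesis using True by (simp add: C_def mult.commute numeral_2_eq_2)
    next
      case False
      have "multiplier_bound (1 + 1) (C0 * C0) (\<lambda>\<xi>::'a. (1 - resolvent \<kappa> \<tau> \<xi>) * resolvent \<kappa> \<rho> \<xi>)"
        using \<tau> \<rho> \<kappa> by (intro multiplier_bound_mult R R1) auto
      then show ?thesis using False by (simp add: C_def numeral_2_eq_2)
    qed
  qed
  then show ?thesis using C by blast
qed

text \<open>F is recovered from G = symbol powr (s / 2) * F by a Mellin integral of \<rho> powr (s /
  2 - 1) * R(\<rho>)^n, and (1 - R(\<tau>))^n is taken inside. The product bound makes the integral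
  of the norms converge, at 0 because s > 0 and at infinity because n > s / 2; rescaling \<rho> by
  \<tau> yields \<tau> powr (s / 2).\<close>

lemma high_frequency_bound:
  assumes s: "0 < s" and n: "s / 2 < real n"
  shows "\<exists>C>0. \<forall>\<kappa>\<ge>0. \<forall>\<tau>>0. \<forall>F::'a::euclidean_space \<Rightarrow> complex. integrable lborel F \<longrightarrow>
    integrable lborel (\<lambda>\<xi>. of_real (symbol \<kappa> \<xi> powr (s / 2)) * F \<xi>) \<longrightarrow>
    (\<forall>x. abs_inv_fourier (\<lambda>\<xi>. of_real ((1 - resolvent \<kappa> \<tau> \<xi>) ^ n) * F \<xi>) x
      \<le> ennreal (C * \<tau> powr (s / 2)) * (hlmax ^^ (n * 2)) (abs_inv_fourier (\<lambda>\<xi>. of_real (symbol \<kappa> \<xi> powr (s / 2)) * F \<xi>)) x)"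
proof -
  obtain C0 where C00: "C0 > 0 \<and> (\<forall>\<kappa>\<ge>0. \<forall>\<tau>>0. \<forall>\<rho>>0.
     multiplier_bound (n * 2) ((C0 * min 1 (\<tau> / \<rho>)) ^ n)
       (\<lambda>\<xi>::'a. ((1 - resolvent \<kappa> \<tau> \<xi>) * resolvent \<kappa> \<rho> \<xi>) ^ n))"
    using resolvent_product_multiplier_bound[where 'a='a] by (rule exE)
  note C0 = conjunct1[OF C00] and RR = conjunct2[OF C00, rule_format]
  \<comment> \<open>h2 is the profile of R(\<rho>)^n, whose Mellin constant normalises the formula
    for F; h3 is the profile of the product bound as a function of \<rho> / \<tau>.\<close>
  define h2 where "h2 = (\<lambda>v::real. ennreal ((1 / (1 + v)) ^ n))"
  define h3 where "h3 = (\<lambda>v::real. ennreal (min 1 (1 / v) ^ n))"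
  have [measurable]: "h2 \<in> borel_measurable borel" "h3 \<in> borel_measurable borel"
    unfolding h2_def h3_def by measurable
  have powr_n: "v powr (- real n) = (1 / v) ^ n" if "0 < v" for v :: real
    using that by (simp add: powr_minus powr_realpow power_one_over inverse_eq_divide)
  have "mellin (- (s / 2)) h2 < \<infinity>"
  proof (rule mellin_finite[where K = 1 and ?c1.0 = 0 and ?c2.0 = "- real n"])
    show "h2 v \<le> ennreal (1 * v powr 0)" if "0 < v" "v \<le> 1" for v
      using that unfolding h2_def by (intro ennreal_leI) (simp add: power_le_one)
    show "h2 v \<le> ennreal (1 * v powr - real n)" if "1 \<le> v" for v
      using that unfolding h2_def by (intro ennreal_leI, subst powr_n) (auto intro!: power_mono divide_left_mono)
  qed (use s n in auto)
  moreover have "0 < mellin (- (s / 2)) h2"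
    by (rule mellin_pos) (auto simp: h2_def)
  ultimately obtain c2 where c2: "0 < c2" "mellin (- (s / 2)) h2 = ennreal c2"
    by (rule ennreal_positive_finite)
  have "mellin (- (s / 2)) h3 < \<infinity>"
  proof (rule mellin_finite[where K = 1 and ?c1.0 = 0 and ?c2.0 = "- real n"])
    show "h3 v \<le> ennreal (1 * v powr 0)" if "0 < v" "v \<le> 1" for v
      using that unfolding h3_def by (intro ennreal_leI) (simp add: power_le_one)
    show "h3 v \<le> ennreal (1 * v powr - real n)" if "1 \<le> v" for v
      using that unfolding h3_def by (intro ennreal_leI, subst powr_n) (auto intro!: power_mono)
  qed (use s n in auto)
  moreover have "0 < mellin (- (s / 2)) h3"
    by (rule mellin_pos) (auto simp: h3_def)
  ultimately obtain c3 where c3: "0 < c3" "mellin (- (s / 2)) h3 = ennreal c3"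
    by (rule ennreal_positive_finite)
  define C where "C = C0 ^ n * c3 / c2"
  have C: "0 < C" using C0 c2 c3 by (simp add: C_def)
  have "abs_inv_fourier (\<lambda>\<xi>. of_real ((1 - resolvent \<kappa> \<tau> \<xi>) ^ n) * F \<xi>) x
      \<le> ennreal (C * \<tau> powr (s / 2)) * (hlmax ^^ (n * 2)) (abs_inv_fourier (\<lambda>\<xi>. of_real (symbol \<kappa> \<xi> powr (s / 2)) * F \<xi>)) x"
    if \<kappa>: "0 \<le> \<kappa>" and \<tau>: "0 < \<tau>" and F: "integrable lborel F"
      and G': "integrable lborel (\<lambda>\<xi>. of_real (symbol \<kappa> \<xi> powr (s / 2)) * F \<xi>)" for \<kappa> \<tau> x and F :: "'a \<Rightarrow> complex"
  proof -
    define G where "G = (\<lambda>\<xi>. of_real (symbol \<kappa> \<xi> powr (s / 2)) * F \<xi>)"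
    have G: "integrable lborel G" using G' by (simp add: G_def)
    have [measurable]: "F \<in> borel_measurable borel" "G \<in> borel_measurable borel" using F G by auto
    define B where "B = (hlmax ^^ (n * 2)) (abs_inv_fourier G) x"
    let ?w = "\<lambda>\<rho>. indicator {0<..} \<rho> * \<rho> powr (- (- (s / 2)) - 1) :: real"
    define m where "m = (\<lambda>\<rho> \<xi>. ?w \<rho> * ((1 - resolvent \<kappa> \<tau> (\<xi>::'a)) * resolvent \<kappa> \<rho> \<xi>) ^ n)"
    define M where "M = (\<lambda>\<xi>::'a. c2 * symbol \<kappa> \<xi> powr (- (s / 2)) * (1 - resolvent \<kappa> \<tau> \<xi>) ^ n)"
    have r1: "0 \<le> 1 - resolvent \<kappa> \<tau> \<xi>" for \<xi> :: 'a using resolvent_bounds[OF \<tau> \<kappa>, of \<xi>] by simp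
    have [measurable]: "case_prod m \<in> borel_measurable (borel \<Otimes>\<^sub>M borel)" "M \<in> borel_measurable borel"
      unfolding m_def M_def resolvent_def by measurable
    \<comment> \<open>For \<kappa> = 0 the two opposite powers of the symbol do not multiply to 1 at
      the origin, so the identity is claimed almost everywhere.\<close>
    have MF: "AE \<xi> in lborel. of_real (M \<xi>) * G \<xi> = of_real (c2 * (1 - resolvent \<kappa> \<tau> \<xi>) ^ n) * F \<xi>"
      using AE_lborel_nonzero
    proof eventually_elim
      case (elim \<xi>)
      have "symbol \<kappa> \<xi> powr (- (s / 2)) * symbol \<kappa> \<xi> powr (s / 2) = 1"
        using symbol_pos[OF \<kappa> elim] by (simp add: powr_add[symmetric])
      then have "of_real (symbol \<kappa> \<xi> powr (- (s / 2))) * complex_of_real (symbol \<kappa> \<xi> powr (s / 2)) = 1"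
        by (metis of_real_1 of_real_mult)
      then show ?case by (simp add: M_def G_def mult_ac)
    qed
    have intR: "integrable lborel (\<lambda>\<xi>. of_real (c2 * (1 - resolvent \<kappa> \<tau> \<xi>) ^ n) * F \<xi>)"
    proof (rule integrable_bounded_mult[OF F])
      show "\<bar>c2 * (1 - resolvent \<kappa> \<tau> \<xi>) ^ n\<bar> \<le> c2" for \<xi> :: 'a
        using r1[of \<xi>] resolvent_bounds[OF \<tau> \<kappa>, of \<xi>] c2 by (simp add: abs_mult mult_left_le power_le_one)
    qed measurable
    have "ennreal c2 * abs_inv_fourier (\<lambda>\<xi>. of_real ((1 - resolvent \<kappa> \<tau> \<xi>) ^ n) * F \<xi>) x
      = abs_inv_fourier (\<lambda>\<xi>. of_real (c2 * (1 - resolvent \<kappa> \<tau> \<xi>) ^ n) * F \<xi>) x"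
      using c2 by (subst abs_inv_fourier_cmult) auto
    also have "\<dots> = abs_inv_fourier (\<lambda>\<xi>. of_real (M \<xi>) * G \<xi>) x"
      unfolding abs_inv_fourier_def by (subst inv_fourier_cong_AE[OF _ _ MF]) measurable
    also have "\<dots> \<le> (\<integral>\<^sup>+\<rho>. abs_inv_fourier (\<lambda>\<xi>. of_real (m \<rho> \<xi>) * G \<xi>) x \<partial>lborel)"
    proof (rule inv_fourier_superpose)
      show "0 \<le> m \<rho> \<xi>" for \<rho> \<xi>
        using r1[of \<xi>] resolvent_bounds[OF _ \<kappa>, of \<rho> \<xi>] by (cases "0 < \<rho>") (auto simp: m_def)
      show "0 \<le> M \<xi>" for \<xi> using r1[of \<xi>] c2 by (simp add: M_def)
      fix \<xi> :: 'a assume \<xi>: "\<xi> \<noteq> 0"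
      have "(\<integral>\<^sup>+\<rho>. ennreal (m \<rho> \<xi>) \<partial>lborel) = (\<integral>\<^sup>+\<rho>. ennreal ((1 - resolvent \<kappa> \<tau> \<xi>) ^ n) *
          (indicator {0<..} \<rho> * ennreal (\<rho> powr (- (- (s / 2)) - 1)) * h2 (\<rho> * symbol \<kappa> \<xi>)) \<partial>lborel)"
      proof (rule nn_integral_cong)
        fix \<rho> :: real
        show "ennreal (m \<rho> \<xi>) = ennreal ((1 - resolvent \<kappa> \<tau> \<xi>) ^ n) *
          (indicator {0<..} \<rho> * ennreal (\<rho> powr (- (- (s / 2)) - 1)) * h2 (\<rho> * symbol \<kappa> \<xi>))"
        proof (cases "0 < \<rho>")
          case True
          have r2: "0 \<le> resolvent \<kappa> \<rho> \<xi>" using resolvent_bounds[OF True \<kappa>, of \<xi>] by simp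
          have "h2 (\<rho> * symbol \<kappa> \<xi>) = ennreal (resolvent \<kappa> \<rho> \<xi> ^ n)" by (simp add: h2_def resolvent_def)
          then show ?thesis using True r1[of \<xi>] r2
            by (simp add: m_def power_mult_distrib ennreal_mult[symmetric] mult_ac)
        qed (simp add: m_def)
      qed
      also have "\<dots> = ennreal ((1 - resolvent \<kappa> \<tau> \<xi>) ^ n) * mellin (- (s / 2)) (\<lambda>\<rho>. h2 (\<rho> * symbol \<kappa> \<xi>))"
        unfolding mellin_def by (rule nn_integral_cmult) measurable
      also have "\<dots> = ennreal ((1 - resolvent \<kappa> \<tau> \<xi>) ^ n) * (ennreal (symbol \<kappa> \<xi> powr (- (s / 2))) * ennreal c2)"
        using symbol_pos[OF \<kappa> \<xi>] by (subst mellin_scale) (auto simp: c2)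
      also have "\<dots> = ennreal (M \<xi>)"
        using c2 r1[of \<xi>] by (simp add: M_def ennreal_mult[symmetric] mult_ac)
      finally show "(\<integral>\<^sup>+\<rho>. ennreal (m \<rho> \<xi>) \<partial>lborel) = ennreal (M \<xi>)" .
    next
      show "integrable lborel (\<lambda>\<xi>. of_real (M \<xi>) * G \<xi>)"
        by (rule integrable_cong_AE_imp[OF intR]) (use MF in \<open>auto elim: eventually_mono\<close>)
    qed measurable
    also have "\<dots> \<le> (\<integral>\<^sup>+\<rho>. ennreal (C0 ^ n) * B * (indicator {0<..} \<rho> * ennreal (\<rho> powr (- (- (s / 2)) - 1)) * h3 (\<rho> * (1 / \<tau>))) \<partial>lborel)"
    proof (rule nn_integral_mono)
      fix \<rho> :: real
      show "abs_inv_fourier (\<lambda>\<xi>. of_real (m \<rho> \<xi>) * G \<xi>) x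
         \<le> ennreal (C0 ^ n) * B * (indicator {0<..} \<rho> * ennreal (\<rho> powr (- (- (s / 2)) - 1)) * h3 (\<rho> * (1 / \<tau>)))"
      proof (cases "0 < \<rho>")
        case True
        have "abs_inv_fourier (\<lambda>\<xi>. of_real (m \<rho> \<xi>) * G \<xi>) x
          = ennreal (?w \<rho>) * abs_inv_fourier (\<lambda>\<xi>. of_real (((1 - resolvent \<kappa> \<tau> \<xi>) * resolvent \<kappa> \<rho> \<xi>) ^ n) * G \<xi>) x"
          unfolding m_def by (rule abs_inv_fourier_cmult) simp
        also have "\<dots> \<le> ennreal (?w \<rho>) * (ennreal ((C0 * min 1 (\<tau> / \<rho>)) ^ n) * B)"
          unfolding B_def by (intro mult_left_mono multiplier_boundD[OF RR G] \<kappa> \<tau> True) auto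
        also have "\<dots> = ennreal (C0 ^ n) * B * (indicator {0<..} \<rho> * ennreal (\<rho> powr (- (- (s / 2)) - 1)) * h3 (\<rho> * (1 / \<tau>)))"
          using True \<tau> C0 by (simp add: h3_def power_mult_distrib ennreal_mult mult_ac)
        finally show ?thesis .
      next
        case False
        then show ?thesis by (simp add: m_def abs_inv_fourier_def inv_fourier_def)
      qed
    qed
    also have "\<dots> = ennreal (C0 ^ n) * B * mellin (- (s / 2)) (\<lambda>\<rho>. h3 (\<rho> * (1 / \<tau>)))"
      unfolding mellin_def by (rule nn_integral_cmult) measurable
    also have "\<dots> = ennreal (C0 ^ n) * B * (ennreal ((1 / \<tau>) powr (- (s / 2))) * ennreal c3)"
      using \<tau> by (subst mellin_scale) (auto simp: c3)
    also have "\<dots> = ennreal (C0 ^ n * \<tau> powr (s / 2) * c3) * B"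
      using C0 c3 \<tau> by (simp add: powr_divide powr_minus ennreal_mult mult_ac)
    finally have "ennreal (1 / c2) * (ennreal c2 * abs_inv_fourier (\<lambda>\<xi>. of_real ((1 - resolvent \<kappa> \<tau> \<xi>) ^ n) * F \<xi>) x)
       \<le> ennreal (1 / c2) * (ennreal (C0 ^ n * \<tau> powr (s / 2) * c3) * B)"
      by (rule mult_left_mono) simp
    then show ?thesis using c2 C0 c3
      by (simp add: mult.assoc[symmetric] ennreal_mult[symmetric]) (simp add: C_def B_def G_def mult_ac)
  qed
  then show ?thesis using C by blast
qed

text \<open>The endpoints t = 0 and t = s are excluded because the integral of \<tau> powr (- t / 2
  - 1) * min A (\<tau> powr (s / 2) * B), for positive A and B, converges at infinity only if t > 0
  and at 0 only if t < s.\<close>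

lemma pointwise_interpolation:
  assumes t: "0 < t" "t < s"
  shows "\<exists>n. \<exists>C>0. \<forall>\<kappa>\<ge>0. \<forall>F::'a::euclidean_space \<Rightarrow> complex. integrable lborel F \<longrightarrow>
    integrable lborel (\<lambda>\<xi>. of_real (symbol \<kappa> \<xi> powr (s / 2)) * F \<xi>) \<longrightarrow>
    integrable lborel (\<lambda>\<xi>. of_real (symbol \<kappa> \<xi> powr (t / 2)) * F \<xi>) \<longrightarrow>
    (\<forall>x. abs_inv_fourier (\<lambda>\<xi>. of_real (symbol \<kappa> \<xi> powr (t / 2)) * F \<xi>) x
      \<le> ennreal C * (ennpowr ((hlmax ^^ (n * 2)) (abs_inv_fourier (\<lambda>\<xi>. of_real (symbol \<kappa> \<xi> powr (s / 2)) * F \<xi>)) x) (t / s)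
          * ennpowr ((hlmax ^^ n) (abs_inv_fourier F) x) (1 - t / s)))"
proof -
  have s: "0 < s" using t by simp
  obtain n :: nat where n: "s / 2 < real n" using reals_Archimedean2 by blast
  obtain C0 where C00: "C0 > 0 \<and> (\<forall>\<tau>>0. \<forall>\<kappa>\<ge>0. multiplier_bound 1 C0 (resolvent \<kappa> \<tau> :: 'a \<Rightarrow> real)
     \<and> multiplier_bound 1 C0 (\<lambda>\<xi>::'a. 1 - resolvent \<kappa> \<tau> \<xi>))"
    using resolvent_multiplier_bound[where 'a='a] by (rule exE)
  note C0 = conjunct1[OF C00] and R1 = conjunct2[OF conjunct2[OF C00, rule_format]]
  obtain C1 where C10: "C1>0 \<and> (\<forall>\<kappa>\<ge>0. \<forall>\<tau>>0. \<forall>F::'a \<Rightarrow> complex. integrable lborel F \<longrightarrow>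
    integrable lborel (\<lambda>\<xi>. of_real (symbol \<kappa> \<xi> powr (s / 2)) * F \<xi>) \<longrightarrow>
    (\<forall>x. abs_inv_fourier (\<lambda>\<xi>. of_real ((1 - resolvent \<kappa> \<tau> \<xi>) ^ n) * F \<xi>) x
      \<le> ennreal (C1 * \<tau> powr (s / 2)) * (hlmax ^^ (n * 2)) (abs_inv_fourier (\<lambda>\<xi>. of_real (symbol \<kappa> \<xi> powr (s / 2)) * F \<xi>)) x))"
    using high_frequency_bound[where 'a='a, OF s n] by (rule exE)
  note C1 = conjunct1[OF C10] and H = conjunct2[OF C10, rule_format]
  define D where "D = max (C0 ^ n) C1"
  have D: "0 < D" using C1 by (simp add: D_def)
  \<comment> \<open>h1 is the profile of (1 - R(\<tau>))^n, and its Mellin constant normalises the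
    formula for symbol powr (t / 2). h4 is the minimum of the two bounds in normalised form, and its
    Mellin constant is the balanced integral for A = B = 1.\<close>
  define h1 where "h1 = (\<lambda>v::real. ennreal ((v / (1 + v)) ^ n))"
  define h4 where "h4 = (\<lambda>v::real. ennreal (min 1 (v powr (s / 2))))"
  have [measurable]: "h1 \<in> borel_measurable borel" "h4 \<in> borel_measurable borel"
    unfolding h1_def h4_def by measurable
  have "mellin (t / 2) h1 < \<infinity>"
  proof (rule mellin_finite[where K = 1 and ?c1.0 = "real n" and ?c2.0 = 0])
    show "h1 v \<le> ennreal (1 * v powr real n)" if "0 < v" "v \<le> 1" for v
      using that unfolding h1_def by (intro ennreal_leI) (auto simp: powr_realpow divide_le_eq intro!: power_mono)
    show "h1 v \<le> ennreal (1 * v powr 0)" if "1 \<le> v" for v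
      using that unfolding h1_def by (intro ennreal_leI) (auto intro!: power_le_one)
  qed (use t n in auto)
  moreover have "0 < mellin (t / 2) h1"
    by (rule mellin_pos) (auto simp: h1_def)
  ultimately obtain c1 where c1: "0 < c1" "mellin (t / 2) h1 = ennreal c1"
    by (rule ennreal_positive_finite)
  have "mellin (t / 2) h4 < \<infinity>"
  proof (rule mellin_finite[where K = 1 and ?c1.0 = "s / 2" and ?c2.0 = 0])
    show "h4 v \<le> ennreal (1 * v powr (s / 2))" if "0 < v" "v \<le> 1" for v
      unfolding h4_def by (intro ennreal_leI) simp
    show "h4 v \<le> ennreal (1 * v powr 0)" if "1 \<le> v" for v
      using that unfolding h4_def by (intro ennreal_leI) simp
  qed (use t in auto)
  moreover have "0 < mellin (t / 2) h4"
    by (rule mellin_pos) (auto simp: h4_def)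
  ultimately obtain c4 where c4: "0 < c4" "mellin (t / 2) h4 = ennreal c4"
    by (rule ennreal_positive_finite)
  define C where "C = D * c4 / c1"
  have C: "0 < C" using D c1 c4 by (simp add: C_def)
  have "abs_inv_fourier (\<lambda>\<xi>. of_real (symbol \<kappa> \<xi> powr (t / 2)) * F \<xi>) x
      \<le> ennreal C * (ennpowr ((hlmax ^^ (n * 2)) (abs_inv_fourier (\<lambda>\<xi>. of_real (symbol \<kappa> \<xi> powr (s / 2)) * F \<xi>)) x) (t / s)
          * ennpowr ((hlmax ^^ n) (abs_inv_fourier F) x) (1 - t / s))"
    if \<kappa>: "0 \<le> \<kappa>" and F: "integrable lborel F"
      and G: "integrable lborel (\<lambda>\<xi>. of_real (symbol \<kappa> \<xi> powr (s / 2)) * F \<xi>)"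
      and Ft: "integrable lborel (\<lambda>\<xi>. of_real (symbol \<kappa> \<xi> powr (t / 2)) * F \<xi>)" for \<kappa> x and F :: "'a \<Rightarrow> complex"
  proof -
    have [measurable]: "F \<in> borel_measurable borel" using F by auto
    define A where "A = (hlmax ^^ n) (abs_inv_fourier F) x"
    define B where "B = (hlmax ^^ (n * 2)) (abs_inv_fourier (\<lambda>\<xi>. of_real (symbol \<kappa> \<xi> powr (s / 2)) * F \<xi>)) x"
    define T where "T = abs_inv_fourier (\<lambda>\<xi>. of_real (symbol \<kappa> \<xi> powr (t / 2)) * F \<xi>) x"
    let ?w = "\<lambda>\<tau>. indicator {0<..} \<tau> * \<tau> powr (- (t / 2) - 1) :: real"
    define m where "m = (\<lambda>\<tau> \<xi>. ?w \<tau> * (1 - resolvent \<kappa> \<tau> (\<xi>::'a)) ^ n)"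
    define M where "M = (\<lambda>\<xi>::'a. c1 * symbol \<kappa> \<xi> powr (t / 2))"
    have [measurable]: "case_prod m \<in> borel_measurable (borel \<Otimes>\<^sub>M borel)" "M \<in> borel_measurable borel"
      unfolding m_def M_def resolvent_def by measurable
    have "ennreal c1 * T = abs_inv_fourier (\<lambda>\<xi>. of_real (M \<xi>) * F \<xi>) x"
      unfolding M_def T_def using c1 by (subst abs_inv_fourier_cmult) auto
    also have "\<dots> \<le> (\<integral>\<^sup>+\<tau>. abs_inv_fourier (\<lambda>\<xi>. of_real (m \<tau> \<xi>) * F \<xi>) x \<partial>lborel)"
    proof (rule inv_fourier_superpose)
      show "0 \<le> m \<tau> \<xi>" for \<tau> \<xi>
        using resolvent_bounds[OF _ \<kappa>, of \<tau> \<xi>] by (cases "0 < \<tau>") (auto simp: m_def)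
      show "0 \<le> M \<xi>" for \<xi> using c1 by (simp add: M_def)
      fix \<xi> :: 'a assume \<xi>: "\<xi> \<noteq> 0"
      have "(\<integral>\<^sup>+\<tau>. ennreal (m \<tau> \<xi>) \<partial>lborel) = mellin (t / 2) (\<lambda>\<tau>. h1 (\<tau> * symbol \<kappa> \<xi>))"
        unfolding mellin_def
      proof (rule nn_integral_cong)
        fix \<tau> :: real
        show "ennreal (m \<tau> \<xi>) = indicator {0<..} \<tau> * ennreal (\<tau> powr (- (t / 2) - 1)) * h1 (\<tau> * symbol \<kappa> \<xi>)"
        proof (cases "0 < \<tau>")
          case True
          have "h1 (\<tau> * symbol \<kappa> \<xi>) = ennreal ((1 - resolvent \<kappa> \<tau> \<xi>) ^ n)"
            by (simp add: h1_def one_minus_resolvent[OF True \<kappa>])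
          then show ?thesis using True resolvent_bounds[OF True \<kappa>, of \<xi>]
            by (simp add: m_def ennreal_mult)
        qed (simp add: m_def)
      qed
      also have "\<dots> = ennreal (M \<xi>)"
        using symbol_pos[OF \<kappa> \<xi>] c1 by (subst mellin_scale) (auto simp: M_def ennreal_mult mult.commute)
      finally show "(\<integral>\<^sup>+\<tau>. ennreal (m \<tau> \<xi>) \<partial>lborel) = ennreal (M \<xi>)" .
    next
      show "integrable lborel (\<lambda>\<xi>. of_real (M \<xi>) * F \<xi>)"
        using Ft unfolding M_def by (simp add: mult.assoc)
    qed measurable
    also have "\<dots> \<le> (\<integral>\<^sup>+\<tau>. ennreal D * (indicator {0<..} \<tau> * ennreal (\<tau> powr (- (t / 2) - 1)) * min A (ennreal (\<tau> powr (s / 2)) * B)) \<partial>lborel)"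
    proof (rule nn_integral_mono)
      fix \<tau> :: real
      show "abs_inv_fourier (\<lambda>\<xi>. of_real (m \<tau> \<xi>) * F \<xi>) x
         \<le> ennreal D * (indicator {0<..} \<tau> * ennreal (\<tau> powr (- (t / 2) - 1)) * min A (ennreal (\<tau> powr (s / 2)) * B))"
      proof (cases "0 < \<tau>")
        case True
        let ?N = "abs_inv_fourier (\<lambda>\<xi>. of_real ((1 - resolvent \<kappa> \<tau> \<xi>) ^ n) * F \<xi>) x"
        have "?N \<le> ennreal (C0 ^ n) * A"
          using multiplier_boundD[OF multiplier_bound_power[OF R1[OF True \<kappa>], of n] F, of x] by (simp add: A_def)
        also have "\<dots> \<le> ennreal D * A" by (intro mult_right_mono ennreal_leI) (auto simp: D_def)
        finally have N1: "?N \<le> ennreal D * A" .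
        have "?N \<le> ennreal (C1 * \<tau> powr (s / 2)) * B"
          unfolding B_def by (rule H[OF \<kappa> True F G])
        also have "\<dots> \<le> ennreal (D * \<tau> powr (s / 2)) * B"
          by (intro mult_right_mono ennreal_leI) (auto simp: D_def)
        also have "\<dots> = ennreal D * (ennreal (\<tau> powr (s / 2)) * B)" using D by (simp add: ennreal_mult mult.assoc)
        finally have N2: "?N \<le> ennreal D * (ennreal (\<tau> powr (s / 2)) * B)" .
        have "?N \<le> ennreal D * min A (ennreal (\<tau> powr (s / 2)) * B)"
          using N1 N2 by (simp add: min_def)
        then have "ennreal (?w \<tau>) * ?N \<le> ennreal (?w \<tau>) * (ennreal D * min A (ennreal (\<tau> powr (s / 2)) * B))"
          by (rule mult_left_mono) simp
        moreover have "abs_inv_fourier (\<lambda>\<xi>. of_real (m \<tau> \<xi>) * F \<xi>) x = ennreal (?w \<tau>) * ?N"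
          unfolding m_def by (rule abs_inv_fourier_cmult) simp
        ultimately show ?thesis using True by (simp add: mult_ac)
      next
        case False
        then show ?thesis by (simp add: m_def abs_inv_fourier_def inv_fourier_def)
      qed
    qed
    also have "\<dots> = ennreal D * (\<integral>\<^sup>+\<tau>. indicator {0<..} \<tau> * ennreal (\<tau> powr (- (t / 2) - 1)) * min A (ennreal (\<tau> powr (s / 2)) * B) \<partial>lborel)"
      by (rule nn_integral_cmult) measurable
    also have "(\<integral>\<^sup>+\<tau>. indicator {0<..} \<tau> * ennreal (\<tau> powr (- (t / 2) - 1)) * min A (ennreal (\<tau> powr (s / 2)) * B) \<partial>lborel)
       = ennreal c4 * (ennpowr B (t / s) * ennpowr A (1 - t / s))"
    proof -
      have fin: "A < \<infinity>" "B < \<infinity>"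
        unfolding A_def B_def by (rule hlmax_funpow_abs_inv_fourier_finite[OF F], rule hlmax_funpow_abs_inv_fourier_finite[OF G])
      then obtain a b where ab: "A = ennreal a" "B = ennreal b" "0 \<le> a" "0 \<le> b"
        by (cases A; cases B) auto
      have ts: "0 < t / s" "0 < 1 - t / s" using t by (simp_all add: divide_less_eq_1)
      show ?thesis
      \<comment> \<open>If one bound is 0, the minimum vanishes identically, and so does the
        right-hand side, since both exponents are positive.\<close>
      proof (cases "a = 0 \<or> b = 0")
        case True
        then have "A = 0 \<or> B = 0" using ab by auto
        then have z: "min A (ennreal (\<tau> powr (s / 2)) * B) = 0" for \<tau> by (auto simp: min_def)
        have "ennpowr 0 (t / s) = 0" "ennpowr 0 (1 - t / s) = 0"
          using ts by (intro ennpowr_zero; linarith)+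
        then show ?thesis unfolding z using \<open>A = 0 \<or> B = 0\<close> by auto
      next
        case False
        then have ab': "0 < a" "0 < b" using ab by auto
        \<comment> \<open>Rescales \<tau> so that the two bounds meet at 1: A = \<tau> powr (s / 2)
          * B exactly when \<tau> * l = 1.\<close>
        define l where "l = (b / a) powr (2 / s)"
        have l: "0 < l" using ab' by (simp add: l_def)
        have "min A (ennreal (\<tau> powr (s / 2)) * B) = ennreal a * h4 (\<tau> * l)" if "0 < \<tau>" for \<tau>
        proof -
          have "(\<tau> * l) powr (s / 2) = \<tau> powr (s / 2) * (b / a)"
            using ab' s that by (simp add: l_def powr_mult powr_powr)
          then have "a * min 1 ((\<tau> * l) powr (s / 2)) = min a (\<tau> powr (s / 2) * b)"
            using ab' by (simp add: min_mult_distrib_left)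
          then have "ennreal a * h4 (\<tau> * l) = ennreal (min a (\<tau> powr (s / 2) * b))"
            using ab' by (simp add: h4_def ennreal_mult'[symmetric])
          also have "\<dots> = min A (ennreal (\<tau> powr (s / 2)) * B)"
            unfolding ab using ab' by (simp add: ennreal_mult'[symmetric] min_def)
          finally show ?thesis by simp
        qed
        then have "(\<integral>\<^sup>+\<tau>. indicator {0<..} \<tau> * ennreal (\<tau> powr (- (t / 2) - 1)) * min A (ennreal (\<tau> powr (s / 2)) * B) \<partial>lborel)
          = (\<integral>\<^sup>+\<tau>. ennreal a * (indicator {0<..} \<tau> * ennreal (\<tau> powr (- (t / 2) - 1)) * h4 (\<tau> * l)) \<partial>lborel)"
          by (intro nn_integral_cong) (auto simp: indicator_def mult_ac)
        also have "\<dots> = ennreal a * mellin (t / 2) (\<lambda>\<tau>. h4 (\<tau> * l))"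
          unfolding mellin_def by (rule nn_integral_cmult) measurable
        also have "\<dots> = ennreal a * (ennreal (l powr (t / 2)) * ennreal c4)"
          using l by (subst mellin_scale) (auto simp: c4)
        also have "l powr (t / 2) = (b / a) powr (t / s)"
          using s by (simp add: l_def powr_powr)
        also have "ennreal a * (ennreal ((b / a) powr (t / s)) * ennreal c4) = ennreal c4 * (ennreal (b powr (t / s)) * ennreal (a powr (1 - t / s)))"
        proof -
          have "a * ((b / a) powr (t / s) * c4) = c4 * (b powr (t / s) * a powr (1 - t / s))"
            using ab' by (simp add: powr_divide powr_diff)
          then show ?thesis using ab' c4 by (simp add: ennreal_mult'[symmetric])
        qed
        also have "\<dots> = ennreal c4 * (ennpowr B (t / s) * ennpowr A (1 - t / s))"
          unfolding ab using ab' by (simp add: ennpowr_ennreal_pos)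
        finally show ?thesis .
      qed
    qed
    finally have "ennreal (1 / c1) * (ennreal c1 * T) \<le> ennreal (1 / c1) * (ennreal D * (ennreal c4 * (ennpowr B (t / s) * ennpowr A (1 - t / s))))"
      by (rule mult_left_mono) simp
    moreover have "ennreal (1 / c1) * (ennreal c1 * T) = T"
      using c1 by (simp add: mult.assoc[symmetric] ennreal_mult[symmetric])
    moreover have "ennreal (1 / c1) * (ennreal D * (ennreal c4 * (ennpowr B (t / s) * ennpowr A (1 - t / s)))) = ennreal C * (ennpowr B (t / s) * ennpowr A (1 - t / s))"
      using c1 D c4 by (simp add: C_def mult.assoc[symmetric] ennreal_mult[symmetric])
    ultimately show ?thesis by (simp add: T_def A_def B_def)
  qed
  then show ?thesis using C by blast
qed

section \<open>Schwartz functions\<close>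

lemma iter_partial_append: "iter_partial as (iter_partial bs f) = iter_partial (as @ bs) f"
  by (induction as) auto

lemma schwartz_partial:
  assumes "f \<in> schwartz_space" "b \<in> Basis"
  shows "(\<lambda>x. frechet_derivative f (at x) b) \<in> schwartz_space"
proof -
  have "(\<lambda>x. frechet_derivative f (at x) b) = iter_partial [b] f" by simp
  then show ?thesis
    using assms unfolding schwartz_space_def by (simp only: mem_Collect_eq iter_partial_append) auto
qed

lemma schwartz_differentiable: "f \<in> schwartz_space \<Longrightarrow> f differentiable (at x)"
  unfolding schwartz_space_def by (drule CollectD, drule spec[of _ "[]"]) simp

lemma schwartz_decay: "f \<in> schwartz_space \<Longrightarrow> \<exists>M. \<forall>x. norm x ^ k * norm (f x) \<le> M"
  unfolding schwartz_space_def by (drule CollectD, drule spec[of _ "[]"]) simp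

lemma schwartz_continuous: "f \<in> schwartz_space \<Longrightarrow> continuous_on UNIV f"
  by (simp add: continuous_at_imp_continuous_on differentiable_imp_continuous_within schwartz_differentiable)

lemma schwartz_measurable: "f \<in> schwartz_space \<Longrightarrow> f \<in> borel_measurable borel"
  by (intro borel_measurable_continuous_onI schwartz_continuous)

text \<open>Common integrable majorant; d + 1 is the least integer exponent that makes it
  integrable.\<close>

definition decay :: "'a::euclidean_space \<Rightarrow> real" where
  "decay x = 1 / (1 + norm x) ^ (DIM('a) + 1)"

lemma one_plus_norm_power_pos: "0 < (1 + norm x) ^ n"
  by (intro zero_less_power) (simp add: add_pos_nonneg)

lemma decay_pos [simp]: "0 < decay x"
  by (simp add: decay_def add_pos_nonneg)

lemma measurable_decay [measurable]: "decay \<in> borel_measurable borel"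
  unfolding decay_def[abs_def] by measurable

lemma integrable_decay: "integrable lborel (decay :: 'a::euclidean_space \<Rightarrow> real)"
proof (rule integrableI_bounded)
  let ?d = "real DIM('a)"
  obtain C1 where C1: "\<And>R. R > 0 \<Longrightarrow> (\<integral>\<^sup>+y. ennreal (if norm (y::'a) \<le> R then norm y powr 0 else 0) \<partial>lborel) \<le> ennreal (C1 * R powr (0 + ?d))"
    using nn_integral_norm_powr_inside[where 'a='a, of 0] by auto
  obtain C2 where C2: "\<And>R. R > 0 \<Longrightarrow> (\<integral>\<^sup>+y. ennreal (if R \<le> norm (y::'a) then norm y powr (- ?d - 1) else 0) \<partial>lborel) \<le> ennreal (C2 * R powr (- ?d - 1 + ?d))"
    using nn_integral_norm_powr_outside[where 'a='a, of "- ?d - 1"] by auto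
  have "(\<integral>\<^sup>+x. ennreal (norm (decay (x::'a))) \<partial>lborel)
    \<le> (\<integral>\<^sup>+y. ennreal (if norm (y::'a) \<le> 1 then norm y powr 0 else 0) + ennreal (if 1 \<le> norm (y::'a) then norm y powr (- ?d - 1) else 0) \<partial>lborel)"
  proof (intro nn_integral_mono_AE, use AE_lborel_nonzero in eventually_elim)
    case (elim x)
    show ?case
    proof (cases "norm x \<le> 1")
      case True
      have "norm (decay x) \<le> 1"
        unfolding decay_def using one_plus_norm_power_pos[of x "DIM('a) + 1"] one_le_power[of "1 + norm x" "DIM('a) + 1"]
        by (simp del: power_Suc)
      then have "ennreal (norm (decay x)) \<le> ennreal 1" by (rule ennreal_leI)
      then show ?thesis using True elim by (simp add: add_increasing2)
    next
      case False
      have "decay x \<le> 1 / norm x ^ (DIM('a) + 1)"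
        unfolding decay_def using elim by (intro divide_left_mono power_mono) (auto simp: add_pos_nonneg)
      also have "\<dots> = norm x powr (- ?d - 1)"
        using elim by (simp add: powr_minus powr_diff powr_realpow inverse_eq_divide)
      finally show ?thesis using False by (simp add: ennreal_leI less_imp_le)
    qed
  qed
  also have "\<dots> \<le> ennreal (C1 * 1 powr (0 + ?d)) + ennreal (C2 * 1 powr (- ?d - 1 + ?d))"
    by (subst nn_integral_add) (auto intro!: add_mono C1[of 1, simplified] C2[of 1, simplified])
  also have "\<dots> < \<infinity>" by simp
  finally show "(\<integral>\<^sup>+x. ennreal (norm (decay (x::'a))) \<partial>lborel) < \<infinity>" .
qed measurable

text \<open>Serves to dominate difference quotients, since the mean value inequality evaluates the
  derivative at a point shifted by less than 1.\<close>

lemma decay_translate: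
  fixes x h :: "'a::euclidean_space"
  assumes "norm h \<le> 1"
  shows "decay (x + h) \<le> 2 ^ (DIM('a) + 1) * decay x"
proof -
  have "norm x \<le> norm (x + h) + norm h" using norm_triangle_ineq4[of "x + h" h] by simp
  then have "1 + norm x \<le> 2 * (1 + norm (x + h))" using assms by (smt (verit) norm_ge_zero)
  then have "(1 + norm x) ^ (DIM('a) + 1) \<le> (2 * (1 + norm (x + h))) ^ (DIM('a) + 1)"
    by (intro power_mono) auto
  then have "(1 + norm x) ^ (DIM('a) + 1) \<le> 2 ^ (DIM('a) + 1) * (1 + norm (x + h)) ^ (DIM('a) + 1)"
    by (simp only: power_mult_distrib)
  moreover have "0 < (1 + norm x) ^ (DIM('a) + 1)" "0 < (1 + norm (x + h)) ^ (DIM('a) + 1)"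
    by (rule one_plus_norm_power_pos)+
  ultimately show ?thesis
    unfolding decay_def by (simp add: field_simps del: power_Suc)
qed

text \<open>Starts from polynomial decay and not from \<open>schwartz_space\<close>, because it is
  applied to Fourier transforms too, for which only decay is established.\<close>

lemma power_decay_bound:
  fixes g :: "'a::euclidean_space \<Rightarrow> complex"
  assumes "\<And>k. \<exists>M. \<forall>x. norm x ^ k * norm (g x) \<le> M"
  shows "\<exists>M\<ge>0. \<forall>x. (1 + norm x) ^ j * norm (g x) \<le> M * decay x"
proof -
  let ?n = "j + (DIM('a) + 1)"
  obtain M0 where M0: "\<And>x. norm x ^ 0 * norm (g x) \<le> M0" using assms by blast
  obtain M1 where M1: "\<And>x. norm x ^ ?n * norm (g x) \<le> M1" using assms by blast
  define M where "M = 2 ^ ?n * (M0 + M1)"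
  have "0 \<le> norm (g 0)" "norm (g 0) \<le> M0" using M0[of 0] by auto
  then have nn: "0 \<le> M0" by linarith
  have "0 \<le> norm (0::'a) ^ ?n * norm (g 0)" by simp
  then have nn1: "0 \<le> M1" using M1[of 0] by linarith
  have "(1 + norm x) ^ ?n * norm (g x) \<le> M" for x
  proof -
    have "1 + norm x \<le> 2 * max 1 (norm x)" by simp
    then have "(1 + norm x) ^ ?n \<le> (2 * max 1 (norm x)) ^ ?n" by (intro power_mono) auto
    also have "\<dots> = 2 ^ ?n * max 1 (norm x) ^ ?n" by (simp only: power_mult_distrib)
    also have "max 1 (norm x) ^ ?n \<le> 1 + norm x ^ ?n"
      by (cases "1 \<le> norm x") (auto simp: max_def simp del: power_Suc)
    finally have "(1 + norm x) ^ ?n * norm (g x) \<le> 2 ^ ?n * (1 + norm x ^ ?n) * norm (g x)"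
      by (intro mult_right_mono) auto
    also have "\<dots> = 2 ^ ?n * (norm x ^ 0 * norm (g x) + norm x ^ ?n * norm (g x))"
      by (simp add: algebra_simps del: power_Suc)
    also have "\<dots> \<le> M" unfolding M_def by (intro mult_left_mono add_mono M0 M1) auto
    finally show ?thesis .
  qed
  then have "(1 + norm x) ^ j * norm (g x) \<le> M * decay x" for x
  proof -
    have "0 < (1 + norm x) ^ (DIM('a) + 1)" by (rule one_plus_norm_power_pos)
    moreover have "(1 + norm x) ^ j * norm (g x) * (1 + norm x) ^ (DIM('a) + 1) \<le> M"
      using \<open>(1 + norm x) ^ ?n * norm (g x) \<le> M\<close> by (simp only: power_add mult_ac)
    ultimately show ?thesis unfolding decay_def by (simp add: field_simps del: power_Suc)
  qed
  moreover have "0 \<le> M" using nn nn1 by (simp add: M_def)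
  ultimately show ?thesis by blast
qed

lemma schwartz_decay_bound:
  fixes f :: "'a::euclidean_space \<Rightarrow> complex"
  assumes "f \<in> schwartz_space"
  shows "\<exists>M\<ge>0. \<forall>x. norm (f x) \<le> M * decay x"
  using power_decay_bound[of f 0] schwartz_decay[OF assms] by simp

lemma integrable_decay_bound:
  fixes g :: "'a::euclidean_space \<Rightarrow> complex"
  assumes "g \<in> borel_measurable borel" "\<And>x. norm (g x) \<le> M * decay x"
  shows "integrable lborel g"
proof (rule Bochner_Integration.integrable_bound)
  show "integrable lborel (\<lambda>x::'a. M * decay x)" by (simp add: integrable_decay)
  have "norm (g x) \<le> norm (M * decay x)" for x using assms(2)[of x] by simp
  then show "AE x in lborel. norm (g x) \<le> norm (M * decay x)" by simp
qed (use assms in simp)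

lemma schwartz_integrable: "f \<in> schwartz_space \<Longrightarrow> integrable lborel f"
  using schwartz_decay_bound[of f] integrable_decay_bound schwartz_measurable by blast

lemma lborel_integral_affine:
  fixes g :: "'a::euclidean_space \<Rightarrow> complex"
  assumes [measurable]: "g \<in> borel_measurable borel" and c: "c \<noteq> 0"
  shows "(\<integral>x. g x \<partial>lborel) = of_real (\<bar>c\<bar> ^ DIM('a)) * (\<integral>x. g (t + c *\<^sub>R x) \<partial>lborel)"
  by (subst lborel_affine[OF c, of t]) (simp add: integral_density integral_distr scaleR_conv_of_real)

section \<open>Decay of the Fourier transform and the inversion formula\<close>

lemma measurable_fourier [measurable]:
  fixes f :: "'a::euclidean_space \<Rightarrow> complex"
  assumes [measurable]: "f \<in> borel_measurable borel"
  shows "fourier f \<in> borel_measurable borel"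
  unfolding fourier_def by measurable

lemma norm_exp_fourier [simp]: "norm (exp (- 2 * of_real pi * \<i> * complex_of_real r)) = 1"
  by (simp add: norm_exp_eq_Re)

lemma integrable_fourier_integrand:
  fixes f :: "'a::euclidean_space \<Rightarrow> complex"
  assumes f: "integrable lborel f"
  shows "integrable lborel (\<lambda>x. exp (- 2 * of_real pi * \<i> * of_real (x \<bullet> \<xi>)) * f x)"
proof (rule Bochner_Integration.integrable_bound[OF f])
  have [measurable]: "f \<in> borel_measurable borel" using f by auto
  show "(\<lambda>x. exp (- 2 * of_real pi * \<i> * of_real (x \<bullet> \<xi>)) * f x) \<in> borel_measurable lborel"
    by measurable
  show "AE x in lborel. norm (exp (- 2 * of_real pi * \<i> * of_real (x \<bullet> \<xi>)) * f x) \<le> norm (f x)"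
    by (simp only: norm_mult norm_exp_fourier) simp
qed

lemma fourier_translate:
  fixes f :: "'a::euclidean_space \<Rightarrow> complex"
  assumes [measurable]: "f \<in> borel_measurable borel"
  shows "(\<integral>x. exp (- 2 * of_real pi * \<i> * of_real (x \<bullet> \<xi>)) * f (x + h) \<partial>lborel)
    = exp (2 * of_real pi * \<i> * of_real (h \<bullet> \<xi>)) * fourier f \<xi>"
proof -
  have "fourier f \<xi> = (\<integral>x. exp (- 2 * of_real pi * \<i> * of_real ((h + x) \<bullet> \<xi>)) * f (h + x) \<partial>lborel)"
    unfolding fourier_def by (subst lborel_integral_affine[where c = 1 and t = h]) auto
  also have "\<dots> = (\<integral>x. exp (- 2 * of_real pi * \<i> * of_real (h \<bullet> \<xi>)) * (exp (- 2 * of_real pi * \<i> * of_real (x \<bullet> \<xi>)) * f (x + h)) \<partial>lborel)"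
    by (intro Bochner_Integration.integral_cong refl)
       (simp add: inner_add_left algebra_simps exp_add exp_diff exp_minus divide_inverse)
  also have "\<dots> = exp (- 2 * of_real pi * \<i> * of_real (h \<bullet> \<xi>)) * (\<integral>x. exp (- 2 * of_real pi * \<i> * of_real (x \<bullet> \<xi>)) * f (x + h) \<partial>lborel)"
    by (rule integral_mult_right_zero)
  finally show ?thesis by (simp add: mult.assoc[symmetric] mult_exp_exp)
qed

text \<open>Difference quotients in place of integration by parts: the transform turns a translation
  by h b into a phase, and dominated convergence allows h to tend to 0.\<close>

lemma fourier_partial:
  fixes f :: "'a::euclidean_space \<Rightarrow> complex"
  assumes f: "f \<in> schwartz_space" and b: "b \<in> Basis"
  shows "fourier (\<lambda>x. frechet_derivative f (at x) b) \<xi> = 2 * of_real pi * \<i> * of_real (b \<bullet> \<xi>) * fourier f \<xi>"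
proof -
  let ?g = "\<lambda>x. frechet_derivative f (at x) b"
  have g: "?g \<in> schwartz_space" by (rule schwartz_partial[OF f b])
  have [measurable]: "f \<in> borel_measurable borel" "?g \<in> borel_measurable borel"
    using f g by (simp_all add: schwartz_measurable)
  obtain M where M: "M \<ge> 0" "\<And>x. norm (?g x) \<le> M * decay x" using schwartz_decay_bound[OF g] by blast
  define h where "h = (\<lambda>n::nat. 1 / real (Suc n))"
  have h: "0 < h n" "h n \<le> 1" for n by (simp_all add: h_def)
  have h0: "h \<longlonglongrightarrow> 0" unfolding h_def by (rule LIMSEQ_Suc[OF lim_1_over_n])
  have deriv: "((\<lambda>u. f (x + u *\<^sub>R b)) has_derivative (\<lambda>v. v *\<^sub>R ?g (x + u *\<^sub>R b))) (at u)" for x u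
  proof -
    have fd: "(f has_derivative frechet_derivative f (at (x + u *\<^sub>R b))) (at (x + u *\<^sub>R b))"
      using schwartz_differentiable[OF f] frechet_derivative_works by blast
    have "((\<lambda>u. x + u *\<^sub>R b) has_derivative (\<lambda>v. v *\<^sub>R b)) (at u)"
      by (auto intro!: derivative_eq_intros)
    from has_derivative_compose[OF this fd]
    show ?thesis using linear_scale[OF has_derivative_linear[OF fd]] by simp
  qed
  define D where "D = (\<lambda>n x. (f (x + h n *\<^sub>R b) - f x) / of_real (h n))"
  have Dlim: "(\<lambda>n. D n x) \<longlonglongrightarrow> ?g x" for x
  proof -
    have "((\<lambda>u. (f (x + u *\<^sub>R b) - f x - u *\<^sub>R ?g x) /\<^sub>R \<bar>u\<bar>) \<longlongrightarrow> 0) (at 0)"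
      using deriv[of x 0] by (simp add: has_derivative_def)
    moreover have "filterlim h (at 0) sequentially"
      using h0 h(1) by (intro filterlim_atI always_eventually allI) (auto simp: less_imp_neq[symmetric])
    ultimately have "(\<lambda>n. (f (x + h n *\<^sub>R b) - f x - h n *\<^sub>R ?g x) /\<^sub>R \<bar>h n\<bar>) \<longlonglongrightarrow> 0"
      by (rule filterlim_compose)
    moreover have "(f (x + h n *\<^sub>R b) - f x - h n *\<^sub>R ?g x) /\<^sub>R \<bar>h n\<bar> = D n x - ?g x" for n
      using h(1)[of n] by (simp add: D_def scaleR_conv_of_real field_simps)
    ultimately have "(\<lambda>n. D n x - ?g x) \<longlonglongrightarrow> 0" by simp
    then show ?thesis by (rule LIM_zero_cancel)
  qed
  \<comment> \<open>The mean value inequality on the segment from x to x + h b, followed by the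
    translation bound for \<open>decay\<close>, gives a majorant independent of n.\<close>
  have Dbd: "norm (D n x) \<le> 2 ^ (DIM('a) + 1) * M * decay x" for n x
  proof -
    have "\<exists>u\<in>{0<..<h n}. norm (f (x + h n *\<^sub>R b) - f (x + 0 *\<^sub>R b)) \<le> norm ((h n - 0) *\<^sub>R ?g (x + u *\<^sub>R b))"
    proof (rule mvt_general[OF h(1), where f = "\<lambda>u. f (x + u *\<^sub>R b)" and f' = "\<lambda>u v. v *\<^sub>R ?g (x + u *\<^sub>R b)"])
      show "continuous_on {0..h n} (\<lambda>u. f (x + u *\<^sub>R b))"
        by (intro continuous_at_imp_continuous_on ballI has_derivative_continuous[OF deriv])
    qed (rule deriv)
    then obtain u where u: "0 < u" "u < h n" "norm (f (x + h n *\<^sub>R b) - f x) \<le> h n * norm (?g (x + u *\<^sub>R b))"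
      using h[of n] by auto
    have "norm (D n x) \<le> norm (?g (x + u *\<^sub>R b))"
      using u(3) h[of n] by (simp add: D_def norm_divide field_simps)
    also have "\<dots> \<le> M * decay (x + u *\<^sub>R b)" by (rule M)
    also have "\<dots> \<le> M * (2 ^ (DIM('a) + 1) * decay x)"
      using u h[of n] b M(1) by (intro mult_left_mono decay_translate) auto
    finally show ?thesis by (simp add: mult_ac)
  qed
  let ?e = "\<lambda>x. exp (- 2 * of_real pi * \<i> * complex_of_real (x \<bullet> \<xi>))"
  have L1: "(\<lambda>n. (\<integral>x. ?e x * D n x \<partial>lborel)) \<longlonglongrightarrow> fourier ?g \<xi>"
    unfolding fourier_def
  proof (rule integral_dominated_convergence[where w = "\<lambda>x. 2 ^ (DIM('a) + 1) * M * decay x"])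
    show "integrable lborel (\<lambda>x::'a. 2 ^ (DIM('a) + 1) * M * decay x)" by (simp add: integrable_decay)
    show "AE x in lborel. (\<lambda>n. ?e x * D n x) \<longlonglongrightarrow> ?e x * ?g x"
      by (intro AE_I2 tendsto_mult tendsto_const Dlim)
    show "AE x in lborel. norm (?e x * D n x) \<le> 2 ^ (DIM('a) + 1) * M * decay x" for n
      using Dbd by (simp only: norm_mult norm_exp_fourier) simp
    show "(\<lambda>x. ?e x * D n x) \<in> borel_measurable lborel" for n unfolding D_def by measurable
  qed measurable
  let ?w = "2 * of_real pi * \<i> * complex_of_real (b \<bullet> \<xi>)"
  have "(\<integral>x. ?e x * D n x \<partial>lborel) = (exp (of_real (h n) * ?w) - 1) / of_real (h n) * fourier f \<xi>" for n
  proof -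
    obtain M' where M': "M' \<ge> 0" "\<And>x. norm (f x) \<le> M' * decay x" using schwartz_decay_bound[OF f] by blast
    have i1: "integrable lborel (\<lambda>x. ?e x * f (x + h n *\<^sub>R b))"
    proof (rule Bochner_Integration.integrable_bound)
      show "integrable lborel (\<lambda>x::'a. 2 ^ (DIM('a) + 1) * M' * decay x)" by (simp add: integrable_decay)
      have "norm (?e x * f (x + h n *\<^sub>R b)) \<le> norm (2 ^ (DIM('a) + 1) * M' * decay x)" for x
      proof -
        have "norm (?e x * f (x + h n *\<^sub>R b)) \<le> M' * decay (x + h n *\<^sub>R b)"
          using M' by (simp only: norm_mult norm_exp_fourier) simp
        also have "\<dots> \<le> M' * (2 ^ (DIM('a) + 1) * decay x)"
          using h[of n] b M'(1) by (intro mult_left_mono decay_translate) auto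
        finally show ?thesis using M'(1) by (simp add: mult_ac abs_mult less_imp_le)
      qed
      then show "AE x in lborel. norm (?e x * f (x + h n *\<^sub>R b)) \<le> norm (2 ^ (DIM('a) + 1) * M' * decay x)" by simp
    qed measurable
    have i2: "integrable lborel (\<lambda>x. ?e x * f x)"
      by (rule integrable_fourier_integrand[OF schwartz_integrable[OF f]])
    have "(\<integral>x. ?e x * D n x \<partial>lborel) = (\<integral>x. (?e x * f (x + h n *\<^sub>R b) - ?e x * f x) / of_real (h n) \<partial>lborel)"
      by (intro Bochner_Integration.integral_cong refl) (simp only: D_def times_divide_eq_right right_diff_distrib)
    also have "\<dots> = ((\<integral>x. ?e x * f (x + h n *\<^sub>R b) \<partial>lborel) - (\<integral>x. ?e x * f x \<partial>lborel)) / of_real (h n)"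
      by (simp only: integral_divide_zero Bochner_Integration.integral_diff[OF i1 i2])
    also have "(\<integral>x. ?e x * f (x + h n *\<^sub>R b) \<partial>lborel) = exp (2 * of_real pi * \<i> * of_real ((h n *\<^sub>R b) \<bullet> \<xi>)) * fourier f \<xi>"
      by (rule fourier_translate) measurable
    also have "2 * of_real pi * \<i> * of_real ((h n *\<^sub>R b) \<bullet> \<xi>) = of_real (h n) * ?w" by simp
    also have "(\<integral>x. ?e x * f x \<partial>lborel) = fourier f \<xi>" by (simp only: fourier_def)
    finally show ?thesis by (simp add: algebra_simps diff_divide_distrib)
  qed
  moreover have "(\<lambda>n. (exp (of_real (h n) * ?w) - 1) / of_real (h n) * fourier f \<xi>) \<longlonglongrightarrow> ?w * fourier f \<xi>"
  proof (intro tendsto_mult tendsto_const)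
    have "((\<lambda>z. exp (z * ?w)) has_field_derivative ?w) (at 0)"
      by (auto intro!: derivative_eq_intros)
    then have "((\<lambda>z. (exp (z * ?w) - 1) / z) \<longlongrightarrow> ?w) (at 0)" by (simp add: DERIV_def)
    moreover have "filterlim (\<lambda>n. complex_of_real (h n)) (at 0) sequentially"
    proof (rule filterlim_atI)
      show "(\<lambda>n. complex_of_real (h n)) \<longlonglongrightarrow> 0" using tendsto_of_real[OF h0, where 'a=complex] by simp
      show "\<forall>\<^sub>F n in sequentially. complex_of_real (h n) \<noteq> 0" using h(1) by (intro always_eventually allI) (metis less_irrefl of_real_eq_0_iff)
    qed
    ultimately show "(\<lambda>n. (exp (of_real (h n) * ?w) - 1) / of_real (h n)) \<longlonglongrightarrow> ?w"
      by (rule filterlim_compose)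
  qed
  ultimately have "(\<lambda>n. (\<integral>x. ?e x * D n x \<partial>lborel)) \<longlonglongrightarrow> ?w * fourier f \<xi>" by simp
  with L1 show ?thesis by (rule LIMSEQ_unique)
qed

lemma fourier_bounded:
  fixes f :: "'a::euclidean_space \<Rightarrow> complex"
  assumes "f \<in> schwartz_space"
  shows "\<exists>M. \<forall>\<xi>. norm (fourier f \<xi>) \<le> M"
proof -
  have "norm (fourier f \<xi>) \<le> (\<integral>x. norm (f x) \<partial>lborel)" for \<xi>
    unfolding fourier_def
    by (rule order_trans[OF integral_norm_bound]) (simp only: norm_mult norm_exp_fourier mult_1 order_refl)
  then show ?thesis by blast
qed

text \<open>Each power of the coordinate is paid for by one partial derivative, which is a Schwartz
  function again.\<close>

lemma fourier_decay_coordinate: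
  fixes f :: "'a::euclidean_space \<Rightarrow> complex"
  assumes "f \<in> schwartz_space" "b \<in> Basis"
  shows "\<exists>M. \<forall>\<xi>. \<bar>\<xi> \<bullet> b\<bar> ^ k * norm (fourier f \<xi>) \<le> M"
  using assms(1)
proof (induction k arbitrary: f)
  case 0
  then show ?case using fourier_bounded[of f] by simp
next
  case (Suc k)
  obtain M where M: "\<And>\<xi>. \<bar>\<xi> \<bullet> b\<bar> ^ k * norm (fourier (\<lambda>x. frechet_derivative f (at x) b) \<xi>) \<le> M"
    using Suc.IH[OF schwartz_partial[OF Suc.prems assms(2)]] by blast
  have "\<bar>\<xi> \<bullet> b\<bar> ^ Suc k * norm (fourier f \<xi>) \<le> M / (2 * pi)" for \<xi>
  proof -
    have "norm (fourier (\<lambda>x. frechet_derivative f (at x) b) \<xi>) = 2 * pi * \<bar>\<xi> \<bullet> b\<bar> * norm (fourier f \<xi>)"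
      by (simp add: fourier_partial[OF Suc.prems assms(2)] norm_mult inner_commute)
    then show ?thesis using M[of \<xi>] by (simp add: field_simps)
  qed
  then show ?case by blast
qed

lemma fourier_decay:
  fixes f :: "'a::euclidean_space \<Rightarrow> complex"
  assumes f: "f \<in> schwartz_space"
  shows "\<exists>M. \<forall>\<xi>. norm \<xi> ^ k * norm (fourier f \<xi>) \<le> M"
proof -
  have "\<forall>b\<in>Basis. \<exists>M. \<forall>\<xi>. \<bar>\<xi> \<bullet> b\<bar> ^ k * norm (fourier f \<xi>) \<le> M"
    using fourier_decay_coordinate[OF f] by blast
  then obtain M where M: "\<And>b \<xi>. b \<in> Basis \<Longrightarrow> \<bar>\<xi> \<bullet> b\<bar> ^ k * norm (fourier f \<xi>) \<le> M b" by metis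
  have "norm \<xi> ^ k * norm (fourier f \<xi>) \<le> real DIM('a) ^ k * (\<Sum>b\<in>Basis. \<bar>M b\<bar>)" for \<xi>
  proof -
    \<comment> \<open>The largest coordinate controls the norm up to the factor d, so decay in every
      single coordinate is enough.\<close>
    define m where "m = Max ((\<lambda>b. \<bar>\<xi> \<bullet> b\<bar>) ` Basis)"
    have "m \<in> (\<lambda>b. \<bar>\<xi> \<bullet> b\<bar>) ` Basis" unfolding m_def by (intro Max_in) auto
    then obtain b where b: "b \<in> Basis" "m = \<bar>\<xi> \<bullet> b\<bar>" by auto
    have le: "\<bar>\<xi> \<bullet> c\<bar> \<le> m" if "c \<in> Basis" for c unfolding m_def using that by (intro Max_ge) auto
    have "norm \<xi> \<le> (\<Sum>c\<in>Basis. \<bar>\<xi> \<bullet> c\<bar>)" by (rule norm_le_l1)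
    also have "\<dots> \<le> (\<Sum>c\<in>(Basis::'a set). m)" by (intro sum_mono le)
    also have "\<dots> = real DIM('a) * m" by simp
    finally have "norm \<xi> ^ k * norm (fourier f \<xi>) \<le> (real DIM('a) * m) ^ k * norm (fourier f \<xi>)"
      by (intro mult_right_mono power_mono) auto
    also have "\<dots> = real DIM('a) ^ k * (\<bar>\<xi> \<bullet> b\<bar> ^ k * norm (fourier f \<xi>))" by (simp add: power_mult_distrib b)
    also have "\<dots> \<le> real DIM('a) ^ k * M b" by (intro mult_left_mono M b) auto
    also have "\<dots> \<le> real DIM('a) ^ k * (\<Sum>b\<in>Basis. \<bar>M b\<bar>)"
    proof (intro mult_left_mono)
      have "M b \<le> \<bar>M b\<bar>" by simp
      also have "\<dots> \<le> (\<Sum>b\<in>Basis. \<bar>M b\<bar>)" using b(1) by (intro member_le_sum) auto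
      finally show "M b \<le> (\<Sum>b\<in>Basis. \<bar>M b\<bar>)" .
    qed auto
    finally show ?thesis .
  qed
  then show ?thesis by blast
qed

lemma integrable_symbol_fourier:
  fixes f :: "'a::euclidean_space \<Rightarrow> complex"
  assumes f: "f \<in> schwartz_space" and \<kappa>: "0 \<le> \<kappa>" "\<kappa> \<le> 1" and a: "0 \<le> a"
  shows "integrable lborel (\<lambda>\<xi>. of_real (symbol \<kappa> \<xi> powr a) * fourier f \<xi>)"
proof -
  obtain j :: nat where j: "2 * a \<le> real j" using real_arch_simple by blast
  obtain M where M: "M \<ge> 0" "\<And>\<xi>. (1 + norm \<xi>) ^ j * norm (fourier f \<xi>) \<le> M * decay \<xi>"
    using power_decay_bound[of "fourier f" j] fourier_decay[OF f] by blast
  have [measurable]: "f \<in> borel_measurable borel" using f by (rule schwartz_measurable)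
  show ?thesis
  proof (rule integrable_decay_bound)
    fix \<xi> :: 'a
    \<comment> \<open>The assumption \<kappa> \<le> 1 enters here, giving a majorant common to both
      families.\<close>
    have "symbol \<kappa> \<xi> \<le> (1 + norm \<xi>)\<^sup>2" using \<kappa> norm_ge_zero[of \<xi>]
      by (simp only: symbol_def power2_sum power_one)
    then have "symbol \<kappa> \<xi> powr a \<le> ((1 + norm \<xi>)\<^sup>2) powr a" using \<kappa> a by (intro powr_mono2) auto
    also have "\<dots> = (1 + norm \<xi>) powr (2 * a)"
      by (simp add: powr_powr add_pos_nonneg flip: powr_numeral)
    also have "\<dots> \<le> (1 + norm \<xi>) powr real j" using j by (intro powr_mono) auto
    also have "\<dots> = (1 + norm \<xi>) ^ j" by (intro powr_realpow) (simp add: add_pos_nonneg)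
    finally have "norm (of_real (symbol \<kappa> \<xi> powr a) * fourier f \<xi>) \<le> (1 + norm \<xi>) ^ j * norm (fourier f \<xi>)"
      by (simp add: norm_mult mult_right_mono)
    also have "\<dots> \<le> M * decay \<xi>" by (rule M)
    finally show "norm (of_real (symbol \<kappa> \<xi> powr a) * fourier f \<xi>) \<le> M * decay \<xi>" .
  qed measurable
qed

lemma integrable_fourier:
  fixes f :: "'a::euclidean_space \<Rightarrow> complex"
  assumes f: "f \<in> schwartz_space"
  shows "integrable lborel (fourier f)"
proof -
  obtain M where M: "M \<ge> 0" "\<And>\<xi>. (1 + norm \<xi>) ^ 0 * norm (fourier f \<xi>) \<le> M * decay \<xi>"
    using power_decay_bound[of "fourier f" 0] fourier_decay[OF f] by blast
  show ?thesis
    using schwartz_measurable[OF f] M(2) by (intro integrable_decay_bound[of _ M]) auto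
qed

text \<open>Gaussian regularisation: with the factor exp (- \<tau> |\<xi>|^2) inserted, Fubini
  yields the convolution of f with a Gaussian, and \<tau> tends to 0 on both sides.\<close>

lemma fourier_inversion:
  fixes f :: "'a::euclidean_space \<Rightarrow> complex"
  assumes f: "f \<in> schwartz_space"
  shows "inv_fourier (fourier f) x = f x"
proof -
  have [measurable]: "f \<in> borel_measurable borel" using f by (rule schwartz_measurable)
  have fint: "integrable lborel f" by (rule schwartz_integrable[OF f])
  obtain M where M: "M \<ge> 0" "\<And>y. norm (f y) \<le> M * decay y" using schwartz_decay_bound[OF f] by blast
  have Mf: "norm (f y) \<le> M" for y
  proof -
    have "M * decay y \<le> M * 1" using M(1) by (intro mult_left_mono) (auto simp: decay_def one_plus_norm_power_pos divide_le_eq_1 one_le_power simp del: power_Suc)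
    then show ?thesis using M(2)[of y] by simp
  qed
  let ?e = "\<lambda>r. exp (2 * of_real pi * \<i> * complex_of_real r)"
  have smooth: "inv_fourier (\<lambda>\<xi>. of_real (exp (- (\<tau> * (norm \<xi>)\<^sup>2))) * fourier f \<xi>) x = (\<integral>y. of_real (gauss \<tau> (x - y)) * f y \<partial>lborel)"
    if \<tau>: "0 < \<tau>" for \<tau>
  proof -
    \<comment> \<open>Up to a constant, exp (- \<tau> |\<xi>|^2) is itself the Gaussian with
      parameter \<sigma>, so its inverse transform is known from
      \<open>gauss_fourier\<close>.\<close>
    define \<sigma> where "\<sigma> = pi\<^sup>2 / \<tau>"
    have \<sigma>: "0 < \<sigma>" using \<tau> by (simp add: \<sigma>_def)
    define c where "c = sqrt (pi / \<tau>) ^ DIM('a)"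
    have g1: "exp (- (\<tau> * (norm \<xi>)\<^sup>2)) = c * gauss \<sigma> \<xi>" for \<xi> :: 'a
    proof -
      have "sqrt (pi / \<tau>) * sqrt (pi / \<sigma>) = 1"
        using \<tau> by (simp add: \<sigma>_def real_sqrt_mult[symmetric] power2_eq_square)
      then have "c * sqrt (pi / \<sigma>) ^ DIM('a) = 1" unfolding c_def by (simp add: power_mult_distrib[symmetric])
      moreover have "pi\<^sup>2 * (norm \<xi>)\<^sup>2 / \<sigma> = \<tau> * (norm \<xi>)\<^sup>2" using \<tau> by (simp add: \<sigma>_def)
      ultimately show ?thesis by (simp add: gauss_eq mult.assoc[symmetric])
    qed
    have g2: "c * exp (- (\<sigma> * (norm z)\<^sup>2)) = gauss \<tau> z" for z :: 'a
      by (simp add: gauss_eq c_def \<sigma>_def)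
    have g3: "(\<integral>\<xi>. of_real (gauss \<sigma> \<xi>) * ?e (z \<bullet> \<xi>) \<partial>lborel) = of_real (exp (- (\<sigma> * (norm z)\<^sup>2)))" for z :: 'a
    proof -
      have "(\<integral>\<xi>. of_real (gauss \<sigma> \<xi>) * exp (- (2 * of_real pi * \<i> * complex_of_real (\<xi> \<bullet> (- z)))) \<partial>lborel) = of_real (exp (- (\<sigma> * (norm (- z))\<^sup>2)))"
        using gauss_fourier[OF \<sigma>, of "- z"] by (simp only: has_bochner_integral_iff)
      then show ?thesis by (simp add: inner_commute)
    qed
    have "inv_fourier (\<lambda>\<xi>. of_real (exp (- (\<tau> * (norm \<xi>)\<^sup>2))) * fourier f \<xi>) x
      = (\<integral>\<xi>. (\<integral>y. of_real c * (of_real (gauss \<sigma> \<xi>) * ?e ((x - y) \<bullet> \<xi>)) * f y \<partial>lborel) \<partial>lborel)"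
      unfolding inv_fourier_def
    proof (rule Bochner_Integration.integral_cong[OF refl])
      fix \<xi> :: 'a
      have "?e (x \<bullet> \<xi>) * (of_real (exp (- (\<tau> * (norm \<xi>)\<^sup>2))) * fourier f \<xi>)
        = (\<integral>y. (?e (x \<bullet> \<xi>) * of_real (exp (- (\<tau> * (norm \<xi>)\<^sup>2)))) * (exp (- 2 * of_real pi * \<i> * of_real (y \<bullet> \<xi>)) * f y) \<partial>lborel)"
        unfolding fourier_def by (simp only: integral_mult_right_zero mult.assoc)
      also have "\<dots> = (\<integral>y. of_real c * (of_real (gauss \<sigma> \<xi>) * ?e ((x - y) \<bullet> \<xi>)) * f y \<partial>lborel)"
      proof (rule Bochner_Integration.integral_cong[OF refl])
        fix y
        have e1: "?e (x \<bullet> \<xi>) * exp (- 2 * of_real pi * \<i> * of_real (y \<bullet> \<xi>)) = ?e ((x - y) \<bullet> \<xi>)"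
          by (simp add: mult_exp_exp inner_diff_left algebra_simps)
        have "(?e (x \<bullet> \<xi>) * of_real (exp (- (\<tau> * (norm \<xi>)\<^sup>2)))) * (exp (- 2 * of_real pi * \<i> * of_real (y \<bullet> \<xi>)) * f y)
          = (?e (x \<bullet> \<xi>) * exp (- 2 * of_real pi * \<i> * of_real (y \<bullet> \<xi>))) * of_real (exp (- (\<tau> * (norm \<xi>)\<^sup>2))) * f y"
          by (simp only: mult_ac)
        then show "(?e (x \<bullet> \<xi>) * of_real (exp (- (\<tau> * (norm \<xi>)\<^sup>2)))) * (exp (- 2 * of_real pi * \<i> * of_real (y \<bullet> \<xi>)) * f y)
          = of_real c * (of_real (gauss \<sigma> \<xi>) * ?e ((x - y) \<bullet> \<xi>)) * f y"
          unfolding e1 g1 of_real_mult by (simp only: mult_ac)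
      qed
      finally show "?e (x \<bullet> \<xi>) * (of_real (exp (- (\<tau> * (norm \<xi>)\<^sup>2))) * fourier f \<xi>) = \<dots>" .
    qed
    also have "\<dots> = (\<integral>y. (\<integral>\<xi>. of_real c * (of_real (gauss \<sigma> \<xi>) * ?e ((x - y) \<bullet> \<xi>)) * f y \<partial>lborel) \<partial>lborel)"
    proof (rule lborel_Fubini_complex)
      have "(\<integral>\<^sup>+\<xi>. (\<integral>\<^sup>+y. ennreal (norm (of_real c * (of_real (gauss \<sigma> \<xi>) * ?e ((x - y) \<bullet> \<xi>)) * f y)) \<partial>lborel) \<partial>lborel)
         = (\<integral>\<^sup>+\<xi>. (\<integral>\<^sup>+y. ennreal (\<bar>c\<bar> * gauss \<sigma> (\<xi>::'a)) * ennreal (norm (f y)) \<partial>lborel) \<partial>lborel)"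
        using \<sigma> by (intro nn_integral_cong) (simp add: norm_mult ennreal_mult)
      also have "\<dots> = (\<integral>\<^sup>+\<xi>. ennreal (\<bar>c\<bar> * gauss \<sigma> (\<xi>::'a)) \<partial>lborel) * (\<integral>\<^sup>+y. ennreal (norm (f y)) \<partial>lborel)"
        by (simp add: nn_integral_multc nn_integral_cmult)
      also have "\<dots> < \<infinity>"
      proof -
        have "(\<integral>\<^sup>+\<xi>. ennreal (\<bar>c\<bar> * gauss \<sigma> (\<xi>::'a)) \<partial>lborel) = ennreal \<bar>c\<bar> * (\<integral>\<^sup>+\<xi>. ennreal (gauss \<sigma> (\<xi>::'a)) \<partial>lborel)"
          using \<sigma> by (simp add: ennreal_mult nn_integral_cmult)
        then show ?thesis
          using fint integrable_gauss[OF \<sigma>, where 'a='a] \<sigma> by (auto simp: integrable_iff_bounded ennreal_mult_less_top)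
      qed
      finally show "(\<integral>\<^sup>+\<xi>. (\<integral>\<^sup>+y. ennreal (norm (of_real c * (of_real (gauss \<sigma> \<xi>) * ?e ((x - y) \<bullet> \<xi>)) * f y)) \<partial>lborel) \<partial>lborel) < \<infinity>" .
    qed measurable
    also have "\<dots> = (\<integral>y. of_real c * of_real (exp (- (\<sigma> * (norm (x - y))\<^sup>2))) * f y \<partial>lborel)"
      by (simp only: integral_mult_left_zero integral_mult_right_zero g3)
    also have "\<dots> = (\<integral>y. of_real (gauss \<tau> (x - y)) * f y \<partial>lborel)"
      by (simp only: of_real_mult[symmetric] g2)
    finally show ?thesis .
  qed
  define \<tau> where "\<tau> = (\<lambda>n::nat. 1 / real (Suc n))"
  have \<tau>: "0 < \<tau> n" for n by (simp add: \<tau>_def)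
  have \<tau>0: "\<tau> \<longlonglongrightarrow> 0" unfolding \<tau>_def by (rule LIMSEQ_Suc[OF lim_1_over_n])
  \<comment> \<open>After rescaling, the Gaussian is fixed and n occurs only in the argument of f,
    where continuity and boundedness of f allow dominated convergence.\<close>
  have resc: "(\<integral>y. of_real (gauss (\<tau> n) (x - y)) * f y \<partial>lborel) = (\<integral>w. of_real (gauss 1 w) * f (x - sqrt (\<tau> n) *\<^sub>R w) \<partial>lborel)" for n
  proof -
    define s where "s = sqrt (\<tau> n)"
    have s: "0 < s" "s\<^sup>2 = \<tau> n" using \<tau>[of n] by (simp_all add: s_def)
    have "(\<integral>y. of_real (gauss (\<tau> n) (x - y)) * f y \<partial>lborel)
       = of_real (\<bar>- s\<bar> ^ DIM('a)) * (\<integral>w. of_real (gauss (\<tau> n) (x - (x + (- s) *\<^sub>R w))) * f (x + (- s) *\<^sub>R w) \<partial>lborel)"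
      using s by (intro lborel_integral_affine) auto
    also have "\<dots> = (\<integral>w. of_real (\<bar>- s\<bar> ^ DIM('a)) * (of_real (gauss (\<tau> n) (x - (x + (- s) *\<^sub>R w))) * f (x + (- s) *\<^sub>R w)) \<partial>lborel)"
      by (rule integral_mult_right_zero[symmetric])
    also have "\<dots> = (\<integral>w. of_real (gauss 1 w) * f (x - s *\<^sub>R w) \<partial>lborel)"
    proof (rule Bochner_Integration.integral_cong[OF refl])
      fix w :: 'a
      have "\<bar>- s\<bar> ^ DIM('a) * gauss (\<tau> n) (x - (x + (- s) *\<^sub>R w)) = gauss 1 w"
      proof -
        have "s * sqrt (pi / \<tau> n) = sqrt pi" using s by (simp add: s(2)[symmetric] real_sqrt_divide)
        then have "s ^ DIM('a) * sqrt (pi / \<tau> n) ^ DIM('a) = sqrt pi ^ DIM('a)"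
          by (simp only: power_mult_distrib[symmetric])
        then show ?thesis using s \<tau>[of n] by (simp add: gauss_eq power_mult_distrib mult.assoc[symmetric])
      qed
      then show "of_real (\<bar>- s\<bar> ^ DIM('a)) * (of_real (gauss (\<tau> n) (x - (x + (- s) *\<^sub>R w))) * f (x + (- s) *\<^sub>R w)) = of_real (gauss 1 w) * f (x - s *\<^sub>R w)"
        by (simp only: mult.assoc[symmetric] of_real_mult[symmetric]) simp
    qed
    finally show ?thesis by (simp add: s_def)
  qed
  have "(\<lambda>n. (\<integral>w. of_real (gauss 1 w) * f (x - sqrt (\<tau> n) *\<^sub>R w) \<partial>lborel)) \<longlonglongrightarrow> (\<integral>w. of_real (gauss 1 (w::'a)) * f x \<partial>lborel)"
  proof (rule integral_dominated_convergence[where w = "\<lambda>w. gauss 1 w * M"])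
    show "integrable lborel (\<lambda>w::'a. gauss 1 w * M)" using integrable_gauss[of 1, where 'a='a] by simp
    show "AE w in lborel. (\<lambda>n. of_real (gauss 1 w) * f (x - sqrt (\<tau> n) *\<^sub>R w)) \<longlonglongrightarrow> of_real (gauss 1 w) * f x"
    proof (intro AE_I2 tendsto_mult tendsto_const)
      fix w :: 'a
      have "(\<lambda>n. x - sqrt (\<tau> n) *\<^sub>R w) \<longlonglongrightarrow> x - sqrt 0 *\<^sub>R w"
        by (intro tendsto_intros \<tau>0)
      then have *: "(\<lambda>n. x - sqrt (\<tau> n) *\<^sub>R w) \<longlonglongrightarrow> x" by simp
      have "isCont f x" using schwartz_differentiable[OF f] by (rule differentiable_imp_continuous_within)
      then show "(\<lambda>n. f (x - sqrt (\<tau> n) *\<^sub>R w)) \<longlonglongrightarrow> f x" using * by (rule isCont_tendsto_compose)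
    qed
    show "AE w in lborel. norm (of_real (gauss 1 w) * f (x - sqrt (\<tau> n) *\<^sub>R w)) \<le> gauss 1 w * M" for n
      using Mf by (intro AE_I2) (simp add: norm_mult mult_left_mono)
  qed measurable
  moreover have "(\<integral>w. of_real (gauss 1 (w::'a)) * f x \<partial>lborel) = f x"
    using integral_gauss[of 1, where 'a='a] by (simp only: integral_mult_left_zero integral_complex_of_real) simp
  ultimately have lim1: "(\<lambda>n. inv_fourier (\<lambda>\<xi>. of_real (exp (- (\<tau> n * (norm \<xi>)\<^sup>2))) * fourier f \<xi>) x) \<longlonglongrightarrow> f x"
    by (simp only: smooth[OF \<tau>] resc)
  have "(\<lambda>n. inv_fourier (\<lambda>\<xi>. of_real (exp (- (\<tau> n * (norm \<xi>)\<^sup>2))) * fourier f \<xi>) x) \<longlonglongrightarrow> inv_fourier (fourier f) x"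
    unfolding inv_fourier_def
  proof (rule integral_dominated_convergence[where w = "\<lambda>\<xi>. norm (fourier f \<xi>)"])
    show "integrable lborel (\<lambda>\<xi>. norm (fourier f \<xi>))" using integrable_fourier[OF f] by simp
    show "AE \<xi> in lborel. (\<lambda>n. ?e (x \<bullet> \<xi>) * (of_real (exp (- (\<tau> n * (norm \<xi>)\<^sup>2))) * fourier f \<xi>)) \<longlonglongrightarrow> ?e (x \<bullet> \<xi>) * fourier f \<xi>"
    proof (intro AE_I2)
      fix \<xi> :: 'a
      have "(\<lambda>n. exp (- (\<tau> n * (norm \<xi>)\<^sup>2))) \<longlonglongrightarrow> exp (- (0 * (norm \<xi>)\<^sup>2))"
        by (intro tendsto_intros \<tau>0)
      then have "(\<lambda>n. complex_of_real (exp (- (\<tau> n * (norm \<xi>)\<^sup>2)))) \<longlonglongrightarrow> complex_of_real 1"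
        by (intro tendsto_of_real) simp
      from tendsto_mult[OF tendsto_const tendsto_mult[OF this tendsto_const]]
      show "(\<lambda>n. ?e (x \<bullet> \<xi>) * (of_real (exp (- (\<tau> n * (norm \<xi>)\<^sup>2))) * fourier f \<xi>)) \<longlonglongrightarrow> ?e (x \<bullet> \<xi>) * fourier f \<xi>" by simp
    qed
    show "AE \<xi> in lborel. norm (?e (x \<bullet> \<xi>) * (of_real (exp (- (\<tau> n * (norm \<xi>)\<^sup>2))) * fourier f \<xi>)) \<le> norm (fourier f \<xi>)" for n
      using \<tau>[of n] by (intro AE_I2) (simp add: norm_mult mult_left_le_one_le)
  qed measurable
  from LIMSEQ_unique[OF this lim1] show ?thesis .
qed

section \<open>The Stein--Weiss inequality\<close>

lemma measurable_gauss_pair [measurable (raw)]: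
  fixes f :: "'b \<Rightarrow> 'a::euclidean_space"
  assumes [measurable]: "f \<in> borel_measurable M" "\<tau> \<in> borel_measurable M"
  shows "(\<lambda>x. gauss (\<tau> x) (f x)) \<in> borel_measurable M"
  unfolding gauss_eq by measurable

text \<open>Subordination of the Riesz kernel to heat kernels. With b = (d - e) / 2 the dependence
  on z is the scaling of a Mellin transform by 1 / |z|^2. It converges at infinity because e < d
  makes b positive, and at 0 because exp (- pi^2 / v) vanishes there to every order.\<close>

lemma riesz_kernel_integral:
  assumes e: "0 < e" "e < real DIM('a::euclidean_space)"
  shows "\<exists>C>0. \<forall>z::'a. z \<noteq> 0 \<longrightarrow> (\<integral>\<^sup>+\<rho>. indicator {0<..} \<rho> * ennreal (\<rho> powr (e / 2 - 1)) * ennreal (gauss \<rho> z) \<partial>lborel)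
    \<le> ennreal (C * norm z powr (e - real DIM('a)))"
proof -
  let ?d = "real DIM('a)"
  define b where "b = (?d - e) / 2"
  have b: "0 < b" using e by (simp add: b_def)
  obtain N :: nat where N: "b < real N" using reals_Archimedean2 by blast
  define h where "h = (\<lambda>v::real. ennreal (exp (- (pi\<^sup>2 / v))))"
  have [measurable]: "h \<in> borel_measurable borel" unfolding h_def by measurable
  have "mellin b h < \<infinity>"
  proof (rule mellin_finite[where K = "fact N" and ?c1.0 = "real N" and ?c2.0 = 0])
    show "h v \<le> ennreal (fact N * v powr real N)" if v: "0 < v" "v \<le> 1" for v
    proof -
      define u where "u = pi\<^sup>2 / v"
      have "1 \<le> pi\<^sup>2" using pi_ge_two by (intro one_le_power) auto
      then have u: "0 < u" "1 / v \<le> u" using v by (auto simp: u_def field_simps)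
      have "(1 / v) ^ N * exp (- u) \<le> u ^ N * exp (- u)" using v u by (intro mult_right_mono power_mono) auto
      also have "\<dots> \<le> fact N" using u by (intro power_exp_bound) auto
      finally have "exp (- u) \<le> fact N * v ^ N" using v by (simp add: power_one_over field_simps)
      then show ?thesis using v unfolding h_def u_def by (intro ennreal_leI) (simp add: powr_realpow)
    qed
    show "h v \<le> ennreal (fact N * v powr 0)" if v: "1 \<le> v" for v
    proof -
      have "exp (- (pi\<^sup>2 / v)) \<le> 1" using v by simp
      also have "1 \<le> fact N * v powr 0" using v fact_ge_1[of N] by simp
      finally show ?thesis unfolding h_def by (rule ennreal_leI)
    qed
  qed (use b N in auto)
  moreover have "0 < mellin b h" by (rule mellin_pos) (auto simp: h_def)
  ultimately obtain c where c: "0 < c" "mellin b h = ennreal c" by (rule ennreal_positive_finite)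
  define C where "C = sqrt pi ^ DIM('a) * c"
  have C: "0 < C" using c by (simp add: C_def)
  have "(\<integral>\<^sup>+\<rho>. indicator {0<..} \<rho> * ennreal (\<rho> powr (e / 2 - 1)) * ennreal (gauss \<rho> z) \<partial>lborel)
    \<le> ennreal (C * norm z powr (e - ?d))" if z: "z \<noteq> 0" for z :: 'a
  proof -
    define a where "a = 1 / (norm z)\<^sup>2"
    have a: "0 < a" using z by (simp add: a_def)
    have "(\<integral>\<^sup>+\<rho>. indicator {0<..} \<rho> * ennreal (\<rho> powr (e / 2 - 1)) * ennreal (gauss \<rho> z) \<partial>lborel)
      = (\<integral>\<^sup>+\<rho>. ennreal (sqrt pi ^ DIM('a)) * (indicator {0<..} \<rho> * ennreal (\<rho> powr (- b - 1)) * h (\<rho> * a)) \<partial>lborel)"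
    proof (rule nn_integral_cong)
      fix \<rho> :: real
      show "indicator {0<..} \<rho> * ennreal (\<rho> powr (e / 2 - 1)) * ennreal (gauss \<rho> z)
        = ennreal (sqrt pi ^ DIM('a)) * (indicator {0<..} \<rho> * ennreal (\<rho> powr (- b - 1)) * h (\<rho> * a))"
      proof (cases "0 < \<rho>")
        case True
        have q1: "sqrt (pi / \<rho>) ^ DIM('a) = sqrt pi ^ DIM('a) * \<rho> powr (- (?d / 2))"
        proof -
          have "sqrt \<rho> ^ DIM('a) = (\<rho> powr (1 / 2)) powr ?d"
            using True by (simp add: powr_half_sqrt powr_realpow)
          also have "\<dots> = \<rho> powr (?d / 2)" by (simp add: powr_powr)
          finally have "sqrt \<rho> ^ DIM('a) = \<rho> powr (?d / 2)" .
          then show ?thesis by (simp add: real_sqrt_divide power_divide powr_minus_divide)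
        qed
        have q2: "\<rho> powr (e / 2 - 1) * \<rho> powr (- (?d / 2)) = \<rho> powr (- b - 1)"
        proof -
          have "e / 2 - 1 + - (?d / 2) = - b - 1" by (simp add: b_def field_simps)
          then show ?thesis by (simp only: powr_add[symmetric])
        qed
        have q3: "pi\<^sup>2 * (norm z)\<^sup>2 / \<rho> = pi\<^sup>2 / (\<rho> * a)" by (simp add: a_def)
        have "\<rho> powr (e / 2 - 1) * gauss \<rho> z = sqrt pi ^ DIM('a) * (\<rho> powr (- b - 1) * exp (- (pi\<^sup>2 / (\<rho> * a))))"
          unfolding gauss_eq q1 q3 q2[symmetric] by (simp only: mult_ac)
        then have "ennreal (\<rho> powr (e / 2 - 1)) * ennreal (gauss \<rho> z) = ennreal (sqrt pi ^ DIM('a)) * (ennreal (\<rho> powr (- b - 1)) * h (\<rho> * a))"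
          using True by (simp add: h_def ennreal_mult[symmetric])
        then show ?thesis using True by simp
      qed simp
    qed
    also have "\<dots> = ennreal (sqrt pi ^ DIM('a)) * mellin b (\<lambda>\<rho>. h (\<rho> * a))"
      unfolding mellin_def by (rule nn_integral_cmult) measurable
    also have "\<dots> = ennreal (sqrt pi ^ DIM('a)) * (ennreal (a powr b) * ennreal c)"
      using a by (subst mellin_scale) (auto simp: c)
    also have "a powr b = norm z powr (e - ?d)"
    proof -
      have "a = norm z powr (- 2)" using z by (simp add: a_def powr_minus divide_inverse flip: powr_numeral)
      moreover have "- 2 * b = e - ?d" by (simp add: b_def field_simps)
      ultimately show ?thesis by (simp only: powr_powr)
    qed
    also have "ennreal (sqrt pi ^ DIM('a)) * (ennreal (norm z powr (e - ?d)) * ennreal c) = ennreal (C * norm z powr (e - ?d))"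
      using c by (simp add: C_def ennreal_mult[symmetric] mult_ac)
    finally show ?thesis by simp
  qed
  then show ?thesis using C by blast
qed

text \<open>For 0 < e < d, the Riesz potential of order e up to its normalising constant.\<close>

definition riesz :: "real \<Rightarrow> ('a::euclidean_space \<Rightarrow> ennreal) \<Rightarrow> 'a \<Rightarrow> ennreal" where
  "riesz e u x = (\<integral>\<^sup>+y. ennreal (dist x y powr (e - real DIM('a))) * u y \<partial>lborel)"

lemma measurable_riesz [measurable]:
  fixes u :: "'a::euclidean_space \<Rightarrow> ennreal"
  assumes [measurable]: "u \<in> borel_measurable borel"
  shows "riesz e u \<in> borel_measurable borel"
  unfolding riesz_def[abs_def] by measurable

text \<open>The power symbol powr (- e / 2) is a positive superposition of heat multipliers, whose
  kernels are bounded by the Gaussians for every \<kappa> \<ge> 0; for \<kappa> = 1 this is the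
  comparison of the Bessel kernel with the Riesz kernel. Both sides act on a common F, so that in
  the application only nonnegative powers meet the transform of f.\<close>

lemma negative_power_le_riesz:
  assumes e: "0 < e" "e < real DIM('a::euclidean_space)"
  shows "\<exists>C>0. \<forall>\<kappa>\<ge>0. \<forall>a. \<forall>F::'a \<Rightarrow> complex. F \<in> borel_measurable borel \<longrightarrow>
    integrable lborel (\<lambda>\<xi>. of_real (symbol \<kappa> \<xi> powr a) * F \<xi>) \<longrightarrow>
    integrable lborel (\<lambda>\<xi>. of_real (symbol \<kappa> \<xi> powr (a + e / 2)) * F \<xi>) \<longrightarrow>
    (\<forall>x. abs_inv_fourier (\<lambda>\<xi>. of_real (symbol \<kappa> \<xi> powr a) * F \<xi>) x
      \<le> ennreal C * riesz e (abs_inv_fourier (\<lambda>\<xi>. of_real (symbol \<kappa> \<xi> powr (a + e / 2)) * F \<xi>)) x)"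
proof -
  let ?d = "real DIM('a)"
  obtain CK where CK: "CK > 0" "\<And>z::'a. z \<noteq> 0 \<Longrightarrow> (\<integral>\<^sup>+\<rho>. indicator {0<..} \<rho> * ennreal (\<rho> powr (e / 2 - 1)) * ennreal (gauss \<rho> z) \<partial>lborel)
    \<le> ennreal (CK * norm z powr (e - ?d))"
    using riesz_kernel_integral[OF e] by blast
  obtain N :: nat where N: "e / 2 < real N" using reals_Archimedean2 by blast
  define h where "h = (\<lambda>v::real. ennreal (exp (- v)))"
  have [measurable]: "h \<in> borel_measurable borel" unfolding h_def by measurable
  have "mellin (- (e / 2)) h < \<infinity>"
  proof (rule mellin_finite[where K = "fact N" and ?c1.0 = 0 and ?c2.0 = "- real N"])
    show "h v \<le> ennreal (fact N * v powr 0)" if v: "0 < v" "v \<le> 1" for v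
    proof -
      have "exp (- v) \<le> 1" using v by simp
      also have "1 \<le> fact N * v powr 0" using v fact_ge_1[of N] by simp
      finally show ?thesis unfolding h_def by (rule ennreal_leI)
    qed
    show "h v \<le> ennreal (fact N * v powr (- real N))" if v: "1 \<le> v" for v
    proof -
      have "v ^ N * exp (- v) \<le> fact N" using v by (intro power_exp_bound) auto
      then have "exp (- v) \<le> fact N * v powr (- real N)" using v by (simp add: powr_minus powr_realpow field_simps)
      then show ?thesis unfolding h_def by (rule ennreal_leI)
    qed
  qed (use e N in auto)
  moreover have "0 < mellin (- (e / 2)) h" by (rule mellin_pos) (auto simp: h_def)
  ultimately obtain c where c: "0 < c" "mellin (- (e / 2)) h = ennreal c" by (rule ennreal_positive_finite)
  define C where "C = CK / c"
  have C: "0 < C" using c CK by (simp add: C_def)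
  have "abs_inv_fourier (\<lambda>\<xi>. of_real (symbol \<kappa> \<xi> powr a) * F \<xi>) x
      \<le> ennreal C * riesz e (abs_inv_fourier (\<lambda>\<xi>. of_real (symbol \<kappa> \<xi> powr (a + e / 2)) * F \<xi>)) x"
    if \<kappa>: "0 \<le> \<kappa>" and [measurable]: "F \<in> borel_measurable borel"
      and Fa: "integrable lborel (\<lambda>\<xi>. of_real (symbol \<kappa> \<xi> powr a) * F \<xi>)"
      and G': "integrable lborel (\<lambda>\<xi>. of_real (symbol \<kappa> \<xi> powr (a + e / 2)) * F \<xi>)" for \<kappa> a x and F :: "'a \<Rightarrow> complex"
  proof -
    define G where "G = (\<lambda>\<xi>. of_real (symbol \<kappa> \<xi> powr (a + e / 2)) * F \<xi>)"
    have G: "integrable lborel G" using G' by (simp add: G_def)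
    have [measurable]: "G \<in> borel_measurable borel" unfolding G_def by measurable
    let ?w = "\<lambda>\<rho>. indicator {0<..} \<rho> * \<rho> powr (- (- (e / 2)) - 1) :: real"
    define m where "m = (\<lambda>\<rho> \<xi>. ?w \<rho> * exp (- (\<rho> * symbol \<kappa> (\<xi>::'a))))"
    define M where "M = (\<lambda>\<xi>::'a. c * symbol \<kappa> \<xi> powr (- (e / 2)))"
    have [measurable]: "case_prod m \<in> borel_measurable (borel \<Otimes>\<^sub>M borel)" "M \<in> borel_measurable borel"
      unfolding m_def M_def by measurable
    have MF: "AE \<xi> in lborel. of_real (M \<xi>) * G \<xi> = of_real (c * symbol \<kappa> \<xi> powr a) * F \<xi>"
      using AE_lborel_nonzero
    proof eventually_elim
      case (elim \<xi>)
      have "symbol \<kappa> \<xi> powr (- (e / 2)) * symbol \<kappa> \<xi> powr (a + e / 2) = symbol \<kappa> \<xi> powr a"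
        by (simp add: powr_add[symmetric])
      then have "of_real (symbol \<kappa> \<xi> powr (- (e / 2))) * complex_of_real (symbol \<kappa> \<xi> powr (a + e / 2)) = of_real (symbol \<kappa> \<xi> powr a)"
        by (metis of_real_mult)
      then show ?case by (simp add: M_def G_def mult_ac)
    qed
    have intM: "integrable lborel (\<lambda>\<xi>. of_real (c * symbol \<kappa> \<xi> powr a) * F \<xi>)"
      using Fa by (simp add: mult.assoc)
    have "ennreal c * abs_inv_fourier (\<lambda>\<xi>. of_real (symbol \<kappa> \<xi> powr a) * F \<xi>) x = abs_inv_fourier (\<lambda>\<xi>. of_real (c * symbol \<kappa> \<xi> powr a) * F \<xi>) x"
      using c by (subst abs_inv_fourier_cmult) auto
    also have "\<dots> = abs_inv_fourier (\<lambda>\<xi>. of_real (M \<xi>) * G \<xi>) x"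
      unfolding abs_inv_fourier_def by (subst inv_fourier_cong_AE[OF _ _ MF]) measurable
    also have "\<dots> \<le> (\<integral>\<^sup>+\<rho>. abs_inv_fourier (\<lambda>\<xi>. of_real (m \<rho> \<xi>) * G \<xi>) x \<partial>lborel)"
    proof (rule inv_fourier_superpose)
      show "0 \<le> m \<rho> \<xi>" for \<rho> \<xi> by (simp add: m_def)
      show "0 \<le> M \<xi>" for \<xi> using c by (simp add: M_def)
      fix \<xi> :: 'a assume \<xi>: "\<xi> \<noteq> 0"
      have "(\<integral>\<^sup>+\<rho>. ennreal (m \<rho> \<xi>) \<partial>lborel) = mellin (- (e / 2)) (\<lambda>\<rho>. h (\<rho> * symbol \<kappa> \<xi>))"
        unfolding mellin_def
        by (intro nn_integral_cong) (simp add: m_def h_def ennreal_mult indicator_def)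
      also have "\<dots> = ennreal (M \<xi>)"
        using symbol_pos[OF \<kappa> \<xi>] c by (subst mellin_scale) (auto simp: M_def ennreal_mult mult.commute)
      finally show "(\<integral>\<^sup>+\<rho>. ennreal (m \<rho> \<xi>) \<partial>lborel) = ennreal (M \<xi>)" .
    next
      show "integrable lborel (\<lambda>\<xi>. of_real (M \<xi>) * G \<xi>)"
        by (rule integrable_cong_AE_imp[OF intM]) (use MF in \<open>auto elim: eventually_mono\<close>)
    qed measurable
    also have "\<dots> \<le> (\<integral>\<^sup>+\<rho>. (\<integral>\<^sup>+y. indicator {0<..} \<rho> * ennreal (\<rho> powr (e / 2 - 1)) * ennreal (gauss \<rho> (x - y)) * abs_inv_fourier G y \<partial>lborel) \<partial>lborel)"
    proof (rule nn_integral_mono)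
      fix \<rho> :: real
      show "abs_inv_fourier (\<lambda>\<xi>. of_real (m \<rho> \<xi>) * G \<xi>) x
         \<le> (\<integral>\<^sup>+y. indicator {0<..} \<rho> * ennreal (\<rho> powr (e / 2 - 1)) * ennreal (gauss \<rho> (x - y)) * abs_inv_fourier G y \<partial>lborel)"
      proof (cases "0 < \<rho>")
        case True
        have "abs_inv_fourier (\<lambda>\<xi>. of_real (m \<rho> \<xi>) * G \<xi>) x = ennreal (?w \<rho>) * abs_inv_fourier (\<lambda>\<xi>. of_real (exp (- (\<rho> * symbol \<kappa> \<xi>))) * G \<xi>) x"
          unfolding m_def by (rule abs_inv_fourier_cmult) simp
        also have "\<dots> \<le> ennreal (?w \<rho>) * (\<integral>\<^sup>+y. ennreal (gauss \<rho> (x - y)) * abs_inv_fourier G y \<partial>lborel)"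
          by (intro mult_left_mono heat_le_convolution True \<kappa> G) auto
        also have "\<dots> = (\<integral>\<^sup>+y. ennreal (?w \<rho>) * (ennreal (gauss \<rho> (x - y)) * abs_inv_fourier G y) \<partial>lborel)"
          by (rule nn_integral_cmult[symmetric]) measurable
        finally show ?thesis using True by (simp add: mult.assoc)
      next
        case False
        then show ?thesis by (simp add: m_def abs_inv_fourier_def inv_fourier_def)
      qed
    qed
    also have "\<dots> = (\<integral>\<^sup>+y. (\<integral>\<^sup>+\<rho>. indicator {0<..} \<rho> * ennreal (\<rho> powr (e / 2 - 1)) * ennreal (gauss \<rho> (x - y)) * abs_inv_fourier G y \<partial>lborel) \<partial>lborel)"
      by (rule lborel_nn_integral_swap) measurable
    also have "\<dots> \<le> (\<integral>\<^sup>+y. ennreal CK * (ennreal (dist x y powr (e - ?d)) * abs_inv_fourier G y) \<partial>lborel)"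
    proof (intro nn_integral_mono_AE, use AE_lborel_singleton[of x] in eventually_elim)
      case (elim y)
      have "(\<integral>\<^sup>+\<rho>. indicator {0<..} \<rho> * ennreal (\<rho> powr (e / 2 - 1)) * ennreal (gauss \<rho> (x - y)) * abs_inv_fourier G y \<partial>lborel)
        = (\<integral>\<^sup>+\<rho>. indicator {0<..} \<rho> * ennreal (\<rho> powr (e / 2 - 1)) * ennreal (gauss \<rho> (x - y)) \<partial>lborel) * abs_inv_fourier G y"
        by (rule nn_integral_multc) measurable
      also have "\<dots> \<le> ennreal (CK * norm (x - y) powr (e - ?d)) * abs_inv_fourier G y"
        using elim by (intro mult_right_mono CK) auto
      finally show ?case using CK(1) by (simp add: dist_norm ennreal_mult mult.assoc)
    qed
    also have "\<dots> = ennreal CK * riesz e (abs_inv_fourier G) x"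
      unfolding riesz_def by (rule nn_integral_cmult) measurable
    finally have "ennreal (1 / c) * (ennreal c * abs_inv_fourier (\<lambda>\<xi>. of_real (symbol \<kappa> \<xi> powr a) * F \<xi>) x) \<le> ennreal (1 / c) * (ennreal CK * riesz e (abs_inv_fourier G) x)"
      by (rule mult_left_mono) simp
    then show ?thesis using c CK(1)
      by (simp add: mult.assoc[symmetric] ennreal_mult[symmetric]) (simp add: C_def G_def)
  qed
  then show ?thesis using C by blast
qed

text \<open>The exponent \<open>\<sigma>\<close> is such that the pointwise bound is exactly of weak type \<open>(p, r)\<close> after
  multiplication by \<open>\<bar>x\<bar>\<^sup>\<sigma>\<close>.\<close>

lemma weak_strong_interpolation:
  fixes H :: "'a::euclidean_space \<Rightarrow> ennreal"
  assumes [measurable]: "H \<in> borel_measurable borel"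
    and p: "1 < p" "p \<le> r" and \<sigma>: "\<sigma> = real DIM('a) * (1 / p - 1 / r)"
    and n: "0 < n" and C0: "0 < C0"
    and weak: "\<And>x. x \<noteq> 0 \<Longrightarrow> H x \<le> ennreal (C0 * n powr (1 / p) * norm x powr (- real DIM('a) / p))"
    and strong: "(\<integral>\<^sup>+x. ennpowr (H x) p \<partial>lborel) \<le> ennreal (C1 * n)"
  shows "(\<integral>\<^sup>+x. ennpowr (ennreal (norm x powr \<sigma>) * H x) r \<partial>lborel) \<le> ennreal (C0 powr (r - p) * C1 * n powr (r / p))"
proof -
  let ?d = "real DIM('a)"
  have "(\<integral>\<^sup>+x. ennpowr (ennreal (norm x powr \<sigma>) * H x) r \<partial>lborel)
    \<le> (\<integral>\<^sup>+x. ennreal (C0 powr (r - p) * n powr (r / p - 1)) * ennpowr (H x) p \<partial>lborel)"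
  proof (intro nn_integral_mono_AE, use AE_lborel_nonzero in eventually_elim)
    case (elim x)
    define B where "B = C0 * n powr (1 / p) * norm x powr (- ?d / p)"
    have B: "0 < B" using C0 n elim by (simp add: B_def)
    have "ennpowr (ennreal (norm x powr \<sigma>) * H x) r = ennpowr (ennreal (norm x powr \<sigma>)) r * ennpowr (H x) ((r - p) + p)"
      using p by (simp add: ennpowr_mult)
    also have "ennpowr (H x) ((r - p) + p) = ennpowr (H x) (r - p) * ennpowr (H x) p"
      using p by (intro ennpowr_add) auto
    also have "ennpowr (ennreal (norm x powr \<sigma>)) r = ennreal (norm x powr (\<sigma> * r))"
      using p by (simp add: ennpowr_ennreal powr_powr)
    also have "ennreal (norm x powr (\<sigma> * r)) * (ennpowr (H x) (r - p) * ennpowr (H x) p)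
      \<le> ennreal (norm x powr (\<sigma> * r)) * (ennreal (B powr (r - p)) * ennpowr (H x) p)"
    proof (intro mult_left_mono mult_right_mono)
      have "ennpowr (H x) (r - p) \<le> ennpowr (ennreal B) (r - p)"
        using p weak[OF elim] by (intro ennpowr_mono) (auto simp: B_def)
      then show "ennpowr (H x) (r - p) \<le> ennreal (B powr (r - p))" using B by (simp add: ennpowr_ennreal_pos)
    qed auto
    also have "\<dots> = ennreal (norm x powr (\<sigma> * r) * B powr (r - p)) * ennpowr (H x) p"
      by (simp add: ennreal_mult mult.assoc)
    also have "norm x powr (\<sigma> * r) * B powr (r - p) = C0 powr (r - p) * n powr (r / p - 1)"
    proof -
      have e1: "(1 / p) * (r - p) = r / p - 1" using p by (simp add: field_simps)
      \<comment> \<open>The powers of |x| cancel; this is what determines \<sigma>.\<close>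
      have e2: "\<sigma> * r + (- ?d / p) * (r - p) = 0" using p by (simp add: \<sigma> field_simps)
      have "B powr (r - p) = C0 powr (r - p) * n powr ((1 / p) * (r - p)) * norm x powr ((- ?d / p) * (r - p))"
        using C0 n by (simp only: B_def powr_mult powr_powr) 
      then have "norm x powr (\<sigma> * r) * B powr (r - p)
        = C0 powr (r - p) * n powr ((1 / p) * (r - p)) * (norm x powr (\<sigma> * r) * norm x powr ((- ?d / p) * (r - p)))"
        by (simp only: mult_ac)
      also have "norm x powr (\<sigma> * r) * norm x powr ((- ?d / p) * (r - p)) = 1"
        using elim unfolding powr_add[symmetric] e2 by simp
      finally show ?thesis unfolding e1 by simp
    qed
    finally show ?case .
  qed
  also have "\<dots> = ennreal (C0 powr (r - p) * n powr (r / p - 1)) * (\<integral>\<^sup>+x. ennpowr (H x) p \<partial>lborel)"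
    by (rule nn_integral_cmult) measurable
  also have "\<dots> \<le> ennreal (C0 powr (r - p) * n powr (r / p - 1)) * ennreal (C1 * n)"
    by (intro mult_left_mono strong) auto
  also have "\<dots> = ennreal (C0 powr (r - p) * n powr (r / p - 1) * (C1 * n))"
    by (rule ennreal_mult'[symmetric]) simp
  also have "C0 powr (r - p) * n powr (r / p - 1) * (C1 * n) = C0 powr (r - p) * C1 * n powr (r / p)"
    using n by (simp add: powr_diff)
  finally show ?thesis .
qed

lemma Holder_kernel:
  fixes h g :: "'a::euclidean_space \<Rightarrow> ennreal"
  assumes [measurable]: "h \<in> borel_measurable borel" "g \<in> borel_measurable borel"
    and p: "1 < p" "1 / p + 1 / q = 1"
    and n: "0 < n" "(\<integral>\<^sup>+y. ennpowr (h y) p \<partial>lborel) = ennreal n"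
    and g: "0 \<le> B" "(\<integral>\<^sup>+y. ennpowr (g y) q \<partial>lborel) \<le> ennreal B"
  shows "(\<integral>\<^sup>+y. g y * h y \<partial>lborel) \<le> ennreal (B powr (1 / q) * n powr (1 / p))"
proof -
  have "1 / q = 1 - 1 / p" "1 - 1 / p > 0" using p by simp_all
  then have q: "0 < q" by (metis zero_less_divide_1_iff)
  have "(\<integral>\<^sup>+y. g y * h y \<partial>lborel) = (\<integral>\<^sup>+y. h y * g y \<partial>lborel)" by (simp add: mult.commute)
  also have "\<dots> \<le> ennpowr (\<integral>\<^sup>+y. ennpowr (h y) p \<partial>lborel) (1 / p) * ennpowr (\<integral>\<^sup>+y. ennpowr (g y) q \<partial>lborel) (1 / q)"
    by (intro nn_integral_Holder_conj p) auto
  also have "\<dots> \<le> ennpowr (ennreal n) (1 / p) * ennpowr (ennreal B) (1 / q)"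
    unfolding n(2) using q by (intro mult_left_mono ennpowr_mono g) auto
  also have "\<dots> = ennreal (B powr (1 / q) * n powr (1 / p))"
    using n p q g by (simp add: ennpowr_ennreal ennreal_mult mult.commute)
  finally show ?thesis .
qed

text \<open>Hedberg's argument: the integral is split at the radius \<open>\<delta>\<close> that balances the maximal function against
  Hoelder's inequality.\<close>

lemma riesz_local_bound:
  assumes p: "1 < p" "p \<le> r" and e: "0 < e" and a: "0 \<le> a" "a \<le> e"
    and r: "1 / r = 1 / p + (a - e) / real DIM('a::euclidean_space)"
  shows "\<exists>C>0. \<forall>h\<in>borel_measurable borel. \<forall>n>0. (\<integral>\<^sup>+y. ennpowr (h y) p \<partial>lborel) = ennreal n \<longrightarrow>
    (\<forall>x::'a. x \<noteq> 0 \<longrightarrow>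
      ennreal (norm x powr (- a)) * (\<integral>\<^sup>+y. ennreal (if dist x y < 3 * norm x then dist x y powr (e - real DIM('a)) else 0) * h y \<partial>lborel)
        \<le> ennreal (C * n powr (1 / p - 1 / r)) * ennpowr (hlmax h x) (p / r))"
proof -
  define d where "d = real DIM('a)"
  have d: "0 < d" by (simp add: d_def)
  define \<sigma> where "\<sigma> = e - a"
  have \<sigma>0: "0 \<le> \<sigma>" using a by (simp add: \<sigma>_def)
  have \<sigma>: "\<sigma> / d = 1 / p - 1 / r" using r by (simp add: \<sigma>_def d_def diff_divide_distrib)
  have r0: "0 < r" using p by simp
  obtain q where q: "1 < q" "1 / p + 1 / q = 1" using conj_exponent[OF p(1)] .
  obtain K3 where K30: "K3 > 0 \<and> (\<forall>g\<in>borel_measurable borel. \<forall>x. \<forall>\<delta>>0.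
    (\<integral>\<^sup>+y. ennreal (if dist (x::'a) y < \<delta> then dist x y powr (e - real DIM('a)) else 0) * g y \<partial>lborel)
      \<le> ennreal (K3 * \<delta> powr e) * hlmax g x)"
    using truncated_riesz_le_hlmax[where 'a='a, OF e] by (rule exE)
  note K3 = conjunct1[OF K30] conjunct2[OF K30, rule_format, folded d_def]
  have \<sigma>': "\<sigma> = d / p - d / r" using \<sigma> d by (simp add: field_simps)
  have dq: "d / q = d - d / p"
  proof -
    have "1 / q = 1 - 1 / p" using q by simp
    then have "d * (1 / q) = d * (1 - 1 / p)" by simp
    then show ?thesis by (simp add: algebra_simps)
  qed
  \<comment> \<open>Integrability at infinity of the q-th power of |z| powr (\<sigma> - d), as
    Hoelder outside a ball requires. Since \<sigma> = d / p - d / r, it amounts to d / r >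
    0.\<close>
  have "(\<sigma> - d) * q < - d"
  proof -
    have "\<sigma> < d / p" using \<sigma>' d r0 by simp
    then have "\<sigma> - d < - (d / q)" using dq by simp
    then show ?thesis using q by (simp add: field_simps)
  qed
  then obtain K4 where K4: "K4 > 0" "\<And>R. R > 0 \<Longrightarrow> (\<integral>\<^sup>+y. ennreal (if R \<le> norm (y::'a) then norm y powr ((\<sigma> - d) * q) else 0) \<partial>lborel)
    \<le> ennreal (K4 * R powr ((\<sigma> - d) * q + d))"
    using nn_integral_norm_powr_outside[where 'a='a, of "(\<sigma> - d) * q"] unfolding d_def by blast
  define A where "A = 3 powr a * K3"
  define A' where "A' = 3 powr a * K4 powr (1 / q)"
  have A: "0 < A" "0 < A'" using K3(1) K4(1) by (simp_all add: A_def A'_def)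
  define C where "C = A + A'"
  have C: "0 < C" using A by (simp add: C_def)
  have "ennreal (norm x powr (- a)) * (\<integral>\<^sup>+y. ennreal (if dist x y < 3 * norm x then dist x y powr (e - d) else 0) * h y \<partial>lborel)
        \<le> ennreal (C * n powr (1 / p - 1 / r)) * ennpowr (hlmax h x) (p / r)"
    if [measurable]: "h \<in> borel_measurable borel" and n: "0 < n" and hn: "(\<integral>\<^sup>+y. ennpowr (h y) p \<partial>lborel) = ennreal n"
      and x: "x \<noteq> 0" for h n and x :: 'a
  proof (cases "hlmax h x")
    case top
    then have "ennpowr (hlmax h x) (p / r) = top" using p r0 by (metis ennpowr_top divide_eq_0_iff less_irrefl less_trans zero_less_one)
    moreover have "ennreal (C * n powr (1 / p - 1 / r)) \<noteq> 0" using C n by simp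
    ultimately have "ennreal (C * n powr (1 / p - 1 / r)) * ennpowr (hlmax h x) (p / r) = top"
      by (simp only: ennreal_mult_top if_False)
    then show ?thesis by simp
  next
    case (real k)
    let ?I = "ennreal (norm x powr (- a)) * (\<integral>\<^sup>+y. ennreal (if dist x y < 3 * norm x then dist x y powr (e - d) else 0) * h y \<partial>lborel)"
    have nx: "0 < norm x" using x by simp
    \<comment> \<open>As a \<ge> 0, the weight |x| powr (- a) is at most a constant times the same
      power of any radius up to 3 |x|. In this region it thus lowers the order of the kernel from e
      to \<sigma> = e - a.\<close>
    have na: "norm x powr (- a) \<le> 3 powr a * \<delta> powr (- a)" if "0 < \<delta>" "\<delta> \<le> 3 * norm x" for \<delta>
    proof -
      have "norm x powr (- a) \<le> (\<delta> / 3) powr (- a)"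
        using that a by (intro powr_mono2') auto
      also have "\<dots> = 3 powr a * \<delta> powr (- a)" by (simp add: powr_divide powr_minus_divide)
      finally show ?thesis .
    qed
    have near: "ennreal (norm x powr (- a)) * (\<integral>\<^sup>+y. ennreal (if dist x y < \<delta> then dist x y powr (e - d) else 0) * h y \<partial>lborel)
        \<le> ennreal (A * \<delta> powr \<sigma> * k)" if \<delta>: "0 < \<delta>" "\<delta> \<le> 3 * norm x" for \<delta>
    proof -
      have "ennreal (norm x powr (- a)) * (\<integral>\<^sup>+y. ennreal (if dist x y < \<delta> then dist x y powr (e - d) else 0) * h y \<partial>lborel)
         \<le> ennreal (3 powr a * \<delta> powr (- a)) * (ennreal (K3 * \<delta> powr e) * ennreal k)"
        using K3(2)[of h \<delta> x] \<delta> real by (intro mult_mono ennreal_leI na) auto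
      also have "\<dots> = ennreal (3 powr a * \<delta> powr (- a) * (K3 * \<delta> powr e * k))"
        using K3(1) real by (simp add: ennreal_mult[symmetric])
      also have "3 powr a * \<delta> powr (- a) * (K3 * \<delta> powr e * k) = A * (\<delta> powr (- a) * \<delta> powr e) * k"
        by (simp add: A_def)
      also have "\<delta> powr (- a) * \<delta> powr e = \<delta> powr \<sigma>" by (simp add: powr_add[symmetric] \<sigma>_def)
      finally show ?thesis .
    qed
    have far: "(\<integral>\<^sup>+y. ennreal (3 powr a * (if \<delta> \<le> dist x y then dist x y powr (\<sigma> - d) else 0)) * h y \<partial>lborel)
        \<le> ennreal (A' * \<delta> powr (- d / r) * n powr (1 / p))" if \<delta>: "0 < \<delta>" for \<delta>
    proof -
      let ?g = "\<lambda>y. ennreal (if \<delta> \<le> dist x y then dist x y powr (\<sigma> - d) else 0)"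
      have "(\<integral>\<^sup>+y. ennpowr (?g y) q \<partial>lborel) = (\<integral>\<^sup>+y. ennreal (if \<delta> \<le> norm (x - y) then norm (x - y) powr ((\<sigma> - d) * q) else 0) \<partial>lborel)"
        using q by (intro nn_integral_cong) (auto simp: dist_norm ennpowr_ennreal powr_powr)
      also have "\<dots> = (\<integral>\<^sup>+y. ennreal (if \<delta> \<le> norm (y::'a) then norm y powr ((\<sigma> - d) * q) else 0) \<partial>lborel)"
        by (rule nn_integral_lborel_reflect) measurable
      also have "\<dots> \<le> ennreal (K4 * \<delta> powr ((\<sigma> - d) * q + d))" by (rule K4(2)[OF \<delta>])
      finally have "(\<integral>\<^sup>+y. ?g y * h y \<partial>lborel) \<le> ennreal ((K4 * \<delta> powr ((\<sigma> - d) * q + d)) powr (1 / q) * n powr (1 / p))"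
        using K4(1) by (intro Holder_kernel[OF _ _ p(1) q(2) n hn]) auto
      also have "(K4 * \<delta> powr ((\<sigma> - d) * q + d)) powr (1 / q) = K4 powr (1 / q) * \<delta> powr (- d / r)"
      proof -
        have "((\<sigma> - d) * q + d) * (1 / q) = \<sigma> - d + d / q" using q by (simp add: field_simps)
        also have "\<dots> = - d / r" using \<sigma>' dq by simp
        finally show ?thesis using K4(1) by (simp only: powr_mult powr_powr)
      qed
      finally have le: "(\<integral>\<^sup>+y. ?g y * h y \<partial>lborel) \<le> ennreal (K4 powr (1 / q) * \<delta> powr (- d / r) * n powr (1 / p))" .
      have "(\<integral>\<^sup>+y. ennreal (3 powr a * (if \<delta> \<le> dist x y then dist x y powr (\<sigma> - d) else 0)) * h y \<partial>lborel)
         = (\<integral>\<^sup>+y. ennreal (3 powr a) * (?g y * h y) \<partial>lborel)"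
        by (intro nn_integral_cong) (auto simp: ennreal_mult mult.assoc)
      also have "\<dots> = ennreal (3 powr a) * (\<integral>\<^sup>+y. ?g y * h y \<partial>lborel)" by (rule nn_integral_cmult) measurable
      also have "\<dots> \<le> ennreal (3 powr a) * ennreal (K4 powr (1 / q) * \<delta> powr (- d / r) * n powr (1 / p))"
        by (intro mult_left_mono le) auto
      also have "\<dots> = ennreal (A' * \<delta> powr (- d / r) * n powr (1 / p))"
        by (simp add: A'_def ennreal_mult'[symmetric] mult.assoc)
      finally show ?thesis .
    qed
    \<comment> \<open>Below \<delta> the weight is traded at the radius \<delta>, beyond \<delta> at
      the distance dist x y itself; the second choice produces the kernel of order \<sigma> to which
      Hoelder applies.\<close>
    have both: "?I \<le> ennreal (A * \<delta> powr \<sigma> * k) + ennreal (A' * \<delta> powr (- d / r) * n powr (1 / p))"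
      if \<delta>: "0 < \<delta>" "\<delta> \<le> 3 * norm x" for \<delta>
    proof -
      have "?I = (\<integral>\<^sup>+y. ennreal (norm x powr (- a)) * (ennreal (if dist x y < 3 * norm x then dist x y powr (e - d) else 0) * h y) \<partial>lborel)"
        by (rule nn_integral_cmult[symmetric]) measurable
      also have "\<dots> \<le> (\<integral>\<^sup>+y. ennreal (norm x powr (- a)) * (ennreal (if dist x y < \<delta> then dist x y powr (e - d) else 0) * h y)
          + ennreal (3 powr a * (if \<delta> \<le> dist x y then dist x y powr (\<sigma> - d) else 0)) * h y \<partial>lborel)"
      proof (rule nn_integral_mono)
        fix y
        show "ennreal (norm x powr (- a)) * (ennreal (if dist x y < 3 * norm x then dist x y powr (e - d) else 0) * h y)
          \<le> ennreal (norm x powr (- a)) * (ennreal (if dist x y < \<delta> then dist x y powr (e - d) else 0) * h y)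
          + ennreal (3 powr a * (if \<delta> \<le> dist x y then dist x y powr (\<sigma> - d) else 0)) * h y"
        proof (cases "\<delta> \<le> dist x y \<and> dist x y < 3 * norm x")
          case True
          then have dp: "0 < dist x y" using \<delta> by linarith
          have "norm x powr (- a) * dist x y powr (e - d) \<le> (3 powr a * dist x y powr (- a)) * dist x y powr (e - d)"
            using dp True by (intro mult_right_mono na) auto
          also have "\<dots> = 3 powr a * dist x y powr (\<sigma> - d)"
            unfolding mult.assoc powr_add[symmetric] by (simp add: \<sigma>_def algebra_simps)
          finally have "ennreal (norm x powr (- a)) * ennreal (dist x y powr (e - d)) \<le> ennreal (3 powr a * dist x y powr (\<sigma> - d))"
            by (simp add: ennreal_mult[symmetric] ennreal_leI)
          then have "ennreal (norm x powr (- a)) * ennreal (dist x y powr (e - d)) * h y \<le> ennreal (3 powr a * dist x y powr (\<sigma> - d)) * h y"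
            by (rule mult_right_mono) simp
          then show ?thesis using True by (simp add: mult.assoc add_increasing)
        next
          case False
          then show ?thesis by (auto simp: add_increasing2)
        qed
      qed
      also have "\<dots> = ennreal (norm x powr (- a)) * (\<integral>\<^sup>+y. ennreal (if dist x y < \<delta> then dist x y powr (e - d) else 0) * h y \<partial>lborel)
          + (\<integral>\<^sup>+y. ennreal (3 powr a * (if \<delta> \<le> dist x y then dist x y powr (\<sigma> - d) else 0)) * h y \<partial>lborel)"
        by (subst nn_integral_add, measurable, subst nn_integral_cmult, measurable)
      also have "\<dots> \<le> ennreal (A * \<delta> powr \<sigma> * k) + ennreal (A' * \<delta> powr (- d / r) * n powr (1 / p))"
        by (intro add_mono near far \<delta>)
      finally show ?thesis .
    qed
    \<comment> \<open>Covers the case that the balancing radius exceeds 3 |x|: the maximal function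
      then controls the whole local integral.\<close>
    have whole: "?I \<le> ennreal (A * (3 * norm x) powr \<sigma> * k)"
      using near[of "3 * norm x"] nx by simp
    have pr: "0 < p / r" using p by simp
    show ?thesis
    proof (cases "k = 0")
      case True
      have "A * (3 * norm x) powr \<sigma> * k = 0" using True by simp
      then have "?I \<le> 0" using whole by (simp only: ennreal_0)
      also have "0 \<le> ennreal (C * n powr (1 / p - 1 / r)) * ennpowr (hlmax h x) (p / r)" by simp
      finally show ?thesis .
    next
      case False
      then have k: "0 < k" using real by simp
      \<comment> \<open>Solves \<delta> powr \<sigma> * k = \<delta> powr (- d / r) * n powr (1 /
        p), by \<sigma> + d / r = d / p. The common value is X.\<close>
      define \<delta> where "\<delta> = (n powr (1 / p) / k) powr (p / d)"
      have \<delta>: "0 < \<delta>" using n k by (simp add: \<delta>_def)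
      define X where "X = n powr (1 / p - 1 / r) * k powr (p / r)"
      have X: "0 < X" using n k by (simp add: X_def)
      have e1: "\<delta> powr \<sigma> * k = X"
      proof -
        have "(p / d) * \<sigma> = p * (\<sigma> / d)" by simp
        also have "\<dots> = 1 - p / r" using p unfolding \<sigma> by (simp add: field_simps)
        finally have ex: "(p / d) * \<sigma> = 1 - p / r" .
        have ex2: "(1 / p) * (1 - p / r) = 1 / p - 1 / r" using p by (simp add: field_simps)
        have "\<delta> powr \<sigma> = n powr (1 / p - 1 / r) / k powr (1 - p / r)"
          unfolding \<delta>_def powr_powr ex unfolding powr_divide powr_powr ex2 ..
        then show ?thesis using k by (simp add: X_def powr_diff)
      qed
      have e2: "\<delta> powr (- d / r) * n powr (1 / p) = X"
      proof -
        have ex: "(p / d) * (- d / r) = - (p / r)" using d by simp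
        have ex2: "(1 / p) * (- (p / r)) = - (1 / r)" using p by simp
        have eq: "\<delta> powr (- d / r) = n powr (- (1 / r)) / k powr (- (p / r))"
          unfolding \<delta>_def powr_powr ex unfolding powr_divide powr_powr ex2 ..
        have "\<delta> powr (- d / r) * n powr (1 / p) = (n powr (- (1 / r)) * n powr (1 / p)) * (1 / k powr (- (p / r)))"
          unfolding eq by (simp only: times_divide_eq_left times_divide_eq_right mult_1_right)
        also have "n powr (- (1 / r)) * n powr (1 / p) = n powr (1 / p - 1 / r)"
          by (simp add: powr_add[symmetric])
        also have "1 / k powr (- (p / r)) = k powr (p / r)" by (simp add: powr_minus_divide)
        finally show ?thesis by (simp only: X_def)
      qed
      have "?I \<le> ennreal (C * X)"
      proof (cases "\<delta> \<le> 3 * norm x")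
        case True
        have "?I \<le> ennreal (A * (\<delta> powr \<sigma> * k)) + ennreal (A' * (\<delta> powr (- d / r) * n powr (1 / p)))"
          using both[OF \<delta> True] by (simp only: mult.assoc)
        also have "\<dots> = ennreal (C * X)"
          unfolding e1 e2 using A X by (simp add: C_def distrib_right ennreal_plus)
        finally show ?thesis .
      next
        case False
        have "A * (3 * norm x) powr \<sigma> * k \<le> A * \<delta> powr \<sigma> * k"
          using False A k \<sigma>0 by (intro mult_right_mono mult_left_mono powr_mono2) auto
        also have "\<dots> = A * X" by (simp only: mult.assoc e1)
        also have "\<dots> \<le> C * X" using A X by (intro mult_right_mono) (auto simp: C_def)
        finally show ?thesis using whole by (meson ennreal_leI order_trans)
      qed
      also have "\<dots> = ennreal (C * n powr (1 / p - 1 / r)) * ennpowr (hlmax h x) (p / r)"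
        using real k C n by (simp add: X_def ennpowr_ennreal_pos ennreal_mult mult.assoc)
      finally show ?thesis .
    qed
  qed
  then show ?thesis using C unfolding d_def by blast
qed

text \<open>The kernel is split by comparing |y| with |x|. For very different norms it becomes a
  Hardy kernel, bounded from L^p to itself, and the pointwise decay of order |x| powr (- d / p)
  raises the exponent to r. For comparable norms the weight moves from x to y and the local bound
  applies. The borderline a = e, where r = p, is included.\<close>

theorem stein_weiss:
  assumes p: "1 < p" "p \<le> r" and e: "0 < e" and a: "0 \<le> a" "a \<le> e"
    and r: "1 / r = 1 / p + (a - e) / real DIM('a::euclidean_space)"
    and \<alpha>: "\<alpha> < real DIM('a) - real DIM('a) / p" and \<gamma>: "- real DIM('a) / r < \<alpha> - a"
  shows "\<exists>C>0. \<forall>u\<in>borel_measurable borel.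
    (\<integral>\<^sup>+x. ennpowr (ennreal (norm (x::'a) powr (\<alpha> - a)) * riesz e u x) r \<partial>lborel)
      \<le> ennreal C * ennpowr (\<integral>\<^sup>+x. ennpowr (ennreal (norm x powr \<alpha>) * u x) p \<partial>lborel) (r / p)"
proof -
  define d where "d = real DIM('a)"
  have d: "0 < d" by (simp add: d_def)
  define \<sigma> where "\<sigma> = e - a"
  have \<sigma>: "\<sigma> = d * (1 / p - 1 / r)" using r d by (simp add: \<sigma>_def d_def field_simps)
  have r0: "0 < r" "1 < r" using p by simp_all
  \<comment> \<open>For |y| \<ge> 2 |x| the kernel is of size |y| powr (e - d) = |y| powr (- d - b)
    * |y| powr \<alpha>, so b is the exponent of the outer Hardy kernel. By the scaling relation, b
    > - d / p is the lower bound assumed for \<alpha> - a.\<close>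
  define b where "b = \<alpha> - e"
  have b: "b > - d / p"
  proof -
    have "d / r = d / p + (a - e)" using r d r0 p by (simp add: d_def field_simps)
    then show ?thesis using \<gamma> by (simp add: b_def d_def)
  qed
  have ed: "e < d" using b \<alpha> by (simp add: b_def d_def)
  obtain q where q: "1 < q" "1 / p + 1 / q = 1" using conj_exponent[OF p(1)] .
  have dq: "d / q = d - d / p"
  proof -
    have "1 / q = 1 - 1 / p" using q by simp
    then have "d * (1 / q) = d * (1 - 1 / p)" by simp
    then show ?thesis by (simp add: algebra_simps)
  qed
  have "\<alpha> - d < - d / p" using \<alpha> by (simp add: d_def)
  then obtain C1 where C1: "C1 > 0" "\<And>h. h \<in> borel_measurable borel \<Longrightarrow>
    (\<integral>\<^sup>+x. ennpowr (\<integral>\<^sup>+y. ennreal (hardy_in (\<alpha> - d) (x::'a) y) * h y \<partial>lborel) p \<partial>lborel) \<le> ennreal C1 * (\<integral>\<^sup>+y. ennpowr (h y) p \<partial>lborel)"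
    using hardy_in_bounded[where 'a='a, OF p(1), of "\<alpha> - d"] unfolding d_def by blast
  obtain C2 where C2: "C2 > 0" "\<And>h. h \<in> borel_measurable borel \<Longrightarrow>
    (\<integral>\<^sup>+x. ennpowr (\<integral>\<^sup>+y. ennreal (hardy_out b (x::'a) y) * h y \<partial>lborel) p \<partial>lborel) \<le> ennreal C2 * (\<integral>\<^sup>+y. ennpowr (h y) p \<partial>lborel)"
    using hardy_out_bounded[where 'a='a, OF p(1), of b] b unfolding d_def by blast
  obtain C5 where C5: "C5 > 0" "\<And>h. h \<in> borel_measurable borel \<Longrightarrow>
    (\<integral>\<^sup>+x. ennpowr (hlmax h (x::'a)) p \<partial>lborel) \<le> ennreal C5 * (\<integral>\<^sup>+y. ennpowr (h y) p \<partial>lborel)"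
    using hlmax_strong_type[where 'a='a, OF p(1)] by auto
  have "- \<alpha> * q > - d"
  proof -
    have "\<alpha> < d / q" using \<alpha> dq by (simp add: d_def)
    then show ?thesis using q by (simp add: field_simps)
  qed
  then obtain K1 where K1: "K1 > 0" "\<And>R. R > 0 \<Longrightarrow> (\<integral>\<^sup>+y. ennreal (if norm (y::'a) \<le> R then norm y powr (- \<alpha> * q) else 0) \<partial>lborel)
    \<le> ennreal (K1 * R powr (- \<alpha> * q + d))"
    using nn_integral_norm_powr_inside[where 'a='a, of "- \<alpha> * q"] unfolding d_def by blast
  have "(- d - b) * q < - d"
  proof -
    have "- d - b < - (d / q)" using b dq by simp
    then show ?thesis using q by (simp add: field_simps)
  qed
  then obtain K2 where K2: "K2 > 0" "\<And>R. R > 0 \<Longrightarrow> (\<integral>\<^sup>+y. ennreal (if R \<le> norm (y::'a) then norm y powr ((- d - b) * q) else 0) \<partial>lborel)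
    \<le> ennreal (K2 * R powr ((- d - b) * q + d))"
    using nn_integral_norm_powr_outside[where 'a='a, of "(- d - b) * q"] unfolding d_def by blast
  obtain Cm where Cm0: "Cm>0 \<and> (\<forall>h\<in>borel_measurable borel. \<forall>n>0. (\<integral>\<^sup>+y. ennpowr (h y) p \<partial>lborel) = ennreal n \<longrightarrow>
    (\<forall>x::'a. x \<noteq> 0 \<longrightarrow>
      ennreal (norm x powr (- a)) * (\<integral>\<^sup>+y. ennreal (if dist x y < 3 * norm x then dist x y powr (e - real DIM('a)) else 0) * h y \<partial>lborel)
        \<le> ennreal (Cm * n powr (1 / p - 1 / r)) * ennpowr (hlmax h x) (p / r)))"
    using riesz_local_bound[where 'a='a, OF p e a r] by (rule exE)
  note Cm = conjunct1[OF Cm0] conjunct2[OF Cm0, rule_format]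
  define c where "c = 2 powr (d - e) + 2 powr \<bar>\<alpha>\<bar>"
  have c: "0 < c" "2 powr (d - e) \<le> c" "2 powr \<bar>\<alpha>\<bar> \<le> c" by (simp_all add: c_def add_pos_pos)
  define D1 where "D1 = (K1 powr (1 / q)) powr (r - p) * C1"
  define D2 where "D2 = (K2 powr (1 / q)) powr (r - p) * C2"
  define D3 where "D3 = Cm powr r * C5"
  have D: "0 < D1" "0 < D2" "0 < D3" using K1 K2 C1 C2 Cm(1) C5 by (simp_all add: D1_def D2_def D3_def)
  define C where "C = c powr r * (2 powr r * (2 powr r * (D1 + D2) + D3))"
  have C: "0 < C" using c D by (simp add: C_def add_pos_pos)
  have "(\<integral>\<^sup>+x. ennpowr (ennreal (norm (x::'a) powr (\<alpha> - a)) * riesz e u x) r \<partial>lborel)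
      \<le> ennreal C * ennpowr (\<integral>\<^sup>+x. ennpowr (ennreal (norm x powr \<alpha>) * u x) p \<partial>lborel) (r / p)"
    if [measurable]: "u \<in> borel_measurable borel" for u
  proof -
    define h where "h = (\<lambda>y::'a. ennreal (norm y powr \<alpha>) * u y)"
    have [measurable]: "h \<in> borel_measurable borel" unfolding h_def by measurable
    let ?N = "\<integral>\<^sup>+y. ennpowr (h y) p \<partial>lborel"
    have rp: "0 < r / p" using p by simp
    show ?thesis
    proof (cases "?N")
      case top
      then have "ennpowr ?N (r / p) = top" using rp by (metis ennpowr_top less_irrefl)
      then have "ennreal C * ennpowr ?N (r / p) = top"
        using C by (simp add: ennreal_mult_top)
      then show ?thesis by (simp add: h_def)
    next
      case (real n)
      show ?thesis
      \<comment> \<open>The estimates below require n > 0; the case n = 0 means that u vanishes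
        almost everywhere.\<close>
      proof (cases "n = 0")
        case True
        then have "AE y in lborel. ennpowr (h y) p = 0"
          using real by (subst nn_integral_0_iff_AE[symmetric]) auto
        then have u0: "AE y in lborel. u y = 0" using AE_lborel_nonzero
        proof eventually_elim
          case (elim y)
          then have "h y = 0" using p ennpowr_eq_0_iff[of p "h y"] by simp
          then show ?case using elim by (simp add: h_def)
        qed
        have "riesz e u x = 0" for x
          unfolding riesz_def by (subst nn_integral_0_iff_AE) (auto intro: eventually_mono[OF u0])
        then show ?thesis using r0 by simp
      next
        case False
        then have n: "0 < n" using real by simp
        have hn: "?N = ennreal n" using real by simp
        define H1 where "H1 = (\<lambda>x. \<integral>\<^sup>+y. ennreal (hardy_in (\<alpha> - d) x y) * h y \<partial>lborel)"
        define H2 where "H2 = (\<lambda>x. \<integral>\<^sup>+y. ennreal (hardy_out b x y) * h y \<partial>lborel)"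
        define H3 where "H3 = (\<lambda>x. ennreal (norm x powr (- a)) * (\<integral>\<^sup>+y. ennreal (if dist x y < 3 * norm x then dist x y powr (e - d) else 0) * h y \<partial>lborel))"
        have [measurable]: "H1 \<in> borel_measurable borel" "H2 \<in> borel_measurable borel" "H3 \<in> borel_measurable borel"
          unfolding H1_def H2_def H3_def by measurable
        have powq: "(K * norm x powr (- d * q + d)) powr (1 / q) = K powr (1 / q) * norm x powr (- d / p)" for K and x :: 'a
        proof -
          have "(- d * q + d) * (1 / q) = - d + d / q" using q by (simp add: field_simps)
          also have "\<dots> = - d / p" using dq by simp
          finally show ?thesis by (simp only: powr_mult powr_powr)
        qed
        \<comment> \<open>Hoelder against the kernel: by homogeneity the powers of |x| from the
          kernel and from the radius of integration combine to |x| powr (- d / p), the decay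
          required for raising the exponent.\<close>
        have w1: "H1 x \<le> ennreal (K1 powr (1 / q) * n powr (1 / p) * norm x powr (- d / p))" if x: "x \<noteq> 0" for x
        proof -
          have "(\<integral>\<^sup>+y. ennpowr (ennreal (hardy_in (\<alpha> - d) x y)) q \<partial>lborel)
            = (\<integral>\<^sup>+y. ennreal (norm x powr ((\<alpha> - d) * q)) * ennreal (if norm (y::'a) \<le> norm x then norm y powr (- \<alpha> * q) else 0) \<partial>lborel)"
            using q by (intro nn_integral_cong)
              (auto simp: hardy_in_def ennpowr_ennreal powr_mult powr_powr ennreal_mult d_def)
          also have "\<dots> = ennreal (norm x powr ((\<alpha> - d) * q)) * (\<integral>\<^sup>+y. ennreal (if norm (y::'a) \<le> norm x then norm y powr (- \<alpha> * q) else 0) \<partial>lborel)"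
            by (rule nn_integral_cmult) measurable
          also have "\<dots> \<le> ennreal (norm x powr ((\<alpha> - d) * q)) * ennreal (K1 * norm x powr (- \<alpha> * q + d))"
            using x by (intro mult_left_mono K1) auto
          also have "\<dots> = ennreal (K1 * (norm x powr ((\<alpha> - d) * q) * norm x powr (- \<alpha> * q + d)))"
            using K1(1) by (simp add: ennreal_mult[symmetric] mult_ac)
          also have "norm x powr ((\<alpha> - d) * q) * norm x powr (- \<alpha> * q + d) = norm x powr (- d * q + d)"
            unfolding powr_add[symmetric] by (simp add: algebra_simps)
          finally have "H1 x \<le> ennreal ((K1 * norm x powr (- d * q + d)) powr (1 / q) * n powr (1 / p))"
            unfolding H1_def using K1(1) by (intro Holder_kernel[OF _ _ p(1) q(2) n hn]) auto
          then show ?thesis unfolding powq by (simp only: mult_ac)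
        qed
        have w2: "H2 x \<le> ennreal (K2 powr (1 / q) * n powr (1 / p) * norm x powr (- d / p))" if x: "x \<noteq> 0" for x
        proof -
          have "(\<integral>\<^sup>+y. ennpowr (ennreal (hardy_out b x y)) q \<partial>lborel)
            = (\<integral>\<^sup>+y. ennreal (norm x powr (b * q)) * ennreal (if norm x \<le> norm (y::'a) then norm y powr ((- d - b) * q) else 0) \<partial>lborel)"
            using q by (intro nn_integral_cong)
              (auto simp: hardy_out_def ennpowr_ennreal powr_mult powr_powr ennreal_mult d_def)
          also have "\<dots> = ennreal (norm x powr (b * q)) * (\<integral>\<^sup>+y. ennreal (if norm x \<le> norm (y::'a) then norm y powr ((- d - b) * q) else 0) \<partial>lborel)"
            by (rule nn_integral_cmult) measurable
          also have "\<dots> \<le> ennreal (norm x powr (b * q)) * ennreal (K2 * norm x powr ((- d - b) * q + d))"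
            using x by (intro mult_left_mono K2) auto
          also have "\<dots> = ennreal (K2 * (norm x powr (b * q) * norm x powr ((- d - b) * q + d)))"
            using K2(1) by (simp add: ennreal_mult[symmetric] mult_ac)
          also have "norm x powr (b * q) * norm x powr ((- d - b) * q + d) = norm x powr (- d * q + d)"
            unfolding powr_add[symmetric] by (simp add: algebra_simps)
          finally have "H2 x \<le> ennreal ((K2 * norm x powr (- d * q + d)) powr (1 / q) * n powr (1 / p))"
            unfolding H2_def using K2(1) by (intro Holder_kernel[OF _ _ p(1) q(2) n hn]) auto
          then show ?thesis unfolding powq by (simp only: mult_ac)
        qed
        have s1: "(\<integral>\<^sup>+x. ennpowr (ennreal (norm x powr \<sigma>) * H1 x) r \<partial>lborel) \<le> ennreal (D1 * n powr (r / p))"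
          unfolding D1_def
        proof (rule weak_strong_interpolation)
          show "(\<integral>\<^sup>+x. ennpowr (H1 x) p \<partial>lborel) \<le> ennreal (C1 * n)"
            using C1(2)[of h] C1(1) n by (simp add: H1_def hn ennreal_mult)
        qed (use p \<sigma> n K1(1) w1 in \<open>auto simp: d_def\<close>)
        have s2: "(\<integral>\<^sup>+x. ennpowr (ennreal (norm x powr \<sigma>) * H2 x) r \<partial>lborel) \<le> ennreal (D2 * n powr (r / p))"
          unfolding D2_def
        proof (rule weak_strong_interpolation)
          show "(\<integral>\<^sup>+x. ennpowr (H2 x) p \<partial>lborel) \<le> ennreal (C2 * n)"
            using C2(2)[of h] C2(1) n by (simp add: H2_def hn ennreal_mult)
        qed (use p \<sigma> n K2(1) w2 in \<open>auto simp: d_def\<close>)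
        have s3: "(\<integral>\<^sup>+x. ennpowr (H3 x) r \<partial>lborel) \<le> ennreal (D3 * n powr (r / p))"
        proof -
          have "(\<integral>\<^sup>+x. ennpowr (H3 x) r \<partial>lborel) \<le> (\<integral>\<^sup>+x. ennreal (Cm powr r * n powr (r / p - 1)) * ennpowr (hlmax h x) p \<partial>lborel)"
          proof (intro nn_integral_mono_AE, use AE_lborel_nonzero in eventually_elim)
            case (elim x)
            have "ennpowr (H3 x) r \<le> ennpowr (ennreal (Cm * n powr (1 / p - 1 / r)) * ennpowr (hlmax h x) (p / r)) r"
              using r0 Cm(2)[OF _ n hn elim] unfolding H3_def d_def by (intro ennpowr_mono) auto
            also have "\<dots> = ennpowr (ennreal (Cm * n powr (1 / p - 1 / r))) r * ennpowr (hlmax h x) p"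
              using r0 p by (simp add: ennpowr_mult ennpowr_ennpowr)
            also have "ennpowr (ennreal (Cm * n powr (1 / p - 1 / r))) r = ennreal (Cm powr r * n powr ((1 / p - 1 / r) * r))"
              using r0 Cm(1) n by (simp add: ennpowr_ennreal powr_mult powr_powr)
            also have "(1 / p - 1 / r) * r = r / p - 1" using r0 by (simp add: field_simps)
            finally show ?case .
          qed
          also have "\<dots> = ennreal (Cm powr r * n powr (r / p - 1)) * (\<integral>\<^sup>+x. ennpowr (hlmax h x) p \<partial>lborel)"
            by (rule nn_integral_cmult) measurable
          also have "\<dots> \<le> ennreal (Cm powr r * n powr (r / p - 1)) * (ennreal C5 * ennreal n)"
            using C5(2)[of h] by (intro mult_left_mono) (auto simp: hn)
          also have "\<dots> = ennreal (D3 * n powr (r / p))"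
            using C5(1) n by (simp add: D3_def ennreal_mult[symmetric] powr_diff)
          finally show ?thesis .
        qed
        have split: "norm x powr (\<alpha> - a) * dist x y powr (e - d)
            \<le> c * (norm x powr \<sigma> * hardy_in (\<alpha> - d) x y + norm x powr \<sigma> * hardy_out b x y
                + norm x powr (- a) * (if dist x y < 3 * norm x then dist x y powr (e - d) else 0)) * norm y powr \<alpha>"
          (is "?L \<le> c * (?P + ?Q + ?R) * _")
          if xy: "x \<noteq> 0" "y \<noteq> 0" for x y :: 'a
        proof -
          have tri: "norm x - norm y \<le> dist x y" "norm y - norm x \<le> dist x y" "dist x y \<le> norm x + norm y"
            using norm_triangle_ineq2[of x y] norm_triangle_ineq2[of y x] norm_triangle_ineq4[of x y]
            by (simp_all add: dist_norm norm_minus_commute)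
          have ne: "0 < norm x" "0 < norm y" using xy by auto
          have PQR: "0 \<le> ?P" "0 \<le> ?Q" "0 \<le> ?R" by auto
          have ds: "dist x y powr (e - d) \<le> 2 powr (d - e) * z powr (e - d)" if "0 < z" "z / 2 \<le> dist x y" for z
          proof -
            have "dist x y powr (e - d) \<le> (z / 2) powr (e - d)" using that ed by (intro powr_mono2') auto
            also have "\<dots> = 2 powr (d - e) * z powr (e - d)" by (simp add: powr_divide powr_diff)
            finally show ?thesis .
          qed
          \<comment> \<open>In the first two cases the distance is at least half the larger norm,
            and since e < d the kernel decreases with the distance, so it is bounded by a power of
            that norm.\<close>
          consider "norm y \<le> norm x / 2" | "2 * norm x \<le> norm y" | "norm x / 2 < norm y" "norm y < 2 * norm x" by linarith
          then show ?thesis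
          proof cases
            case 1
            have yx: "norm y \<le> norm x" using 1 ne by linarith
            have "?L \<le> norm x powr (\<alpha> - a) * (2 powr (d - e) * norm x powr (e - d))"
              using 1 tri ne by (intro mult_left_mono ds) auto
            also have "\<dots> \<le> norm x powr (\<alpha> - a) * (c * norm x powr (e - d))"
              using c by (intro mult_left_mono mult_right_mono) auto
            also have "\<dots> = c * ?P * norm y powr \<alpha>"
            proof -
              have "norm x powr (\<alpha> - a) * norm x powr (e - d) = norm x powr \<sigma> * norm x powr (\<alpha> - d)"
                unfolding powr_add[symmetric] by (simp add: \<sigma>_def algebra_simps)
              moreover have "norm y powr (- d - (\<alpha> - d)) * norm y powr \<alpha> = 1"
                unfolding powr_add[symmetric] using ne by simp
              ultimately show ?thesis using yx by (simp add: hardy_in_def d_def[symmetric])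
            qed
            also have "\<dots> \<le> c * (?P + ?Q + ?R) * norm y powr \<alpha>"
              using c PQR by (intro mult_right_mono mult_left_mono) auto
            finally show ?thesis .
          next
            case 2
            have yx: "norm x \<le> norm y" using 2 ne by linarith
            have "?L \<le> norm x powr (\<alpha> - a) * (2 powr (d - e) * norm y powr (e - d))"
              using 2 tri ne by (intro mult_left_mono ds) auto
            also have "\<dots> \<le> norm x powr (\<alpha> - a) * (c * norm y powr (e - d))"
              using c by (intro mult_left_mono mult_right_mono) auto
            also have "\<dots> = c * ?Q * norm y powr \<alpha>"
            proof -
              have "norm x powr (\<alpha> - a) = norm x powr \<sigma> * norm x powr b"
                unfolding powr_add[symmetric] by (simp add: \<sigma>_def b_def)
              moreover have "norm y powr (- d - b) * norm y powr \<alpha> = norm y powr (e - d)"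
                unfolding powr_add[symmetric] by (simp add: b_def)
              ultimately show ?thesis using yx by (simp add: hardy_out_def d_def[symmetric])
            qed
            also have "\<dots> \<le> c * (?P + ?Q + ?R) * norm y powr \<alpha>"
              using c PQR by (intro mult_right_mono mult_left_mono) auto
            finally show ?thesis .
          next
            case 3
            have d3: "dist x y < 3 * norm x" using 3 tri by linarith
            have "norm x powr \<alpha> \<le> 2 powr \<bar>\<alpha>\<bar> * norm y powr \<alpha>"
              using 3 ne by (intro powr_comparable) auto
            also have "\<dots> \<le> c * norm y powr \<alpha>" using c by (intro mult_right_mono) auto
            finally have xa: "norm x powr \<alpha> \<le> c * norm y powr \<alpha>" .
            have "?L = norm x powr \<alpha> * (norm x powr (- a) * dist x y powr (e - d))"
              by (simp add: powr_diff powr_minus divide_inverse)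
            also have "\<dots> \<le> (c * norm y powr \<alpha>) * (norm x powr (- a) * dist x y powr (e - d))"
              using xa by (intro mult_right_mono) auto
            also have "\<dots> = c * ?R * norm y powr \<alpha>" using d3 by simp
            also have "\<dots> \<le> c * (?P + ?Q + ?R) * norm y powr \<alpha>"
              using c PQR by (intro mult_right_mono mult_left_mono) auto
            finally show ?thesis .
          qed
        qed
        have pw: "ennreal (norm x powr (\<alpha> - a)) * riesz e u x
            \<le> ennreal c * ((ennreal (norm x powr \<sigma>) * H1 x + ennreal (norm x powr \<sigma>) * H2 x) + H3 x)" if x: "x \<noteq> 0" for x :: 'a
        proof -
          let ?k1 = "\<lambda>y. ennreal (hardy_in (\<alpha> - d) x y) * h y"
          let ?k2 = "\<lambda>y. ennreal (hardy_out b x y) * h y"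
          let ?k3 = "\<lambda>y. ennreal (if dist x y < 3 * norm x then dist x y powr (e - d) else 0) * h y"
          have "ennreal (norm x powr (\<alpha> - a)) * riesz e u x
             = (\<integral>\<^sup>+y. ennreal (norm x powr (\<alpha> - a)) * (ennreal (dist x y powr (e - d)) * u y) \<partial>lborel)"
            unfolding riesz_def d_def by (rule nn_integral_cmult[symmetric]) measurable
          also have "\<dots> \<le> (\<integral>\<^sup>+y. ennreal c * ((ennreal (norm x powr \<sigma>) * ?k1 y + ennreal (norm x powr \<sigma>) * ?k2 y)
               + ennreal (norm x powr (- a)) * ?k3 y) \<partial>lborel)"
          proof (intro nn_integral_mono_AE, use AE_lborel_nonzero in eventually_elim)
            case (elim y)
            have "ennreal (norm x powr (\<alpha> - a)) * (ennreal (dist x y powr (e - d)) * u y)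
               = ennreal (norm x powr (\<alpha> - a) * dist x y powr (e - d)) * u y"
              by (simp add: ennreal_mult mult.assoc)
            also have "\<dots> \<le> ennreal (c * (norm x powr \<sigma> * hardy_in (\<alpha> - d) x y + norm x powr \<sigma> * hardy_out b x y
                + norm x powr (- a) * (if dist x y < 3 * norm x then dist x y powr (e - d) else 0)) * norm y powr \<alpha>) * u y"
              by (intro mult_right_mono ennreal_leI split x elim) auto
            also have "\<dots> = ennreal c * ((ennreal (norm x powr \<sigma>) * ?k1 y + ennreal (norm x powr \<sigma>) * ?k2 y)
               + ennreal (norm x powr (- a)) * ?k3 y)"
              using c by (simp add: h_def ennreal_mult ennreal_plus distrib_left distrib_right mult_ac)
            finally show ?case .
          qed
          also have "\<dots> = ennreal c * ((ennreal (norm x powr \<sigma>) * H1 x + ennreal (norm x powr \<sigma>) * H2 x) + H3 x)"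
            unfolding H1_def H2_def H3_def by (simp add: nn_integral_cmult nn_integral_add)
          finally show ?thesis .
        qed
        have "(\<integral>\<^sup>+x. ennpowr (ennreal (norm (x::'a) powr (\<alpha> - a)) * riesz e u x) r \<partial>lborel)
          \<le> (\<integral>\<^sup>+x. ennreal (c powr r) * (ennreal (2 powr r) * (ennreal (2 powr r) *
              (ennpowr (ennreal (norm x powr \<sigma>) * H1 x) r + ennpowr (ennreal (norm x powr \<sigma>) * H2 x) r) + ennpowr (H3 x) r)) \<partial>lborel)"
        proof (intro nn_integral_mono_AE, use AE_lborel_nonzero in eventually_elim)
          case (elim x)
          let ?A = "ennreal (norm x powr \<sigma>) * H1 x" and ?B = "ennreal (norm x powr \<sigma>) * H2 x"
          have "ennpowr (ennreal (norm x powr (\<alpha> - a)) * riesz e u x) r \<le> ennpowr (ennreal c * ((?A + ?B) + H3 x)) r"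
            using r0 by (intro ennpowr_mono pw elim) auto
          also have "\<dots> = ennreal (c powr r) * ennpowr ((?A + ?B) + H3 x) r"
            using c r0 by (simp add: ennpowr_mult[of _ "ennreal c"] ennpowr_ennreal)
          also have "\<dots> \<le> ennreal (c powr r) * (ennreal (2 powr r) * (ennpowr (?A + ?B) r + ennpowr (H3 x) r))"
            using r0 by (intro mult_left_mono ennpowr_add_le) auto
          also have "\<dots> \<le> ennreal (c powr r) * (ennreal (2 powr r) * (ennreal (2 powr r) * (ennpowr ?A r + ennpowr ?B r) + ennpowr (H3 x) r))"
            using r0 by (intro mult_left_mono add_right_mono ennpowr_add_le) auto
          finally show ?case .
        qed
        also have "\<dots> = ennreal (c powr r) * (ennreal (2 powr r) * (ennreal (2 powr r) *
              ((\<integral>\<^sup>+x. ennpowr (ennreal (norm x powr \<sigma>) * H1 x) r \<partial>lborel) + (\<integral>\<^sup>+x. ennpowr (ennreal (norm x powr \<sigma>) * H2 x) r \<partial>lborel))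
                + (\<integral>\<^sup>+x. ennpowr (H3 x) r \<partial>lborel)))"
          by (simp add: nn_integral_cmult nn_integral_add)
        also have "\<dots> \<le> ennreal (c powr r) * (ennreal (2 powr r) * (ennreal (2 powr r) *
              (ennreal (D1 * n powr (r / p)) + ennreal (D2 * n powr (r / p))) + ennreal (D3 * n powr (r / p))))"
          by (intro mult_left_mono add_mono s1 s2 s3) auto
        also have "\<dots> = ennreal (C * n powr (r / p))"
          using D by (simp add: ennreal_plus[symmetric] ennreal_mult'[symmetric] C_def algebra_simps del: ennreal_plus)
        also have "\<dots> = ennreal C * ennpowr (ennreal n) (r / p)"
          using C n by (simp add: ennpowr_ennreal_pos ennreal_mult)
        finally show ?thesis using hn by (simp add: h_def)
      qed
    qed
  qed
  then show ?thesis using C by blast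
qed

section \<open>The weighted Gagliardo--Nirenberg inequality\<close>

text \<open>The \<open>Lp_norm\<close> of a \<open>weighted\<close> function, transferred to values
  in [0, \<infinity>], the form in which all estimates are made.\<close>

definition weighted_norm :: "real \<Rightarrow> real \<Rightarrow> ('a::euclidean_space \<Rightarrow> ennreal) \<Rightarrow> ennreal" where
  "weighted_norm p \<alpha> U = ennpowr (\<integral>\<^sup>+x. ennpowr (ennreal (norm x powr \<alpha>) * U x) p \<partial>lborel) (1 / p)"

definition abs_potential :: "real \<Rightarrow> real \<Rightarrow> ('a::euclidean_space \<Rightarrow> complex) \<Rightarrow> 'a \<Rightarrow> ennreal" where
  "abs_potential \<kappa> z f = abs_inv_fourier (\<lambda>\<xi>. of_real (symbol \<kappa> \<xi> powr (z / 2)) * fourier f \<xi>)"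

lemma measurable_abs_potential [measurable]:
  fixes f :: "'a::euclidean_space \<Rightarrow> complex"
  assumes [measurable]: "f \<in> borel_measurable borel"
  shows "abs_potential \<kappa> z f \<in> borel_measurable borel"
  unfolding abs_potential_def by measurable

lemma Lp_norm_weighted:
  fixes g :: "'a::euclidean_space \<Rightarrow> complex"
  assumes "0 < p"
  shows "Lp_norm p (weighted \<alpha> g) = weighted_norm p \<alpha> (\<lambda>x. ennreal (norm (g x)))"
proof -
  have "ennreal (norm (weighted \<alpha> g x) powr p) = ennpowr (ennreal (norm x powr \<alpha>) * ennreal (norm (g x))) p" for x
    using assms by (simp add: weighted_def norm_mult ennreal_mult[symmetric] ennpowr_ennreal)
  then show ?thesis by (simp add: Lp_norm_def weighted_norm_def)
qed

text \<open>At the origin both expressions for the symbol are 0, also for z = 0, so they agree at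
  every frequency.\<close>

lemma D_op_eq_abs_potential:
  fixes f :: "'a::euclidean_space \<Rightarrow> complex"
  shows "(\<lambda>x. ennreal (norm (D_op (of_real z) f x))) = abs_potential 0 z f"
proof -
  have "complex_of_real (norm \<xi>) powr complex_of_real z = complex_of_real (symbol 0 \<xi> powr (z / 2))" for \<xi> :: 'a
  proof -
    have "((norm \<xi>)\<^sup>2) powr (z / 2) = norm \<xi> powr z"
      by (cases "\<xi> = 0") (simp_all add: powr_powr flip: powr_numeral)
    then show ?thesis by (simp add: powr_of_real symbol_def)
  qed
  then show ?thesis by (simp add: abs_potential_def abs_inv_fourier_def D_op_def)
qed

lemma J_op_eq_abs_potential:
  fixes f :: "'a::euclidean_space \<Rightarrow> complex"
  shows "(\<lambda>x. ennreal (norm (J_op (of_real z) f x))) = abs_potential 1 z f"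
proof -
  have "complex_of_real (japanese_bracket \<xi>) powr complex_of_real z = complex_of_real (symbol 1 \<xi> powr (z / 2))" for \<xi> :: 'a
  proof -
    have "0 \<le> 1 + (norm \<xi>)\<^sup>2" by simp
    then have "japanese_bracket \<xi> = (1 + (norm \<xi>)\<^sup>2) powr (1 / 2)"
      unfolding japanese_bracket_def by (simp only: powr_half_sqrt)
    then have "japanese_bracket \<xi> powr z = symbol 1 \<xi> powr (z / 2)"
      by (simp add: powr_powr symbol_def)
    moreover have "0 \<le> japanese_bracket \<xi>" by (simp add: japanese_bracket_def)
    ultimately show ?thesis by (simp add: powr_of_real)
  qed
  then show ?thesis by (simp add: abs_potential_def abs_inv_fourier_def J_op_def)
qed

text \<open>For \<kappa> = 0 the zeroth power of the symbol is 0 and not 1 at the origin, so it is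
  trivial only almost everywhere; the rest is Fourier inversion.\<close>

lemma abs_potential_0:
  fixes f :: "'a::euclidean_space \<Rightarrow> complex"
  assumes f: "f \<in> schwartz_space" and \<kappa>: "0 \<le> \<kappa>"
  shows "abs_potential \<kappa> 0 f = (\<lambda>x. ennreal (norm (f x)))" "abs_inv_fourier (fourier f) = (\<lambda>x. ennreal (norm (f x)))"
proof -
  have [measurable]: "f \<in> borel_measurable borel" using f by (rule schwartz_measurable)
  have "AE \<xi> in lborel. complex_of_real (symbol \<kappa> (\<xi>::'a) powr (0 / 2)) * fourier f \<xi> = fourier f \<xi>"
    using AE_lborel_nonzero by eventually_elim (use symbol_pos[OF \<kappa>, where 'a='a] in \<open>force\<close>)
  then have "inv_fourier (\<lambda>\<xi>. complex_of_real (symbol \<kappa> \<xi> powr (0 / 2)) * fourier f \<xi>) x = f x" for x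
    using fourier_inversion[OF f, of x] by (subst inv_fourier_cong_AE[of _ "fourier f"]) measurable
  then show "abs_potential \<kappa> 0 f = (\<lambda>x. ennreal (norm (f x)))" by (simp only: abs_potential_def abs_inv_fourier_def)
  show "abs_inv_fourier (fourier f) = (\<lambda>x. ennreal (norm (f x)))" by (simp add: abs_inv_fourier_def fourier_inversion[OF f])
qed

text \<open>Raise the pointwise interpolation of order \<theta> s to the power \<rho>, apply
  Hoelder, and remove the iterates of the maximal operator in the two weighted spaces. The endpoints
  \<theta> = 0 and \<theta> = 1, which the pointwise inequality excludes, hold here with constant
  1.\<close>

lemma interpolation_norm:
  assumes p: "1 < p" and q: "1 < q" and s: "0 < s" and \<kappa>: "0 \<le> \<kappa>" "\<kappa> \<le> 1"
    and \<theta>: "0 \<le> \<theta>" "\<theta> \<le> 1"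
    and \<alpha>: "- real DIM('a::euclidean_space) / p < \<alpha>" "\<alpha> < real DIM('a) - real DIM('a) / p"
    and \<beta>: "- real DIM('a) / q < \<beta>" "\<beta> < real DIM('a) - real DIM('a) / q"
    and \<rho>: "0 < \<rho>" "1 / \<rho> = \<theta> / p + (1 - \<theta>) / q"
  shows "\<exists>C>0. \<forall>f\<in>(schwartz_space :: ('a \<Rightarrow> complex) set).
    weighted_norm \<rho> (\<theta> * \<alpha> + (1 - \<theta>) * \<beta>) (abs_potential \<kappa> (\<theta> * s) f)
      \<le> ennreal C * (ennpowr (weighted_norm p \<alpha> (abs_potential \<kappa> s f)) \<theta> * ennpowr (weighted_norm q \<beta> (abs_potential \<kappa> 0 f)) (1 - \<theta>))"
proof -
  consider "\<theta> = 0" | "\<theta> = 1" | "0 < \<theta>" "\<theta> < 1" using \<theta> by linarith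
  then show ?thesis
  proof cases
    case 1
    then have "\<rho> = q" using \<rho> q by (simp add: field_simps)
    then show ?thesis using 1 by (intro exI[of _ 1]) simp
  next
    case 2
    then have "\<rho> = p" using \<rho> p by (simp add: field_simps)
    then show ?thesis using 2 by (intro exI[of _ 1]) simp
  next
    case 3
    define \<alpha>' where "\<alpha>' = \<theta> * \<alpha> + (1 - \<theta>) * \<beta>"
    have \<theta>s: "0 < \<theta> * s" "\<theta> * s < s" "\<theta> * s / s = \<theta>" using 3 s by simp_all
    obtain m C0 where C00: "C0>0 \<and> (\<forall>\<kappa>\<ge>0. \<forall>F::'a \<Rightarrow> complex. integrable lborel F \<longrightarrow>
      integrable lborel (\<lambda>\<xi>. of_real (symbol \<kappa> \<xi> powr (s / 2)) * F \<xi>) \<longrightarrow>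
      integrable lborel (\<lambda>\<xi>. of_real (symbol \<kappa> \<xi> powr (\<theta> * s / 2)) * F \<xi>) \<longrightarrow>
      (\<forall>x. abs_inv_fourier (\<lambda>\<xi>. of_real (symbol \<kappa> \<xi> powr (\<theta> * s / 2)) * F \<xi>) x
        \<le> ennreal C0 * (ennpowr ((hlmax ^^ (m * 2)) (abs_inv_fourier (\<lambda>\<xi>. of_real (symbol \<kappa> \<xi> powr (s / 2)) * F \<xi>)) x) (\<theta> * s / s)
            * ennpowr ((hlmax ^^ m) (abs_inv_fourier F) x) (1 - \<theta> * s / s))))"
      using pointwise_interpolation[where 'a='a, OF \<theta>s(1,2)] by (elim exE) blast
    note C0 = conjunct1[OF C00] conjunct2[OF C00, rule_format, unfolded \<theta>s(3)]
    obtain C1 where C1: "C1 > 0" "\<And>u. u \<in> borel_measurable borel \<Longrightarrow>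
      (\<integral>\<^sup>+x. ennpowr (ennreal (norm x powr \<alpha>) * (hlmax ^^ (m * 2)) u (x::'a)) p \<partial>lborel)
        \<le> ennreal C1 * (\<integral>\<^sup>+x. ennpowr (ennreal (norm x powr \<alpha>) * u x) p \<partial>lborel)"
      using hlmax_funpow_weighted[OF p \<alpha>] by blast
    obtain C2 where C2: "C2 > 0" "\<And>u. u \<in> borel_measurable borel \<Longrightarrow>
      (\<integral>\<^sup>+x. ennpowr (ennreal (norm x powr \<beta>) * (hlmax ^^ m) u (x::'a)) q \<partial>lborel)
        \<le> ennreal C2 * (\<integral>\<^sup>+x. ennpowr (ennreal (norm x powr \<beta>) * u x) q \<partial>lborel)"
      using hlmax_funpow_weighted[OF q \<beta>] by blast
    \<comment> \<open>The share of \<theta> / p in 1 / \<rho>. It makes \<theta> * \<rho> = p * l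
      and (1 - \<theta>) * \<rho> = q * (1 - l), so that Hoelder produces exactly the p-th and q-th
      power integrals.\<close>
    define l where "l = \<theta> * \<rho> / p"
    have l1: "1 - l = (1 - \<theta>) * \<rho> / q"
    proof -
      have "1 = \<rho> * (\<theta> / p + (1 - \<theta>) / q)" using \<rho> by (simp add: field_simps)
      then show ?thesis by (simp add: l_def algebra_simps)
    qed
    have l: "0 < l" "l < 1"
    proof -
      show "0 < l" using 3 \<rho> p by (simp add: l_def)
      have "0 < 1 - l" unfolding l1 using 3 \<rho> q by simp
      then show "l < 1" by simp
    qed
    define D where "D = C1 powr l * C2 powr (1 - l)"
    have D: "0 < D" using C1 C2 by (simp add: D_def)
    define C where "C = C0 * D powr (1 / \<rho>)"
    have C: "0 < C" using C0(1) D by (simp add: C_def)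
    have "weighted_norm \<rho> \<alpha>' (abs_potential \<kappa> (\<theta> * s) f)
      \<le> ennreal C * (ennpowr (weighted_norm p \<alpha> (abs_potential \<kappa> s f)) \<theta> * ennpowr (weighted_norm q \<beta> (abs_potential \<kappa> 0 f)) (1 - \<theta>))"
      if f: "f \<in> schwartz_space" for f :: "'a \<Rightarrow> complex"
    proof -
      have [measurable]: "f \<in> borel_measurable borel" using f by (rule schwartz_measurable)
      define U1 where "U1 = (hlmax ^^ (m * 2)) (abs_potential \<kappa> s f)"
      define U2 where "U2 = (hlmax ^^ m) (abs_potential \<kappa> 0 f)"
      have [measurable]: "U1 \<in> borel_measurable borel" "U2 \<in> borel_measurable borel"
        unfolding U1_def U2_def by measurable
      have pw: "abs_potential \<kappa> (\<theta> * s) f x \<le> ennreal C0 * (ennpowr (U1 x) \<theta> * ennpowr (U2 x) (1 - \<theta>))" for x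
        using C0(2)[OF \<kappa>(1) integrable_fourier[OF f] integrable_symbol_fourier[OF f \<kappa>] integrable_symbol_fourier[OF f \<kappa>], of x]
          s \<theta>s(1)
        by (simp add: U1_def U2_def abs_potential_0[OF f \<kappa>(1)]) (simp add: abs_potential_def)
      define W1 where "W1 = (\<lambda>x. ennreal (norm x powr \<alpha>) * U1 x)"
      define W2 where "W2 = (\<lambda>x. ennreal (norm x powr \<beta>) * U2 x)"
      have [measurable]: "W1 \<in> borel_measurable borel" "W2 \<in> borel_measurable borel"
        unfolding W1_def W2_def by measurable
      define I1 where "I1 = (\<integral>\<^sup>+x. ennpowr (ennreal (norm x powr \<alpha>) * abs_potential \<kappa> s f x) p \<partial>lborel)"
      define I2 where "I2 = (\<integral>\<^sup>+x. ennpowr (ennreal (norm x powr \<beta>) * abs_potential \<kappa> 0 f x) q \<partial>lborel)"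
      have "(\<integral>\<^sup>+x. ennpowr (ennreal (norm x powr \<alpha>') * abs_potential \<kappa> (\<theta> * s) f x) \<rho> \<partial>lborel)
        \<le> (\<integral>\<^sup>+x. ennreal (C0 powr \<rho>) * (ennpowr (ennpowr (W1 x) p) l * ennpowr (ennpowr (W2 x) q) (1 - l)) \<partial>lborel)"
      proof (intro nn_integral_mono_AE, use AE_lborel_nonzero in eventually_elim)
        case (elim x)
        have "ennreal (norm x powr \<alpha>') = ennpowr (ennreal (norm x powr \<alpha>)) \<theta> * ennpowr (ennreal (norm x powr \<beta>)) (1 - \<theta>)"
          using elim by (simp add: ennpowr_ennreal_pos powr_powr ennreal_mult[symmetric] powr_add[symmetric] \<alpha>'_def mult.commute)
        then have "ennreal (norm x powr \<alpha>') * abs_potential \<kappa> (\<theta> * s) f x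
          \<le> (ennpowr (ennreal (norm x powr \<alpha>)) \<theta> * ennpowr (ennreal (norm x powr \<beta>)) (1 - \<theta>)) * (ennreal C0 * (ennpowr (U1 x) \<theta> * ennpowr (U2 x) (1 - \<theta>)))"
          using pw[of x] by (simp add: mult_left_mono)
        also have "\<dots> = ennreal C0 * (ennpowr (W1 x) \<theta> * ennpowr (W2 x) (1 - \<theta>))"
          using 3 by (simp add: W1_def W2_def ennpowr_mult mult_ac)
        finally have "ennpowr (ennreal (norm x powr \<alpha>') * abs_potential \<kappa> (\<theta> * s) f x) \<rho>
          \<le> ennpowr (ennreal C0 * (ennpowr (W1 x) \<theta> * ennpowr (W2 x) (1 - \<theta>))) \<rho>"
          using \<rho> by (intro ennpowr_mono) auto
        also have "\<dots> = ennreal (C0 powr \<rho>) * (ennpowr (W1 x) (\<theta> * \<rho>) * ennpowr (W2 x) ((1 - \<theta>) * \<rho>))"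
          using \<rho> 3 C0(1) by (simp add: ennpowr_mult ennpowr_ennpowr ennpowr_ennreal_pos)
        also have "\<theta> * \<rho> = p * l" using p by (simp add: l_def)
        also have "(1 - \<theta>) * \<rho> = q * (1 - l)" using q unfolding l1 by simp
        finally show ?case using p q l by (simp add: ennpowr_ennpowr)
      qed
      also have "\<dots> = ennreal (C0 powr \<rho>) * (\<integral>\<^sup>+x. ennpowr (ennpowr (W1 x) p) l * ennpowr (ennpowr (W2 x) q) (1 - l) \<partial>lborel)"
        by (rule nn_integral_cmult) measurable
      also have "\<dots> \<le> ennreal (C0 powr \<rho>) * (ennpowr (\<integral>\<^sup>+x. ennpowr (W1 x) p \<partial>lborel) l * ennpowr (\<integral>\<^sup>+x. ennpowr (W2 x) q \<partial>lborel) (1 - l))"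
        by (intro mult_left_mono nn_integral_Holder l) auto
      also have "\<dots> \<le> ennreal (C0 powr \<rho>) * (ennpowr (ennreal C1 * I1) l * ennpowr (ennreal C2 * I2) (1 - l))"
        using l C1(2)[of "abs_potential \<kappa> s f"] C2(2)[of "abs_potential \<kappa> 0 f"]
        unfolding W1_def W2_def U1_def U2_def I1_def I2_def
        by (intro mult_left_mono mult_mono ennpowr_mono) auto
      also have "\<dots> = ennreal (C0 powr \<rho> * D) * (ennpowr I1 l * ennpowr I2 (1 - l))"
        using l C1(1) C2(1) by (simp add: D_def ennpowr_mult ennpowr_ennreal_pos ennreal_mult mult_ac)
      finally have "weighted_norm \<rho> \<alpha>' (abs_potential \<kappa> (\<theta> * s) f) \<le> ennpowr (ennreal (C0 powr \<rho> * D) * (ennpowr I1 l * ennpowr I2 (1 - l))) (1 / \<rho>)"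
        unfolding weighted_norm_def using \<rho>(1) by (intro ennpowr_mono) auto
      also have "\<dots> = ennreal C * (ennpowr I1 (l * (1 / \<rho>)) * ennpowr I2 ((1 - l) * (1 / \<rho>)))"
        using \<rho>(1) l C0(1) D by (simp add: ennpowr_mult ennpowr_ennpowr ennpowr_ennreal_pos powr_mult powr_powr C_def)
      also have "l * (1 / \<rho>) = (1 / p) * \<theta>" using \<rho>(1) by (simp add: l_def)
      also have "(1 - l) * (1 / \<rho>) = (1 / q) * (1 - \<theta>)" unfolding l1 using \<rho>(1) by simp
      finally show ?thesis using p q \<theta> by (simp add: weighted_norm_def I1_def I2_def ennpowr_ennpowr)
    qed
    then show ?thesis using C unfolding \<alpha>'_def by blast
  qed
qed

lemma stein_weiss_norm:
  assumes p: "1 < p" "p \<le> r" and e: "0 < e" and a: "0 \<le> a" "a \<le> e"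
    and r: "1 / r = 1 / p + (a - e) / real DIM('a::euclidean_space)"
    and \<alpha>: "\<alpha> < real DIM('a) - real DIM('a) / p" and \<gamma>: "- real DIM('a) / r < \<alpha> - a"
    and t: "0 \<le> t" and \<kappa>: "0 \<le> \<kappa>" "\<kappa> \<le> 1"
  shows "\<exists>C>0. \<forall>f\<in>(schwartz_space :: ('a \<Rightarrow> complex) set).
    weighted_norm r (\<alpha> - a) (abs_potential \<kappa> t f) \<le> ennreal C * weighted_norm p \<alpha> (abs_potential \<kappa> (t + e) f)"
proof -
  let ?d = "real DIM('a)"
  have r0: "0 < r" using p by simp
  \<comment> \<open>With the scaling relation the two bounds on the weights combine to e < \<alpha>
    + d / p < d, the range in which the Riesz kernel is available.\<close>
  have "?d / r = ?d / p + (a - e)" using r r0 p by (simp add: field_simps)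
  then have ed: "e < ?d" using \<alpha> \<gamma> by simp
  obtain C0 where C00: "C0>0 \<and> (\<forall>\<kappa>\<ge>0. \<forall>a. \<forall>F::'a \<Rightarrow> complex. F \<in> borel_measurable borel \<longrightarrow>
    integrable lborel (\<lambda>\<xi>. of_real (symbol \<kappa> \<xi> powr a) * F \<xi>) \<longrightarrow>
    integrable lborel (\<lambda>\<xi>. of_real (symbol \<kappa> \<xi> powr (a + e / 2)) * F \<xi>) \<longrightarrow>
    (\<forall>x. abs_inv_fourier (\<lambda>\<xi>. of_real (symbol \<kappa> \<xi> powr a) * F \<xi>) x
      \<le> ennreal C0 * riesz e (abs_inv_fourier (\<lambda>\<xi>. of_real (symbol \<kappa> \<xi> powr (a + e / 2)) * F \<xi>)) x))"
    using negative_power_le_riesz[where 'a='a, OF e ed] by (rule exE)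
  note C0 = conjunct1[OF C00] conjunct2[OF C00, rule_format]
  obtain C1 where C1: "C1 > 0" "\<And>u. u \<in> borel_measurable borel \<Longrightarrow>
    (\<integral>\<^sup>+x. ennpowr (ennreal (norm (x::'a) powr (\<alpha> - a)) * riesz e u x) r \<partial>lborel)
      \<le> ennreal C1 * ennpowr (\<integral>\<^sup>+x. ennpowr (ennreal (norm x powr \<alpha>) * u x) p \<partial>lborel) (r / p)"
    using stein_weiss[OF p e a r \<alpha> \<gamma>] by blast
  define C where "C = C0 * C1 powr (1 / r)"
  have C: "0 < C" using C0(1) C1(1) by (simp add: C_def)
  have "weighted_norm r (\<alpha> - a) (abs_potential \<kappa> t f) \<le> ennreal C * weighted_norm p \<alpha> (abs_potential \<kappa> (t + e) f)"
    if f: "f \<in> schwartz_space" for f :: "'a \<Rightarrow> complex"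
  proof -
    have [measurable]: "f \<in> borel_measurable borel" using f by (rule schwartz_measurable)
    let ?u = "abs_potential \<kappa> (t + e) f"
    have te: "t / 2 + e / 2 = (t + e) / 2" by simp
    have pw: "abs_potential \<kappa> t f x \<le> ennreal C0 * riesz e ?u x" for x
      using C0(2)[OF \<kappa>(1) measurable_fourier integrable_symbol_fourier[OF f \<kappa>] integrable_symbol_fourier[OF f \<kappa>], of "t / 2" x]
        t e unfolding te abs_potential_def by simp
    have "(\<integral>\<^sup>+x. ennpowr (ennreal (norm x powr (\<alpha> - a)) * abs_potential \<kappa> t f x) r \<partial>lborel)
      \<le> (\<integral>\<^sup>+x. ennreal (C0 powr r) * ennpowr (ennreal (norm x powr (\<alpha> - a)) * riesz e ?u x) r \<partial>lborel)"
    proof (rule nn_integral_mono)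
      fix x :: 'a
      have "ennpowr (ennreal (norm x powr (\<alpha> - a)) * abs_potential \<kappa> t f x) r
        \<le> ennpowr (ennreal (norm x powr (\<alpha> - a)) * (ennreal C0 * riesz e ?u x)) r"
        using r0 by (intro ennpowr_mono mult_left_mono pw) auto
      also have "\<dots> = ennreal (C0 powr r) * ennpowr (ennreal (norm x powr (\<alpha> - a)) * riesz e ?u x) r"
        using r0 C0(1) by (simp add: ennpowr_mult ennpowr_ennreal_pos mult_ac)
      finally show "ennpowr (ennreal (norm x powr (\<alpha> - a)) * abs_potential \<kappa> t f x) r \<le> \<dots>" .
    qed
    also have "\<dots> = ennreal (C0 powr r) * (\<integral>\<^sup>+x. ennpowr (ennreal (norm x powr (\<alpha> - a)) * riesz e ?u x) r \<partial>lborel)"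
      by (rule nn_integral_cmult) measurable
    also have "\<dots> \<le> ennreal (C0 powr r) * (ennreal C1 * ennpowr (\<integral>\<^sup>+x. ennpowr (ennreal (norm x powr \<alpha>) * ?u x) p \<partial>lborel) (r / p))"
      by (intro mult_left_mono C1) auto
    finally have "weighted_norm r (\<alpha> - a) (abs_potential \<kappa> t f)
      \<le> ennpowr (ennreal (C0 powr r) * (ennreal C1 * ennpowr (\<integral>\<^sup>+x. ennpowr (ennreal (norm x powr \<alpha>) * ?u x) p \<partial>lborel) (r / p))) (1 / r)"
      unfolding weighted_norm_def using r0 by (intro ennpowr_mono) auto
    also have "\<dots> = ennreal C * weighted_norm p \<alpha> ?u"
      using r0 p C0(1) C1(1) by (simp add: weighted_norm_def C_def ennpowr_mult ennpowr_ennpowr ennpowr_ennreal_pos powr_powr ennreal_mult mult.assoc)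
    finally show ?thesis .
  qed
  then show ?thesis using C by blast
qed

lemma gagliardo_nirenberg_abs_potential:
  assumes p: "1 < p" and q: "1 < q" and r: "1 < r"
    and st: "0 \<le> t" "t < s" and \<kappa>: "0 \<le> \<kappa>" "\<kappa> \<le> 1"
    and \<theta>: "t / s \<le> \<theta>" "\<theta> \<le> 1"
    and \<alpha>: "- real DIM('a::euclidean_space) / p < \<alpha>" "\<alpha> < real DIM('a) - real DIM('a) / p"
    and \<beta>: "- real DIM('a) / q < \<beta>" "\<beta> < real DIM('a) - real DIM('a) / q"
    and \<gamma>: "- real DIM('a) / r < \<gamma>"
    and scaling: "1 / r - (t - \<gamma>) / real DIM('a)
        = \<theta> * (1 / p - (s - \<alpha>) / real DIM('a)) + (1 - \<theta>) * (1 / q + \<beta> / real DIM('a))"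
    and weights: "0 \<le> \<theta> * \<alpha> + (1 - \<theta>) * \<beta> - \<gamma>" "\<theta> * \<alpha> + (1 - \<theta>) * \<beta> - \<gamma> \<le> \<theta> * s - t"
  shows "\<exists>C>0. \<forall>f\<in>(schwartz_space :: ('a \<Rightarrow> complex) set).
    weighted_norm r \<gamma> (abs_potential \<kappa> t f)
      \<le> ennreal C * ennpowr (weighted_norm p \<alpha> (abs_potential \<kappa> s f)) \<theta> * ennpowr (weighted_norm q \<beta> (abs_potential \<kappa> 0 f)) (1 - \<theta>)"
proof -
  define d where "d = real DIM('a)"
  have d: "0 < d" by (simp add: d_def)
  have s: "0 < s" using st by simp
  have \<theta>0: "0 \<le> \<theta>" using \<theta> st s by (meson divide_nonneg_pos order_trans)
  \<comment> \<open>x is 1 / \<rho>, a convex combination of 1 / p and 1 / q and hence strictly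
    between 0 and 1; \<rho> is the exponent reached by interpolation at order \<theta> s.\<close>
  define x where "x = \<theta> / p + (1 - \<theta>) / q"
  have x: "0 < x" "x < 1"
  proof -
    have pq: "0 < 1 / p" "1 / p < 1" "0 < 1 / q" "1 / q < 1" using p q by simp_all
    have x_eq: "x = \<theta> * (1 / p) + (1 - \<theta>) * (1 / q)" by (simp add: x_def)
    show "0 < x"
    proof (cases "\<theta> = 0")
      case False
      then have "0 < \<theta> * (1 / p)" using \<theta>0 pq by (intro mult_pos_pos) auto
      then show ?thesis unfolding x_eq using \<theta> pq by (intro add_pos_nonneg) auto
    qed (use q in \<open>simp add: x_def\<close>)
    have "x \<le> \<theta> * max (1 / p) (1 / q) + (1 - \<theta>) * max (1 / p) (1 / q)"
      unfolding x_eq using \<theta>0 \<theta> by (intro add_mono mult_left_mono) auto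
    also have "\<dots> = max (1 / p) (1 / q)" by (simp add: algebra_simps)
    also have "\<dots> < 1" using pq by simp
    finally show "x < 1" .
  qed
  define \<rho> where "\<rho> = 1 / x"
  have \<rho>: "0 < \<rho>" "1 / \<rho> = \<theta> / p + (1 - \<theta>) / q" "1 < \<rho>" using x by (simp_all add: \<rho>_def x_def[symmetric])
  define \<alpha>' where "\<alpha>' = \<theta> * \<alpha> + (1 - \<theta>) * \<beta>"
  \<comment> \<open>a is the gap in the weight and e the gap in the order between the interpolated
    norm and the one to be estimated.\<close>
  define a where "a = \<alpha>' - \<gamma>"
  define e where "e = \<theta> * s - t"
  have ae: "0 \<le> a" "a \<le> e" using weights by (simp_all add: a_def e_def \<alpha>'_def)
  have r_eq: "1 / r = 1 / \<rho> + (a - e) / d"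
    using scaling unfolding \<rho>(2) a_def e_def \<alpha>'_def d_def[symmetric]
    by (simp add: diff_divide_distrib add_divide_distrib algebra_simps)
  have \<alpha>'_lt: "\<alpha>' < d - d / \<rho>"
  proof -
    have "\<alpha>' < \<theta> * (d - d / p) + (1 - \<theta>) * (d - d / q)"
    \<comment> \<open>Strictness must come from a term with positive coefficient: from \<beta> if
      \<theta> = 0 and from \<alpha> otherwise.\<close>
    proof (cases "\<theta> = 0")
      case True
      then show ?thesis using \<beta> by (simp add: \<alpha>'_def d_def)
    next
      case False
      then have "\<theta> * \<alpha> < \<theta> * (d - d / p)" using \<theta>0 \<alpha> by (simp add: d_def)
      moreover have "(1 - \<theta>) * \<beta> \<le> (1 - \<theta>) * (d - d / q)" using \<theta> \<beta> by (intro mult_left_mono) (auto simp: d_def)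
      ultimately show ?thesis unfolding \<alpha>'_def by linarith
    qed
    also have "\<dots> = d - d * (\<theta> / p + (1 - \<theta>) / q)" by (simp add: algebra_simps)
    also have "\<dots> = d - d / \<rho>" unfolding \<rho>(2)[symmetric] by simp
    finally show ?thesis .
  qed
  obtain C1 where C1: "C1 > 0" "\<And>f. f \<in> (schwartz_space :: ('a \<Rightarrow> complex) set) \<Longrightarrow>
    weighted_norm \<rho> \<alpha>' (abs_potential \<kappa> (\<theta> * s) f)
      \<le> ennreal C1 * (ennpowr (weighted_norm p \<alpha> (abs_potential \<kappa> s f)) \<theta> * ennpowr (weighted_norm q \<beta> (abs_potential \<kappa> 0 f)) (1 - \<theta>))"
    using interpolation_norm[OF p q s \<kappa> \<theta>0 \<theta>(2) \<alpha> \<beta> \<rho>(1,2)] unfolding \<alpha>'_def by blast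
  have "\<exists>C>0. \<forall>f\<in>(schwartz_space :: ('a \<Rightarrow> complex) set).
    weighted_norm r \<gamma> (abs_potential \<kappa> t f) \<le> ennreal C * weighted_norm \<rho> \<alpha>' (abs_potential \<kappa> (\<theta> * s) f)"
  \<comment> \<open>Without a gap in the order there is none in the weight, and the scaling relation
    gives r = \<rho>. Otherwise a \<le> e gives \<rho> \<le> r, as Stein--Weiss requires.\<close>
  proof (cases "e = 0")
    case True
    then have "a = 0" using ae by simp
    then have "\<gamma> = \<alpha>'" "t = \<theta> * s" "1 / r = 1 / \<rho>" using True r_eq by (simp_all add: a_def e_def)
    moreover from this have "r = \<rho>" by simp
    ultimately show ?thesis by (intro exI[of _ 1]) simp
  next
    case False
    then have e: "0 < e" using ae by simp
    have "(a - e) / d \<le> 0" using ae d by (simp add: divide_nonpos_pos)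
    then have "1 / r \<le> 1 / \<rho>" using r_eq by simp
    then have \<rho>r: "\<rho> \<le> r" using \<rho>(1) r by (simp add: field_simps)
    have g: "\<alpha>' - a = \<gamma>" "t + e = \<theta> * s" by (simp_all add: a_def e_def)
    show ?thesis
      using stein_weiss_norm[where 'a='a, OF \<rho>(3) \<rho>r e ae r_eq[unfolded d_def] \<alpha>'_lt[unfolded d_def] _ st(1) \<kappa>] \<gamma>
      unfolding g by simp
  qed
  then obtain C2 where C2: "C2 > 0" "\<And>f. f \<in> (schwartz_space :: ('a \<Rightarrow> complex) set) \<Longrightarrow>
    weighted_norm r \<gamma> (abs_potential \<kappa> t f) \<le> ennreal C2 * weighted_norm \<rho> \<alpha>' (abs_potential \<kappa> (\<theta> * s) f)" by blast
  have "weighted_norm r \<gamma> (abs_potential \<kappa> t f)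
      \<le> ennreal (C2 * C1) * ennpowr (weighted_norm p \<alpha> (abs_potential \<kappa> s f)) \<theta> * ennpowr (weighted_norm q \<beta> (abs_potential \<kappa> 0 f)) (1 - \<theta>)"
    if f: "f \<in> schwartz_space" for f :: "'a \<Rightarrow> complex"
  proof -
    have "weighted_norm r \<gamma> (abs_potential \<kappa> t f) \<le> ennreal C2 * (ennreal C1 * (ennpowr (weighted_norm p \<alpha> (abs_potential \<kappa> s f)) \<theta> * ennpowr (weighted_norm q \<beta> (abs_potential \<kappa> 0 f)) (1 - \<theta>)))"
      by (rule order_trans[OF C2(2)[OF f]]) (intro mult_left_mono C1 f, simp)
    then show ?thesis using C1(1) C2(1) by (simp add: ennreal_mult mult.assoc)
  qed
  moreover have "0 < C2 * C1" using C1(1) C2(1) by simp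
  ultimately show ?thesis by blast
qed

theorem theorem1p6:
  fixes p q r p' q' s t \<theta> \<alpha> \<beta> \<gamma> d :: real
  assumes d: "d = real DIM('a::euclidean_space)"
    and p: "1 < p" and q: "1 < q" and r: "1 < r"
    and p': "1 / p + 1 / p' = 1" and q': "1 / q + 1 / q' = 1"
    and st: "0 \<le> t" "t < s"
    and \<theta>: "t / s \<le> \<theta>" "\<theta> \<le> 1"
    and \<alpha>: "- d / p < \<alpha>" "\<alpha> < d / p'"
    and \<beta>: "- d / q < \<beta>" "\<beta> < d / q'"
    and \<gamma>: "- d / r < \<gamma>"
    and scaling: "1 / r - (t - \<gamma>) / d
        = \<theta> * (1 / p - (s - \<alpha>) / d) + (1 - \<theta>) * (1 / q + \<beta> / d)"
    and weights: "0 \<le> \<theta> * \<alpha> + (1 - \<theta>) * \<beta> - \<gamma>"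
      "\<theta> * \<alpha> + (1 - \<theta>) * \<beta> - \<gamma> \<le> \<theta> * s - t"
  shows "(\<exists>C>0. \<forall>f \<in> (schwartz_space :: ('a \<Rightarrow> complex) set).
            Lp_norm r (weighted \<gamma> (D_op (of_real t) f))
            \<le> ennreal C * ennpowr (Lp_norm p (weighted \<alpha> (D_op (of_real s) f))) \<theta>
                * ennpowr (Lp_norm q (weighted \<beta> f)) (1 - \<theta>))
       \<and> (\<exists>C>0. \<forall>f \<in> (schwartz_space :: ('a \<Rightarrow> complex) set).
            Lp_norm r (weighted \<gamma> (J_op (of_real t) f))
            \<le> ennreal C * ennpowr (Lp_norm p (weighted \<alpha> (J_op (of_real s) f))) \<theta>
                * ennpowr (Lp_norm q (weighted \<beta> f)) (1 - \<theta>))"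
proof -
  have conj: "d / y = d - d / x" if "1 / x + 1 / y = 1" for x y
  proof -
    have "1 / y = 1 - 1 / x" using that by simp
    then have "d * (1 / y) = d * (1 - 1 / x)" by (rule arg_cong)
    then show ?thesis by (simp add: algebra_simps)
  qed
  note \<alpha>' = \<alpha>[unfolded conj[OF p'], unfolded d] and \<beta>' = \<beta>[unfolded conj[OF q'], unfolded d]
  have pos: "0 < p" "0 < q" "0 < r" using p q r by simp_all
  note key = gagliardo_nirenberg_abs_potential[where 'a='a, OF p q r st _ _ \<theta> \<alpha>' \<beta>' \<gamma>[unfolded d] scaling[unfolded d] weights]
  have f0: "abs_potential \<kappa> 0 f = (\<lambda>x. ennreal (norm (f x)))" if "0 \<le> \<kappa>" "f \<in> schwartz_space" for \<kappa> and f :: "'a \<Rightarrow> complex"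
    using that by (intro abs_potential_0)
  obtain CD where CD: "CD > 0" "\<And>f. f \<in> (schwartz_space :: ('a \<Rightarrow> complex) set) \<Longrightarrow>
    weighted_norm r \<gamma> (abs_potential 0 t f) \<le> ennreal CD * ennpowr (weighted_norm p \<alpha> (abs_potential 0 s f)) \<theta> * ennpowr (weighted_norm q \<beta> (abs_potential 0 0 f)) (1 - \<theta>)"
    using key[of 0] by auto
  obtain CJ where CJ: "CJ > 0" "\<And>f. f \<in> (schwartz_space :: ('a \<Rightarrow> complex) set) \<Longrightarrow>
    weighted_norm r \<gamma> (abs_potential 1 t f) \<le> ennreal CJ * ennpowr (weighted_norm p \<alpha> (abs_potential 1 s f)) \<theta> * ennpowr (weighted_norm q \<beta> (abs_potential 1 0 f)) (1 - \<theta>)"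
    using key[of 1] by auto
  show ?thesis
    unfolding Lp_norm_weighted[OF pos(1)] Lp_norm_weighted[OF pos(2)] Lp_norm_weighted[OF pos(3)]
      D_op_eq_abs_potential J_op_eq_abs_potential
  proof (intro conjI)
    show "\<exists>C>0. \<forall>f\<in>(schwartz_space :: ('a \<Rightarrow> complex) set). weighted_norm r \<gamma> (abs_potential 0 t f)
      \<le> ennreal C * ennpowr (weighted_norm p \<alpha> (abs_potential 0 s f)) \<theta> * ennpowr (weighted_norm q \<beta> (\<lambda>x. ennreal (norm (f x)))) (1 - \<theta>)"
      using CD f0[of 0] by (intro exI[of _ CD]) simp
    show "\<exists>C>0. \<forall>f\<in>(schwartz_space :: ('a \<Rightarrow> complex) set). weighted_norm r \<gamma> (abs_potential 1 t f)
      \<le> ennreal C * ennpowr (weighted_norm p \<alpha> (abs_potential 1 s f)) \<theta> * ennpowr (weighted_norm q \<beta> (\<lambda>x. ennreal (norm (f x)))) (1 - \<theta>)"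
      using CJ f0[of 1] by (intro exI[of _ CJ]) simp
  qed
qed

end
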